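(* Let $L$ be a finite language and $\varphi$ a basic $L$-sentence without built-in symbols that fails in some infinite model. Then there exist a model $\langle N,\alpha^N\rangle$ of $\forall\mathsf{T}^1_2(\mathsf{PV}(\alpha))$ and $n\in N\setminus\{0\}$ such that $\mathbf B(L,n,\alpha^N)\not\models\varphi$. Moreover, if $\psi(x)$ is a $\mathsf{PV}$-formula that defines an unbounded set in $\mathbb N$, then $N,n$ can be chosen such that $N$ is a $\mathsf{PV}$-cut in an elementary extension $M$ of $\mathbb N$, $N$ is subexponential in $n$, and $M\models\psi(n)$.
   Context: $\mathsf{PV}$: language with a binary relation $<$ and a function symbol for every polynomial-time Turing machine; $\mathbb N$ its standard model. $|x|$ binary length, $\mathit{bit}(i,a)$ bits, $\langle\cdots\rangle$ a $\mathsf{PV}$-computable tupling. $\mathsf{PV}(\alpha)$ adds unary relation symbol $\alpha$ and a symbol for every polynomial-time oracle machine; $\forall\mathsf{PV}(\alpha)$ = universal $\mathsf{PV}(\alpha)$-sentences true in $\langle\mathbb N,\alpha^{\mathbb N}\rangle$ for all $\alpha^{\mathbb N}\subseteq\mathbb N$. $\forall\mathsf{T}^1_2(\mathsf{PV}(\alpha))$ = $\forall\mathsf{PV}(\alpha)$ + minimization $\chi(x,\bar x)\to\exists y{\le}x(\chi(y,\bar x)\wedge\forall z{<}y\neg\chi(z,\bar x))$ for $\chi\in\Sigma^b_1(\mathsf{PV}(\alpha))$ (closure of sharply bounded $\mathsf{PV}(\alpha)$-formulas under $\wedge,\vee$, sharply bounded quantifiers and $\exists x{<}t$). Every model of this theory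 is an expansion $\langle N,\alpha^N\rangle$ of a $(\mathsf{PV}\cup\{\alpha\})$-structure $(N,\alpha^N)$. A basic $L$-sentence ($L$ finite, disjoint from $\mathsf{PV}$, symbols identified with numbers) has form $\exists\bar y\bigvee_i\bigwedge_j\lambda_{ij}$ with literals $R(\bar u),\neg R(\bar u),f(\bar u)=v,\neg u=v,u=v$; without built-in symbols means all symbols are from $L$. For $n\in N\setminus\{0\}$ and $X\subseteq N$, $\mathbf B(L,n,X)$ is the $L$-structure on $[n]=\{a\in N:a<n\}$ interpreting relation symbol $S$ by $\{\bar a:\langle S,\bar a\rangle\in X\}$ and function symbol $S$ by $\bar a\mapsto\min\{a,n-1\}$ where $a$ is the unique element below $2^{|n|}$ with $\mathit{bit}(i,a)=1\iff\langle S,\bar a,i\rangle\in X$ for all $i<|n|$ (all computed in $N$). A $\mathsf{PV}$-cut of $M$ is a substructure $N$ of the $\mathsf{PV}$-reduct of $M$ closed downward under $<^M$. $N$ is subexponential in $n$ if $f^M(n)\in N$ for every function $f:\mathbb N\to\mathbb N$ definable in $\mathbb N$ with $f(n)\le 2^{n^{o(1)}}$ ($f^M$ its extension to $M$). *)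

theory Defs
  imports Complex_Main "HOL-Library.Log_Nat"
begin

section \<open>First-order logic\<close>

datatype 'f trm = Var nat | Fun 'f "'f trm list"

datatype ('f, 'r) fm =
    Eq "'f trm" "'f trm"
  | Rel 'r "'f trm list"
  | Neg "('f, 'r) fm"
  | Conj "('f, 'r) fm list"
  | Disj "('f, 'r) fm list"
  | Ex nat "('f, 'r) fm"
  | All nat "('f, 'r) fm"

record ('f, 'r) language =
  funs :: "'f set"
  rels :: "'r set"
  far :: "'f \<Rightarrow> nat"
  rar :: "'r \<Rightarrow> nat"

record ('a, 'f, 'r) struct =
  Dom :: "'a set"
  fn :: "'f \<Rightarrow> 'a list \<Rightarrow> 'a"
  rl :: "'r \<Rightarrow> 'a list \<Rightarrow> bool"

fun tvars :: "'f trm \<Rightarrow> nat set" where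
  "tvars (Var x) = {x}"
| "tvars (Fun f ts) = (\<Union>t\<in>set ts. tvars t)"

fun fv :: "('f, 'r) fm \<Rightarrow> nat set" where
  "fv (Eq s t) = tvars s \<union> tvars t"
| "fv (Rel R ts) = (\<Union>t\<in>set ts. tvars t)"
| "fv (Neg \<phi>) = fv \<phi>"
| "fv (Conj \<phi>s) = (\<Union>\<phi>\<in>set \<phi>s. fv \<phi>)"
| "fv (Disj \<phi>s) = (\<Union>\<phi>\<in>set \<phi>s. fv \<phi>)"
| "fv (Ex x \<phi>) = fv \<phi> - {x}"
| "fv (All x \<phi>) = fv \<phi> - {x}"

fun is_term :: "('f, 'r) language \<Rightarrow> 'f trm \<Rightarrow> bool" where
  "is_term L (Var x) = True"
| "is_term L (Fun f ts) = (f \<in> funs L \<and> length ts = far L f \<and> (\<forall>t\<in>set ts. is_term L t))"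

fun is_formula :: "('f, 'r) language \<Rightarrow> ('f, 'r) fm \<Rightarrow> bool" where
  "is_formula L (Eq s t) = (is_term L s \<and> is_term L t)"
| "is_formula L (Rel R ts) = (R \<in> rels L \<and> length ts = rar L R \<and> (\<forall>t\<in>set ts. is_term L t))"
| "is_formula L (Neg \<phi>) = is_formula L \<phi>"
| "is_formula L (Conj \<phi>s) = (\<forall>\<phi>\<in>set \<phi>s. is_formula L \<phi>)"
| "is_formula L (Disj \<phi>s) = (\<forall>\<phi>\<in>set \<phi>s. is_formula L \<phi>)"
| "is_formula L (Ex x \<phi>) = is_formula L \<phi>"
| "is_formula L (All x \<phi>) = is_formula L \<phi>"

fun quantifier_free :: "('f, 'r) fm \<Rightarrow> bool" where
  "quantifier_free (Eq s t) = True"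
| "quantifier_free (Rel R ts) = True"
| "quantifier_free (Neg \<phi>) = quantifier_free \<phi>"
| "quantifier_free (Conj \<phi>s) = (\<forall>\<phi>\<in>set \<phi>s. quantifier_free \<phi>)"
| "quantifier_free (Disj \<phi>s) = (\<forall>\<phi>\<in>set \<phi>s. quantifier_free \<phi>)"
| "quantifier_free (Ex x \<phi>) = False"
| "quantifier_free (All x \<phi>) = False"

definition is_struct :: "('f, 'r) language \<Rightarrow> ('a, 'f, 'r) struct \<Rightarrow> bool" where
  "is_struct L A \<longleftrightarrow> Dom A \<noteq> {} \<and>
     (\<forall>f\<in>funs L. \<forall>as. set as \<subseteq> Dom A \<longrightarrow> length as = far L f \<longrightarrow> fn A f as \<in> Dom A)"

fun teval :: "('a, 'f, 'r) struct \<Rightarrow> (nat \<Rightarrow> 'a) \<Rightarrow> 'f trm \<Rightarrow> 'a" where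
  "teval A e (Var x) = e x"
| "teval A e (Fun f ts) = fn A f (map (teval A e) ts)"

fun sat :: "('a, 'f, 'r) struct \<Rightarrow> (nat \<Rightarrow> 'a) \<Rightarrow> ('f, 'r) fm \<Rightarrow> bool" where
  "sat A e (Eq s t) = (teval A e s = teval A e t)"
| "sat A e (Rel R ts) = rl A R (map (teval A e) ts)"
| "sat A e (Neg \<phi>) = (\<not> sat A e \<phi>)"
| "sat A e (Conj \<phi>s) = (\<forall>\<phi>\<in>set \<phi>s. sat A e \<phi>)"
| "sat A e (Disj \<phi>s) = (\<exists>\<phi>\<in>set \<phi>s. sat A e \<phi>)"
| "sat A e (Ex x \<phi>) = (\<exists>a\<in>Dom A. sat A (e(x := a)) \<phi>)"
| "sat A e (All x \<phi>) = (\<forall>a\<in>Dom A. sat A (e(x := a)) \<phi>)"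

definition models :: "('a, 'f, 'r) struct \<Rightarrow> ('f, 'r) fm \<Rightarrow> bool" where
  "models A \<phi> \<longleftrightarrow> (\<forall>e. range e \<subseteq> Dom A \<longrightarrow> sat A e \<phi>)"

definition substruct ::
    "('f, 'r) language \<Rightarrow> ('a, 'f, 'r) struct \<Rightarrow> ('a, 'f, 'r) struct \<Rightarrow> bool" where
  "substruct L A B \<longleftrightarrow> is_struct L A \<and> is_struct L B \<and> Dom A \<subseteq> Dom B \<and>
     (\<forall>f\<in>funs L. \<forall>as. set as \<subseteq> Dom A \<longrightarrow> length as = far L f \<longrightarrow> fn A f as = fn B f as) \<and>
     (\<forall>R\<in>rels L. \<forall>as. set as \<subseteq> Dom A \<longrightarrow> length as = rar L R \<longrightarrow> rl A R as = rl B R as)"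

definition elementary_embedding ::
    "('f, 'r) language \<Rightarrow> ('a \<Rightarrow> 'b) \<Rightarrow> ('a, 'f, 'r) struct \<Rightarrow> ('b, 'f, 'r) struct \<Rightarrow> bool" where
  "elementary_embedding L h A B \<longleftrightarrow> is_struct L A \<and> is_struct L B \<and> h ` Dom A \<subseteq> Dom B \<and>
     (\<forall>\<theta> e. is_formula L \<theta> \<longrightarrow> range e \<subseteq> Dom A \<longrightarrow> (sat A e \<theta> \<longleftrightarrow> sat B (h \<circ> e) \<theta>))"

definition exs :: "nat list \<Rightarrow> ('f, 'r) fm \<Rightarrow> ('f, 'r) fm" where
  "exs xs \<phi> = foldr Ex xs \<phi>"

definition alls :: "nat list \<Rightarrow> ('f, 'r) fm \<Rightarrow> ('f, 'r) fm" where
  "alls xs \<phi> = foldr All xs \<phi>"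

section \<open>Basic sentences without built-in symbols\<close>

inductive literal :: "('f, 'r) language \<Rightarrow> ('f, 'r) fm \<Rightarrow> bool" for L where
  "R \<in> rels L \<Longrightarrow> length us = rar L R \<Longrightarrow> literal L (Rel R (map Var us))"
| "R \<in> rels L \<Longrightarrow> length us = rar L R \<Longrightarrow> literal L (Neg (Rel R (map Var us)))"
| "f \<in> funs L \<Longrightarrow> length us = far L f \<Longrightarrow> literal L (Eq (Fun f (map Var us)) (Var v))"
| "literal L (Neg (Eq (Var u) (Var v)))"
| "literal L (Eq (Var u) (Var v))"

definition basic_sentence :: "('f, 'r) language \<Rightarrow> ('f, 'r) fm \<Rightarrow> bool" where
  "basic_sentence L \<phi> \<longleftrightarrow> fv \<phi> = {} \<and>
     (\<exists>ys lss. \<phi> = exs ys (Disj (map Conj lss)) \<and> (\<forall>ls\<in>set lss. \<forall>l\<in>set ls. literal L l))"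

section \<open>Polynomial-time oracle Turing machines\<close>

text \<open>
  A machine is given by its number of inputs, its number of tapes and a finite transition table;
  the first entry of the table that matches the state and the scanned symbols applies, and the
  machine halts if there is none. Tape 0 is the output tape, tape 1 the query tape, and the inputs
  are on the tapes from 2 on. Tapes are infinite in both directions. Symbol 0 is the blank, and the
  symbols 1 and 2 are the binary digits 0 and 1; a table may use further symbols. Numbers are
  written from cell 0 rightwards, least significant digit first. State 0 is initial. In state 1 the
  machine asks whether the number on the query tape is in the oracle, and goes to state 2 (yes) or
  3 (no) in one step.
\<close>

datatype dir = MoveL | Stay | MoveR

datatype otm = OTM (arity: nat) (ntapes: nat)
  (table: "((nat \<times> nat list) \<times> (nat \<times> (nat \<times> dir) list)) list")

type_synonym tape = "(int \<Rightarrow> nat) \<times> int"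
type_synonym config = "nat \<times> tape list"

abbreviation bitlength :: "nat \<Rightarrow> nat" where
  "bitlength \<equiv> floorlog 2"

definition wf_otm :: "otm \<Rightarrow> bool" where
  "wf_otm m \<longleftrightarrow> arity m + 2 \<le> ntapes m \<and>
     (\<forall>((q, rs), (q', as))\<in>set (table m). length rs = ntapes m \<and> length as = ntapes m)"

definition oracle_free :: "otm \<Rightarrow> bool" where
  "oracle_free m \<longleftrightarrow> (\<forall>(_, (q', _))\<in>set (table m). q' \<noteq> 1)"

definition blank_tape :: tape where
  "blank_tape = (\<lambda>_. 0, 0)"

definition number_tape :: "nat \<Rightarrow> tape" where
  "number_tape x =
     (\<lambda>p. if 0 \<le> p \<and> nat p < bitlength x then (if bit x (nat p) then 2 else 1) else 0, 0)"

definition tape_number :: "tape \<Rightarrow> nat" where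
  "tape_number t = (\<Sum>i < (LEAST j. fst t (int j) \<notin> {1, 2}). of_bool (fst t (int i) = 2) * 2 ^ i)"

definition read_tape :: "tape \<Rightarrow> nat" where
  "read_tape t = fst t (snd t)"

fun act :: "nat \<times> dir \<Rightarrow> tape \<Rightarrow> tape" where
  "act (s, d) (c, p) = (c(p := s), case d of MoveL \<Rightarrow> p - 1 | Stay \<Rightarrow> p | MoveR \<Rightarrow> p + 1)"

fun step :: "nat set \<Rightarrow> otm \<Rightarrow> config \<Rightarrow> config option" where
  "step \<alpha> m (q, ts) =
     (if q = 1 then Some (if tape_number (ts ! 1) \<in> \<alpha> then 2 else 3, ts)
      else map_option (\<lambda>(q', as). (q', map2 act as ts))
             (map_of (table m) (q, map read_tape ts)))"

fun run :: "nat set \<Rightarrow> otm \<Rightarrow> nat \<Rightarrow> config \<Rightarrow> config" where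
  "run \<alpha> m 0 c = c"
| "run \<alpha> m (Suc t) c = (case step \<alpha> m c of None \<Rightarrow> c | Some c' \<Rightarrow> run \<alpha> m t c')"

definition init :: "otm \<Rightarrow> nat list \<Rightarrow> config" where
  "init m xs = (0, replicate 2 blank_tape @ map number_tape xs
                     @ replicate (ntapes m - 2 - length xs) blank_tape)"

definition halts_in :: "nat set \<Rightarrow> otm \<Rightarrow> nat list \<Rightarrow> nat \<Rightarrow> bool" where
  "halts_in \<alpha> m xs t \<longleftrightarrow> step \<alpha> m (run \<alpha> m t (init m xs)) = None"

definition polytime :: "otm \<Rightarrow> bool" where
  "polytime m \<longleftrightarrow> wf_otm m \<and>
     (\<exists>c. \<forall>\<alpha> xs. length xs = arity m \<longrightarrow> halts_in \<alpha> m xs (sum_list (map bitlength xs) ^ c + c))"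

definition otm_fun :: "nat set \<Rightarrow> otm \<Rightarrow> nat list \<Rightarrow> nat" where
  "otm_fun \<alpha> m xs =
     tape_number (snd (run \<alpha> m (LEAST t. halts_in \<alpha> m xs t) (init m xs)) ! 0)"

section \<open>The languages PV and PV(alpha)\<close>

datatype pv_rel = Less | Alpha

definition PV :: "(otm, pv_rel) language" where
  "PV = \<lparr>funs = {m. polytime m \<and> oracle_free m}, rels = {Less}, far = arity,
         rar = (\<lambda>R. case R of Less \<Rightarrow> 2 | Alpha \<Rightarrow> 1)\<rparr>"

definition PVa :: "(otm, pv_rel) language" where
  "PVa = \<lparr>funs = {m. polytime m}, rels = {Less, Alpha}, far = arity,
          rar = (\<lambda>R. case R of Less \<Rightarrow> 2 | Alpha \<Rightarrow> 1)\<rparr>"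

definition std :: "nat set \<Rightarrow> (nat, otm, pv_rel) struct" where
  "std \<alpha> = \<lparr>Dom = UNIV, fn = otm_fun \<alpha>,
     rl = (\<lambda>R as. case R of Less \<Rightarrow> as ! 0 < as ! 1 | Alpha \<Rightarrow> as ! 0 \<in> \<alpha>)\<rparr>"

text \<open>The standard model of \<open>PV\<close>; the oracle is irrelevant for \<open>PV\<close>-formulas.\<close>

abbreviation std_PV :: "(nat, otm, pv_rel) struct" where
  "std_PV \<equiv> std {}"

definition pv_computes :: "otm \<Rightarrow> nat \<Rightarrow> (nat list \<Rightarrow> nat) \<Rightarrow> bool" where
  "pv_computes m k F \<longleftrightarrow> m \<in> funs PV \<and> arity m = k \<and>
     (\<forall>xs. length xs = k \<longrightarrow> fn std_PV m xs = F xs)"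

abbreviation less_in :: "('a, otm, pv_rel) struct \<Rightarrow> 'a \<Rightarrow> 'a \<Rightarrow> bool" where
  "less_in N a b \<equiv> rl N Less [a, b]"

definition alpha_of :: "('a, otm, pv_rel) struct \<Rightarrow> 'a set" where
  "alpha_of N = {a \<in> Dom N. rl N Alpha [a]}"

section \<open>The theory of minimization\<close>

definition forall_PVa :: "(otm, pv_rel) fm set" where
  "forall_PVa = {\<sigma>. is_formula PVa \<sigma> \<and> fv \<sigma> = {} \<and>
     (\<exists>xs \<phi>. quantifier_free \<phi> \<and> \<sigma> = alls xs \<phi>) \<and> (\<forall>\<alpha>. models (std \<alpha>) \<sigma>)}"

definition bex :: "nat \<Rightarrow> otm trm \<Rightarrow> (otm, pv_rel) fm \<Rightarrow> (otm, pv_rel) fm" where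
  "bex x t \<phi> = Ex x (Conj [Rel Less [Var x, t], \<phi>])"

definition ball :: "nat \<Rightarrow> otm trm \<Rightarrow> (otm, pv_rel) fm \<Rightarrow> (otm, pv_rel) fm" where
  "ball x t \<phi> = All x (Disj [Neg (Rel Less [Var x, t]), \<phi>])"

text \<open>
  The terms of the form \<open>|t|\<close>. Any symbol for the binary length may be used, since
  two such symbols denote the same function in every model of \<open>forall_PVa\<close>.
\<close>

inductive length_term :: "otm trm \<Rightarrow> bool" where
  "pv_computes l 1 (\<lambda>xs. bitlength (xs ! 0)) \<Longrightarrow> is_term PVa t \<Longrightarrow> length_term (Fun l [t])"

inductive sharply_bounded :: "(otm, pv_rel) fm \<Rightarrow> bool" where
  "is_formula PVa \<phi> \<Longrightarrow> quantifier_free \<phi> \<Longrightarrow> sharply_bounded \<phi>"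
| "sharply_bounded \<phi> \<Longrightarrow> sharply_bounded (Neg \<phi>)"
| "\<forall>\<phi>\<in>set \<phi>s. sharply_bounded \<phi> \<Longrightarrow> sharply_bounded (Conj \<phi>s)"
| "\<forall>\<phi>\<in>set \<phi>s. sharply_bounded \<phi> \<Longrightarrow> sharply_bounded (Disj \<phi>s)"
| "sharply_bounded \<phi> \<Longrightarrow> length_term t \<Longrightarrow> x \<notin> tvars t \<Longrightarrow> sharply_bounded (bex x t \<phi>)"
| "sharply_bounded \<phi> \<Longrightarrow> length_term t \<Longrightarrow> x \<notin> tvars t \<Longrightarrow> sharply_bounded (ball x t \<phi>)"

inductive Sigma_b_1 :: "(otm, pv_rel) fm \<Rightarrow> bool" where
  "sharply_bounded \<phi> \<Longrightarrow> Sigma_b_1 \<phi>"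
| "\<forall>\<phi>\<in>set \<phi>s. Sigma_b_1 \<phi> \<Longrightarrow> Sigma_b_1 (Conj \<phi>s)"
| "\<forall>\<phi>\<in>set \<phi>s. Sigma_b_1 \<phi> \<Longrightarrow> Sigma_b_1 (Disj \<phi>s)"
| "Sigma_b_1 \<phi> \<Longrightarrow> length_term t \<Longrightarrow> x \<notin> tvars t \<Longrightarrow> Sigma_b_1 (bex x t \<phi>)"
| "Sigma_b_1 \<phi> \<Longrightarrow> length_term t \<Longrightarrow> x \<notin> tvars t \<Longrightarrow> Sigma_b_1 (ball x t \<phi>)"
| "Sigma_b_1 \<phi> \<Longrightarrow> is_term PVa t \<Longrightarrow> x \<notin> tvars t \<Longrightarrow> Sigma_b_1 (bex x t \<phi>)"

text \<open>
  Satisfaction of the minimization axiom for \<open>\<chi>\<close> and its variable \<open>x\<close>; the other free variables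
  of \<open>\<chi>\<close> are the parameters, evaluated by \<open>e\<close>.
\<close>

definition minimization :: "('a, otm, pv_rel) struct \<Rightarrow> (otm, pv_rel) fm \<Rightarrow> nat \<Rightarrow> bool" where
  "minimization N \<chi> x \<longleftrightarrow> (\<forall>e. range e \<subseteq> Dom N \<longrightarrow> sat N e \<chi> \<longrightarrow>
     (\<exists>b\<in>Dom N. (less_in N b (e x) \<or> b = e x) \<and> sat N (e(x := b)) \<chi> \<and>
        (\<forall>c\<in>Dom N. less_in N c b \<longrightarrow> \<not> sat N (e(x := c)) \<chi>)))"

definition model_forall_T12_PVa :: "('a, otm, pv_rel) struct \<Rightarrow> bool" where
  "model_forall_T12_PVa N \<longleftrightarrow> is_struct PVa N \<and> (\<forall>\<sigma>\<in>forall_PVa. models N \<sigma>) \<and>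
     (\<forall>\<chi> x. Sigma_b_1 \<chi> \<longrightarrow> minimization N \<chi> x)"

section \<open>The structure B(L, n, X)\<close>

text \<open>
  \<open>PV\<close>-symbols for the functions that occur in the definition of \<open>B(L, n, X)\<close>, among them a tupling
  function. In \<open>valid_names\<close> the tupling function is injective on tuples of arbitrary length, so that
  codes of tuples of different lengths do not collide.
\<close>

record pv_names =
  num :: "nat \<Rightarrow> otm"
  prd :: otm
  len :: otm
  pow :: otm
  bitf :: otm
  tup :: "nat \<Rightarrow> otm"

definition valid_names :: "pv_names \<Rightarrow> bool" where
  "valid_names P \<longleftrightarrow>
     (\<forall>c. pv_computes (num P c) 0 (\<lambda>xs. c)) \<and>
     pv_computes (prd P) 1 (\<lambda>xs. xs ! 0 - 1) \<and>
     pv_computes (len P) 1 (\<lambda>xs. bitlength (xs ! 0)) \<and>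
     pv_computes (pow P) 1 (\<lambda>xs. 2 ^ bitlength (xs ! 0)) \<and>
     pv_computes (bitf P) 2 (\<lambda>xs. of_bool (bit (xs ! 1) (xs ! 0))) \<and>
     (\<exists>\<tau>. inj \<tau> \<and> (\<forall>k. pv_computes (tup P k) k \<tau>))"

definition numeral_in :: "pv_names \<Rightarrow> ('a, otm, pv_rel) struct \<Rightarrow> nat \<Rightarrow> 'a" where
  "numeral_in P N c = fn N (num P c) []"

definition tuple_in :: "pv_names \<Rightarrow> ('a, otm, pv_rel) struct \<Rightarrow> 'a list \<Rightarrow> 'a" where
  "tuple_in P N as = fn N (tup P (length as)) as"

definition coded_value ::
    "pv_names \<Rightarrow> ('a, otm, pv_rel) struct \<Rightarrow> 'a \<Rightarrow> 'a set \<Rightarrow> nat \<Rightarrow> 'a list \<Rightarrow> 'a" where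
  "coded_value P N n X S as = (THE a. a \<in> Dom N \<and> less_in N a (fn N (pow P) [n]) \<and>
     (\<forall>i\<in>Dom N. less_in N i (fn N (len P) [n]) \<longrightarrow>
        (fn N (bitf P) [i, a] = numeral_in P N 1 \<longleftrightarrow>
         tuple_in P N (numeral_in P N S # as @ [i]) \<in> X)))"

text \<open>The symbols of the language \<open>L\<close> coded by \<open>B(L, n, X)\<close> are numbers.\<close>

definition finite_language :: "(nat, nat) language \<Rightarrow> bool" where
  "finite_language L \<longleftrightarrow> finite (funs L) \<and> finite (rels L) \<and> funs L \<inter> rels L = {}"

definition B_struct ::
    "pv_names \<Rightarrow> ('a, otm, pv_rel) struct \<Rightarrow> 'a \<Rightarrow> 'a set \<Rightarrow> ('a, nat, nat) struct" where
  "B_struct P N n X =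
     \<lparr>Dom = {a \<in> Dom N. less_in N a n},
      fn = (\<lambda>S as. let a = coded_value P N n X S as; n' = fn N (prd P) [n]
                   in if less_in N a n' then a else n'),
      rl = (\<lambda>S as. tuple_in P N (numeral_in P N S # as) \<in> X)\<rparr>"

section \<open>Cuts\<close>

definition pv_cut :: "('a, otm, pv_rel) struct \<Rightarrow> ('a, otm, pv_rel) struct \<Rightarrow> bool" where
  "pv_cut N M \<longleftrightarrow> substruct PV N M \<and>
     (\<forall>b\<in>Dom N. \<forall>a\<in>Dom M. less_in M a b \<longrightarrow> a \<in> Dom N)"

definition defines_fun :: "(otm, pv_rel) fm \<Rightarrow> (nat \<Rightarrow> nat) \<Rightarrow> bool" where
  "defines_fun \<theta> f \<longleftrightarrow> is_formula PV \<theta> \<and> fv \<theta> \<subseteq> {0, 1} \<and>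
     (\<forall>e. sat std_PV e \<theta> \<longleftrightarrow> e 1 = f (e 0))"

definition extension_at ::
    "('a, otm, pv_rel) struct \<Rightarrow> (otm, pv_rel) fm \<Rightarrow> 'a \<Rightarrow> 'a" where
  "extension_at M \<theta> a = (THE b. b \<in> Dom M \<and> sat M ((\<lambda>_. a)(1 := b)) \<theta>)"

definition subexp_growth :: "(nat \<Rightarrow> nat) \<Rightarrow> bool" where
  "subexp_growth f \<longleftrightarrow> (\<exists>\<epsilon> :: nat \<Rightarrow> real. \<epsilon> \<longlonglongrightarrow> 0 \<and>
     (\<forall>\<^sub>F k in sequentially. real (f k) \<le> 2 powr (real k powr \<epsilon> k)))"

definition subexponential_in ::
    "('a, otm, pv_rel) struct \<Rightarrow> ('a, otm, pv_rel) struct \<Rightarrow> 'a \<Rightarrow> bool" where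
  "subexponential_in M N n \<longleftrightarrow>
     (\<forall>f \<theta>. defines_fun \<theta> f \<longrightarrow> subexp_growth f \<longrightarrow> extension_at M \<theta> n \<in> Dom N)"

text \<open>
  The type from which the elements of the models asserted to exist are taken. It has the
  cardinality of the continuum; the languages involved are countable, so by the
  Loewenheim-Skolem theorem any infinite type gives an equivalent statement.
\<close>

type_synonym point = "nat \<Rightarrow> nat"

end

theory Submission
  imports Defs "HOL-Library.Countable_Set"
begin

text \<open>
  By the downward Loewenheim-Skolem theorem the infinite structure in which \<open>\<phi>\<close> fails may be taken
  to be a structure \<open>A\<close> on the natural numbers. The elementary extension \<open>M\<close> is an ultrapower of the
  standard model, restricted to a countable set \<open>F\<close> of sequences that is closed under Skolem
  functions and under a few operations on conditions; \<open>n\<close> is the class of a sequence of elements of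
  \<open>\<psi>\<close> that tends to infinity, and \<open>N\<close> consists of all elements whose length is at most \<open>n powr o(1)\<close>.

  The oracle is generic for forcing with internal partial injections from \<open>[n]\<close> to \<open>A\<close> of small
  size. Deciding one query enlarges a condition by at most a constant number of pairs, so every
  polynomial-time computation on elements of \<open>N\<close> is decided densely. The generic oracle codes a
  substructure of an ultrapower of \<open>A\<close>, where \<open>\<phi>\<close> fails because it is existential. For the
  minimization of a bounded existential formula one takes the least value at which the formula can
  be forced by a small extension of the current condition: a true instance at a smaller value would
  have a certificate with few queries, and shrinking the condition that contains it to this
  certificate would give such an extension.
\<close>

subsection \<open>Ultrafilters and countable closures\<close>

text \<open>Each stage of the forcing is internal, a sequence of finite conditions with one entry
  per index.

  Two resources allow conditions to grow. An element of \<open>[n]\<close> gets a fresh image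
  because \<open>A\<close> is infinite. The class of sizes below every standard root of
  \<open>n\<close> has both properties that this asks for: its members are below \<open>n\<close>,
  and it is closed under polynomials.

  A least value is chosen at one stage, while its rivals may become true only later. The number of
  queries that a certificate may use must hence be fixed in advance, and exponents may depend on the
  formula alone. Sharply bounded universal quantifiers are the delicate case: their instances may be
  certified at different stages with no common one in sight, which is why initial segments are
  treated by a least choice of their own.\<close>

definition ultrafilter :: "'a filter \<Rightarrow> bool" where
  "ultrafilter U \<longleftrightarrow> U \<noteq> bot \<and> (\<forall>P. eventually P U \<or> eventually (\<lambda>x. \<not> P x) U)"

text \<open>Zorn's lemma is applied to families of sets with the finite intersection property rather
  than to filters, since the union of a chain of families keeps that property: a finite part of the
  union lies in one member of the chain.\<close>

lemma ultrafilter_below: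
  fixes F :: "'a filter"
  assumes "F \<noteq> bot"
  shows "\<exists>U. U \<le> F \<and> ultrafilter U"
proof -
  define D where "D = {S :: 'a set set. {X. eventually (\<lambda>x. x \<in> X) F} \<subseteq> S \<and>
    (\<forall>T. finite T \<longrightarrow> T \<subseteq> S \<longrightarrow> \<Inter>T \<noteq> {})}"
  have base: "{X. eventually (\<lambda>x. x \<in> X) F} \<in> D"
  proof -
    have "\<Inter>T \<noteq> {}" if "finite T" "T \<subseteq> {X. eventually (\<lambda>x. x \<in> X) F}" for T
    proof -
      have "eventually (\<lambda>x. \<forall>X\<in>T. x \<in> X) F"
        using that by (intro eventually_ball_finite) auto
      with assms have "\<exists>x. \<forall>X\<in>T. x \<in> X"
        using eventually_happens' by blast
      then show ?thesis by blast
    qed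
    then show ?thesis by (auto simp: D_def)
  qed
  have "\<exists>S\<in>D. \<forall>S'\<in>D. S \<subseteq> S' \<longrightarrow> S' = S"
  proof (rule Zorn_Lemma2, intro ballI)
    fix C assume C: "C \<in> chains D"
    show "\<exists>S\<in>D. \<forall>S'\<in>C. S' \<subseteq> S"
    proof (cases "C = {}")
      case True
      with base show ?thesis by auto
    next
      case False
      have "\<Inter>T \<noteq> {}" if T: "finite T" "T \<subseteq> \<Union>C" for T
      proof -
        have "\<exists>S\<in>C. T \<subseteq> S"
          using T
        proof (induction T)
          case empty
          with False show ?case by auto
        next
          case (insert X T)
          then obtain S S' where S: "S \<in> C" "T \<subseteq> S" "S' \<in> C" "X \<in> S'" by auto
          then have "S \<subseteq> S' \<or> S' \<subseteq> S" using C chainsD by blast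
          with S show ?case by auto
        qed
        with C chainsD2 T(1) show ?thesis unfolding D_def by blast
      qed
      moreover have "{X. eventually (\<lambda>x. x \<in> X) F} \<subseteq> \<Union>C"
        using False C chainsD2 unfolding D_def by blast
      ultimately have "\<Union>C \<in> D" by (auto simp: D_def)
      then show ?thesis by blast
    qed
  qed
  then obtain S where S: "S \<in> D" and max: "\<And>S'. S' \<in> D \<Longrightarrow> S \<subseteq> S' \<Longrightarrow> S' = S" by blast
  have fip: "\<Inter>T \<noteq> {}" if "finite T" "T \<subseteq> S" for T
    using S that by (auto simp: D_def)
  \<comment> \<open>By maximality, a set that meets all finite intersections of members is a member.
    The closure properties of a filter follow, and so does the ultrafilter property: if neither a
    set nor its complement is a member, two finite intersections have no point in common.\<close>
  have add: "X \<in> S" if X: "\<And>T. finite T \<Longrightarrow> T \<subseteq> S \<Longrightarrow> \<Inter>T \<inter> X \<noteq> {}" for X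
  proof -
    have "insert X S \<in> D"
    proof -
      have "\<Inter>T \<noteq> {}" if T: "finite T" "T \<subseteq> insert X S" for T
      proof -
        have "\<Inter>(T - {X}) \<inter> X \<noteq> {}"
          using T by (intro X) auto
        moreover have "\<Inter>(T - {X}) \<inter> X \<subseteq> \<Inter>T" by blast
        ultimately show ?thesis by blast
      qed
      with S show ?thesis by (auto simp: D_def)
    qed
    from max[OF this] show ?thesis by blast
  qed
  have up: "Y \<in> S" if "T \<subseteq> S" "finite T" "\<Inter>T \<subseteq> Y" for T Y
  proof (rule add)
    fix T' assume T': "finite T'" "T' \<subseteq> S"
    have "\<Inter>(T \<union> T') \<noteq> {}" using that T' by (intro fip) auto
    with that(3) show "\<Inter>T' \<inter> Y \<noteq> {}" by blast
  qed
  have filt: "is_filter (\<lambda>P. {x. P x} \<in> S)"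
  proof
    show "{x. True} \<in> S" by (rule up[of "{}"]) auto
  next
    fix P Q :: "'a \<Rightarrow> bool" assume "{x. P x} \<in> S" "{x. Q x} \<in> S"
    then show "{x. P x \<and> Q x} \<in> S" by (intro up[of "{{x. P x}, {x. Q x}}"]) auto
  next
    fix P Q :: "'a \<Rightarrow> bool" assume "\<forall>x. P x \<longrightarrow> Q x" "{x. P x} \<in> S"
    then show "{x. Q x} \<in> S" by (intro up[of "{{x. P x}}"]) auto
  qed
  define U where "U = Abs_filter (\<lambda>P. {x. P x} \<in> S)"
  have ev: "eventually P U \<longleftrightarrow> {x. P x} \<in> S" for P
    unfolding U_def using eventually_Abs_filter[OF filt] by simp
  have "U \<le> F"
    using S by (auto simp: le_filter_def ev D_def)
  moreover have "U \<noteq> bot"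
    using fip[of "{{}}"] by (auto simp: trivial_limit_def ev)
  moreover have "eventually P U \<or> eventually (\<lambda>x. \<not> P x) U" for P
  proof (rule ccontr)
    assume "\<not> ?thesis"
    then have "{x. P x} \<notin> S" "{x. \<not> P x} \<notin> S" by (auto simp: ev)
    then obtain T T' where T: "finite T" "T \<subseteq> S" "\<Inter>T \<inter> {x. P x} = {}"
      and T': "finite T'" "T' \<subseteq> S" "\<Inter>T' \<inter> {x. \<not> P x} = {}"
      using add by metis
    have "\<Inter>(T \<union> T') \<noteq> {}" using T T' by (intro fip) auto
    with T T' show False by blast
  qed
  ultimately show ?thesis by (auto simp: ultrafilter_def)
qed

lemma ultrafilter_not:
  "ultrafilter U \<Longrightarrow> eventually (\<lambda>x. \<not> P x) U \<longleftrightarrow> \<not> eventually P U"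
  unfolding ultrafilter_def using eventually_happens'[of U] eventually_conj[of P U "\<lambda>x. \<not> P x"] by blast

lemma ultrafilter_bex:
  assumes "ultrafilter U" "finite S"
  shows "eventually (\<lambda>x. \<exists>s\<in>S. P s x) U \<longleftrightarrow> (\<exists>s\<in>S. eventually (P s) U)"
proof -
  have "eventually (\<lambda>x. \<forall>s\<in>S. \<not> P s x) U \<longleftrightarrow> (\<forall>s\<in>S. eventually (\<lambda>x. \<not> P s x) U)"
    by (rule eventually_ball_finite_distrib[OF assms(2)])
  moreover have "eventually (\<lambda>x. \<forall>s\<in>S. \<not> P s x) U \<longleftrightarrow> \<not> eventually (\<lambda>x. \<exists>s\<in>S. P s x) U"
    using ultrafilter_not[OF assms(1), of "\<lambda>x. \<exists>s\<in>S. P s x"] by simp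
  ultimately show ?thesis
    using ultrafilter_not[OF assms(1)] by auto
qed

text \<open>The operations take lists, which covers all arities at once; a finite list over the
  union already lies in one of the countably many iterates. It serves twice: for the countable hull
  of the given structure and for the set \<open>F\<close> of sequences.\<close>

lemma countable_closure:
  fixes H :: "('a list \<Rightarrow> 'a) set"
  assumes "countable H" "countable S"
  shows "\<exists>T. countable T \<and> S \<subseteq> T \<and> (\<forall>h\<in>H. \<forall>xs. set xs \<subseteq> T \<longrightarrow> h xs \<in> T)"
proof -
  define E where "E = (\<lambda>T. T \<union> (\<lambda>(h, xs). h xs) ` (H \<times> lists T))"
  define T where "T = (\<Union>i. (E ^^ i) S)"
  have sub: "X \<subseteq> E X" for X by (auto simp: E_def)
  have "countable ((E ^^ i) S)" for i
    using assms by (induction i) (auto simp: E_def)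
  moreover have mono: "(E ^^ i) S \<subseteq> (E ^^ j) S" if "i \<le> j" for i j
    using that by (induction rule: dec_induct) (use sub in auto)
  have "\<exists>i. set xs \<subseteq> (E ^^ i) S" if "set xs \<subseteq> T" for xs
    using that
  proof (induction xs)
    case (Cons x xs)
    then obtain i j where "x \<in> (E ^^ i) S" "set xs \<subseteq> (E ^^ j) S" by (auto simp: T_def)
    then have "set (x # xs) \<subseteq> (E ^^ max i j) S"
      using mono[of i "max i j"] mono[of j "max i j"] by auto
    then show ?case by blast
  qed auto
  then have "h xs \<in> T" if "h \<in> H" "set xs \<subseteq> T" for h xs
  proof -
    obtain i where "set xs \<subseteq> (E ^^ i) S" using \<open>set xs \<subseteq> T\<close> \<open>\<And>xs. set xs \<subseteq> T \<Longrightarrow> _\<close> by blast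
    with that(1) have "(h, xs) \<in> H \<times> lists ((E ^^ i) S)" by auto
    from imageI[OF this, of "\<lambda>(h, xs). h xs"] have "h xs \<in> E ((E ^^ i) S)" unfolding E_def by simp
    then have "h xs \<in> (E ^^ Suc i) S" by simp
    then show ?thesis unfolding T_def by blast
  qed
  moreover have "S \<subseteq> T" unfolding T_def using UN_upper[of 0 UNIV "\<lambda>i. (E ^^ i) S"] by simp
  ultimately show ?thesis unfolding T_def by (intro exI[of _ "\<Union>i. (E ^^ i) S"]) auto
qed

instance dir :: countable by countable_datatype
instance otm :: countable by countable_datatype
instance pv_rel :: countable by countable_datatype
instance trm :: (countable) countable by countable_datatype
instance fm :: (countable, countable) countable by countable_datatype

subsection \<open>Coincidence\<close>

lemma finite_tvars [simp]: "finite (tvars t)"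
  by (induction t) auto

lemma finite_fv [simp]: "finite (fv \<phi>)"
  by (induction \<phi>) auto

lemma teval_cong:
  assumes "\<And>x. x \<in> tvars t \<Longrightarrow> e x = e' x"
  shows "teval A e t = teval A e' t"
  using assms
proof (induction t)
  case (Fun f ts)
  then have "map (teval A e) ts = map (teval A e') ts" by (intro map_cong) auto
  then show ?case unfolding teval.simps by (rule arg_cong)
qed auto

lemma sat_cong:
  assumes "\<And>x. x \<in> fv \<phi> \<Longrightarrow> e x = e' x"
  shows "sat A e \<phi> \<longleftrightarrow> sat A e' \<phi>"
  using assms
proof (induction \<phi> arbitrary: e e')
  case (Eq s t)
  then show ?case using teval_cong[of s e e' A] teval_cong[of t e e' A] by simp
next
  case (Rel R ts)
  then have "map (teval A e) ts = map (teval A e') ts" by (intro map_cong teval_cong) auto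
  then show ?case unfolding sat.simps by (rule arg_cong)
next
  case (Neg \<phi>)
  then have "sat A e \<phi> \<longleftrightarrow> sat A e' \<phi>" by (intro Neg.IH) auto
  then show ?case by simp
next
  case (Conj \<phi>s)
  have "sat A e \<phi> \<longleftrightarrow> sat A e' \<phi>" if "\<phi> \<in> set \<phi>s" for \<phi>
    using Conj.prems that by (intro Conj.IH[OF that]) auto
  then show ?case by simp
next
  case (Disj \<phi>s)
  have "sat A e \<phi> \<longleftrightarrow> sat A e' \<phi>" if "\<phi> \<in> set \<phi>s" for \<phi>
    using Disj.prems that by (intro Disj.IH[OF that]) auto
  then show ?case by simp
next
  case (Ex x \<phi>)
  have "sat A (e(x := a)) \<phi> \<longleftrightarrow> sat A (e'(x := a)) \<phi>" for a
    using Ex.prems by (intro Ex.IH) auto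
  then show ?case by simp
next
  case (All x \<phi>)
  have "sat A (e(x := a)) \<phi> \<longleftrightarrow> sat A (e'(x := a)) \<phi>" for a
    using All.prems by (intro All.IH) auto
  then show ?case by simp
qed

lemma range_fun_upd: "range e \<subseteq> D \<Longrightarrow> a \<in> D \<Longrightarrow> range (e(x := a)) \<subseteq> D"
  by auto

lemma sat_exs_intro:
  assumes "sat A e' \<phi>" "\<And>x. x \<notin> set xs \<Longrightarrow> e x = e' x" "range e' \<subseteq> Dom A"
  shows "sat A e (exs xs \<phi>)"
  using assms(2)
proof (induction xs arbitrary: e)
  case Nil
  then have "e = e'" by auto
  with assms show ?case by (simp add: exs_def)
next
  case (Cons x xs)
  have "sat A (e(x := e' x)) (exs xs \<phi>)" using Cons.prems by (intro Cons.IH) auto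
  with assms(3) show ?case by (auto simp: exs_def)
qed

lemma sat_exs_elim:
  assumes "sat A e (exs xs \<phi>)" "range e \<subseteq> Dom A"
  obtains e' where "sat A e' \<phi>" "range e' \<subseteq> Dom A"
proof -
  have "\<exists>e'. sat A e' \<phi> \<and> range e' \<subseteq> Dom A" using assms
  proof (induction xs arbitrary: e)
    case (Cons x xs)
    then obtain a where a: "a \<in> Dom A" "sat A (e(x := a)) (exs xs \<phi>)" by (auto simp: exs_def)
    from Cons.IH[OF a(2) range_fun_upd[OF Cons.prems(2) a(1)]] show ?case .
  qed (auto simp: exs_def)
  with that show ?thesis by blast
qed

lemma models_alls: "models A (alls xs \<phi>) \<longleftrightarrow> models A \<phi>"
proof (induction xs)
  case (Cons x xs)
  have "models A (All x \<psi>) \<longleftrightarrow> models A \<psi>" for \<psi>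
  proof
    assume l: "models A (All x \<psi>)"
    show "models A \<psi>" unfolding models_def
    proof (intro allI impI)
      fix e :: "nat \<Rightarrow> _" assume e: "range e \<subseteq> Dom A"
      then have "sat A (e(x := e x)) \<psi>" using l unfolding models_def sat.simps by (meson rangeI subsetD)
      then show "sat A e \<psi>" by simp
    qed
  next
    assume r: "models A \<psi>"
    show "models A (All x \<psi>)" unfolding models_def sat.simps
    proof (intro allI impI ballI)
      fix e :: "nat \<Rightarrow> _" and a assume "range e \<subseteq> Dom A" "a \<in> Dom A"
      then have "range (e(x := a)) \<subseteq> Dom A" by (rule range_fun_upd)
      with r show "sat A (e(x := a)) \<psi>" unfolding models_def by simp
    qed
  qed
  with Cons show ?case by (simp add: alls_def)
qed (simp add: alls_def)

text \<open>Assignments are given by finite lists because the set \<open>F\<close> of sequences will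
  be closed under operations on finite lists only. Variables beyond the list get the value
  0.\<close>

definition env :: "nat list \<Rightarrow> nat \<Rightarrow> nat" where
  "env xs j = (if j < length xs then xs ! j else 0)"

definition sz :: "nat list \<Rightarrow> nat" where
  "sz xs = sum_list (map bitlength xs)"

lemma bitlength_le_sz: "x \<in> set xs \<Longrightarrow> bitlength x \<le> sz xs"
  unfolding sz_def by (induction xs) auto

lemma bitlength_env: "bitlength (env xs x) \<le> sz xs"
  by (cases "x < length xs") (simp_all add: env_def bitlength_le_sz, simp add: floorlog_def)

lemma bitlength_le: "x < 2 ^ B \<Longrightarrow> bitlength x \<le> B"
  by (cases "x = 0") (auto simp: floorlog_le_iff)

lemma less_two_power_bitlength: "x < 2 ^ bitlength x"
  using floorlog_leD[of 2 x "bitlength x"] by simp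

lemma bitlength_le_self: "bitlength x \<le> x"
  by (intro bitlength_le less_exp)

subsection \<open>Decision trees\<close>

text \<open>A semantic form of decision trees: only the computed function of the oracle and a bound
  on the number of queries per branch are kept. Leaves are allowed at every height, so
  \<open>h\<close> is an upper bound.\<close>

inductive dec :: "nat \<Rightarrow> (nat set \<Rightarrow> 'v) \<Rightarrow> bool" where
  dec_const: "dec h (\<lambda>_. v)"
| dec_if: "dec h F \<Longrightarrow> dec h G \<Longrightarrow> dec (Suc h) (\<lambda>\<alpha>. if x \<in> \<alpha> then F \<alpha> else G \<alpha>)"

lemma dec_mono: "dec h F \<Longrightarrow> h \<le> h' \<Longrightarrow> dec h' F"
proof (induction arbitrary: h' rule: dec.induct)
  case (dec_if h F G x)
  then obtain k where "h' = Suc k" "h \<le> k" by (cases h') auto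
  with dec_if show ?case by (auto intro: dec.dec_if)
qed (rule dec_const)

lemma dec_bind_all: "dec h F \<Longrightarrow> (\<And>v. dec h' (G v)) \<Longrightarrow> dec (h + h') (\<lambda>\<alpha>. G (F \<alpha>) \<alpha>)"
proof (induction rule: dec.induct)
  case (dec_const h v)
  show ?case using dec_mono[OF dec_const[of v], of "h + h'"] by simp
next
  case (dec_if h F1 F2 x)
  have "dec (Suc (h + h')) (\<lambda>\<alpha>. if x \<in> \<alpha> then G (F1 \<alpha>) \<alpha> else G (F2 \<alpha>) \<alpha>)"
    using dec_if by (intro dec.dec_if) auto
  moreover have "(\<lambda>\<alpha>. if x \<in> \<alpha> then G (F1 \<alpha>) \<alpha> else G (F2 \<alpha>) \<alpha>) =
      (\<lambda>\<alpha>. G (if x \<in> \<alpha> then F1 \<alpha> else F2 \<alpha>) \<alpha>)" by auto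
  ultimately show ?case by simp
qed

lemma dec_bind:
  assumes "dec h F" "\<And>v. v \<in> range F \<Longrightarrow> dec h' (G v)"
  shows "dec (h + h') (\<lambda>\<alpha>. G (F \<alpha>) \<alpha>)"
proof -
  \<comment> \<open>Outside the range of \<open>F\<close> nothing is known about \<open>G\<close>,
    so it is replaced there by a constant, which has a tree of every height. This lets bounds that
    hold only for values that occur be used.\<close>
  define G' where "G' = (\<lambda>v. if v \<in> range F then G v else (\<lambda>_. undefined))"
  have "dec (h + h') (\<lambda>\<alpha>. G' (F \<alpha>) \<alpha>)"
    using assms by (intro dec_bind_all) (auto simp: G'_def intro: dec_const)
  then show ?thesis by (simp add: G'_def)
qed

lemma dec_comp: "dec h F \<Longrightarrow> dec h (\<lambda>\<alpha>. f (F \<alpha>))"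
  using dec_bind[of h F 0 "\<lambda>v _. f v"] by (simp add: dec_const)

lemma dec_mem: "dec (Suc 0) (\<lambda>\<alpha>. x \<in> \<alpha>)"
proof -
  have "dec (Suc 0) (\<lambda>\<alpha>. if x \<in> \<alpha> then True else False)" by (intro dec_if dec_const)
  moreover have "(\<lambda>\<alpha>. if x \<in> \<alpha> then True else False) = (\<lambda>\<alpha>. x \<in> \<alpha>)" by auto
  ultimately show ?thesis by (simp only:)
qed

lemma dec_map:
  assumes "\<And>x. x \<in> set xs \<Longrightarrow> dec h (F x)"
  shows "dec (length xs * h) (\<lambda>\<alpha>. map (\<lambda>x. F x \<alpha>) xs)"
  using assms
proof (induction xs)
  case (Cons x xs)
  then have "dec h (F x)" "dec (length xs * h) (\<lambda>\<alpha>. map (\<lambda>x. F x \<alpha>) xs)" by simp_all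
  then have "dec (h + length xs * h) (\<lambda>\<alpha>. F x \<alpha> # map (\<lambda>x. F x \<alpha>) xs)"
    using dec_bind_all[of h "F x" "length xs * h" "\<lambda>v \<alpha>. v # map (\<lambda>x. F x \<alpha>) xs"]
      dec_comp[of "length xs * h" "\<lambda>\<alpha>. map (\<lambda>x. F x \<alpha>) xs"] by blast
  then show ?case by simp
qed (simp add: dec_const)

subsection \<open>Runs of machines\<close>

lemma run_Suc:
  "run \<alpha> m (Suc t) (q, ts) =
    (if q = 1 then (if tape_number (ts ! 1) \<in> \<alpha> then run \<alpha> m t (2, ts) else run \<alpha> m t (3, ts))
     else case map_of (table m) (q, map read_tape ts) of
       None \<Rightarrow> (q, ts) | Some (q', as) \<Rightarrow> run \<alpha> m t (q', map2 act as ts))"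
  by (auto split: option.split)

text \<open>Only a step in state 1 looks at the oracle, and it asks one question; every other step
  is determined by the configuration. So \<open>t\<close> steps cost at most \<open>t\<close>
  queries.\<close>

lemma dec_run: "dec t (\<lambda>\<alpha>. run \<alpha> m t c)"
proof (induction t arbitrary: c)
  case 0
  then show ?case by (simp add: dec_const)
next
  case (Suc t)
  obtain q ts where c: "c = (q, ts)" by (cases c)
  show ?case
  proof (cases "q = 1")
    case True
    then show ?thesis unfolding c run_Suc by (simp del: run.simps) (intro dec_if Suc.IH)
  next
    case False
    have "dec t (\<lambda>\<alpha>. run \<alpha> m (Suc t) c)"
    proof (cases "map_of (table m) (q, map read_tape ts)")
      case None
      with False show ?thesis unfolding c run_Suc by (simp add: dec_const del: run.simps)
    next
      case (Some a)
      with False Suc.IH show ?thesis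
        unfolding c run_Suc by (cases a) (simp del: run.simps)
    qed
    then show ?thesis by (rule dec_mono) simp
  qed
qed

lemma run_halted: "step \<alpha> m c = None \<Longrightarrow> run \<alpha> m t c = c"
  by (cases t) auto

lemma run_add: "run \<alpha> m (s + t) c = run \<alpha> m t (run \<alpha> m s c)"
proof (induction s arbitrary: c)
  case (Suc s)
  then show ?case by (cases "step \<alpha> m c") (auto simp: run_halted)
qed simp

lemma otm_fun_run:
  assumes "halts_in \<alpha> m xs T"
  shows "otm_fun \<alpha> m xs = tape_number (snd (run \<alpha> m T (init m xs)) ! 0)"
proof -
  define t where "t = (LEAST t. halts_in \<alpha> m xs t)"
  have "halts_in \<alpha> m xs t" "t \<le> T" unfolding t_def using assms by (auto intro: LeastI Least_le)
  then have "run \<alpha> m (t + (T - t)) (init m xs) = run \<alpha> m t (init m xs)"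
    unfolding run_add halts_in_def by (intro run_halted)
  with \<open>t \<le> T\<close> show ?thesis unfolding otm_fun_def t_def by simp
qed

text \<open>The head on the output tape advances by at most one cell per step, so the frontier
  behind which something can be written advances no faster. With \<open>tape_number_less\<close>
  this bounds the length of the output by the running time, for every oracle.\<close>

lemma run_output_blank:
  assumes m: "wf_otm m"
  shows "length ts = ntapes m \<Longrightarrow> \<forall>p\<ge>int B. fst (ts ! 0) p = 0 \<Longrightarrow> snd (ts ! 0) \<le> int B \<Longrightarrow>
    fst (snd (run \<alpha> m t (q, ts)) ! 0) (int (B + t)) = 0"
proof (induction t arbitrary: q ts B)
  case (Suc t)
  have IH: "fst (snd (run \<alpha> m t (q', ts')) ! 0) (int (Suc B + t)) = 0"
    if "length ts' = ntapes m" "\<forall>p\<ge>int (Suc B). fst (ts' ! 0) p = 0" "snd (ts' ! 0) \<le> int (Suc B)"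
    for q' ts'
    using Suc.IH[OF that] .
  show ?case
  proof (cases "q = 1")
    case True
    then show ?thesis using IH[of ts] Suc.prems unfolding run_Suc by simp
  next
    case False
    show ?thesis
    proof (cases "map_of (table m) (q, map read_tape ts)")
      case None
      with False Suc.prems show ?thesis unfolding run_Suc by simp
    next
      case (Some a)
      obtain q' as where a: "a = (q', as)" by (cases a)
      have as: "length as = ntapes m" and two: "0 < ntapes m"
        using m map_of_SomeD[OF Some] unfolding a wf_otm_def by auto
      obtain s d where sd: "as ! 0 = (s, d)" by (cases "as ! 0")
      obtain f p where fp: "ts ! 0 = (f, p)" by (cases "ts ! 0")
      have "map2 act as ts ! 0 = act (as ! 0) (ts ! 0)"
        using as two Suc.prems(1) by simp
      then have "fst (snd (run \<alpha> m t (q', map2 act as ts)) ! 0) (int (Suc B + t)) = 0"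
        using as Suc.prems by (intro IH) (auto simp: sd fp split: dir.splits)
      with False Some show ?thesis unfolding run_Suc a by simp
    qed
  qed
qed simp

lemma tape_number_less:
  assumes "fst t (int B) = 0"
  shows "tape_number t < 2 ^ B"
proof -
  define j where "j = (LEAST j. fst t (int j) \<notin> {1, 2})"
  have "j \<le> B" unfolding j_def using assms by (intro Least_le) simp
  have "tape_number t < 2 ^ j" unfolding tape_number_def j_def[symmetric]
    by (induction j) (auto simp: of_bool_def)
  also have "\<dots> \<le> 2 ^ B" using \<open>j \<le> B\<close> by simp
  finally show ?thesis .
qed

lemma bitlength_otm_fun:
  assumes "wf_otm m" "halts_in \<alpha> m xs T" "length xs = arity m"
  shows "bitlength (otm_fun \<alpha> m xs) \<le> T"
proof -
  obtain ts where ts: "init m xs = (0, ts)" by (auto simp: init_def)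
  have "length ts = ntapes m" "ts ! 0 = blank_tape"
    using assms ts unfolding wf_otm_def init_def by (auto simp: numeral_2_eq_2)
  then have "fst (snd (run \<alpha> m T (0, ts)) ! 0) (int (0 + T)) = 0"
    by (intro run_output_blank assms) (auto simp: blank_tape_def)
  then show ?thesis unfolding otm_fun_run[OF assms(2)] ts by (intro bitlength_le tape_number_less) simp
qed

lemma run_oracle_free:
  assumes "oracle_free m"
  shows "q \<noteq> 1 \<Longrightarrow> run \<alpha> m t (q, ts) = run \<beta> m t (q, ts) \<and> fst (run \<beta> m t (q, ts)) \<noteq> 1"
proof (induction t arbitrary: q ts)
  case (Suc t)
  show ?case
  proof (cases "map_of (table m) (q, map read_tape ts)")
    case (Some a)
    obtain q' as where a: "a = (q', as)" by (cases a)
    have "q' \<noteq> 1" using assms map_of_SomeD[OF Some] unfolding a oracle_free_def by auto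
    then show ?thesis using Suc Some unfolding run_Suc a by simp
  qed (use Suc.prems in \<open>simp add: run_Suc\<close>)
qed simp

lemma otm_fun_oracle_free:
  assumes "oracle_free m"
  shows "otm_fun \<alpha> m xs = otm_fun \<beta> m xs"
proof -
  have r: "run \<alpha> m t (init m xs) = run \<beta> m t (init m xs)" "fst (run \<beta> m t (init m xs)) \<noteq> 1" for t
    using run_oracle_free[OF assms, of 0] unfolding init_def by auto
  have "step \<alpha> m c = step \<beta> m c" if "fst c \<noteq> 1" for c using that by (cases c) simp
  then have "halts_in \<alpha> m xs = halts_in \<beta> m xs" unfolding halts_in_def fun_eq_iff using r by simp
  then show ?thesis unfolding otm_fun_def using r by simp
qed

subsection \<open>Polynomial bounds\<close>

text \<open>With the base at least 2, bounds are combined by adding exponents: a product needs the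
  sum, a sum one more, and a constant \<open>a\<close> is at most \<open>2 ^ a\<close>. Thus a
  single exponent describes a polynomial bound.\<close>

definition polyb :: "(nat \<Rightarrow> nat) \<Rightarrow> bool" where
  "polyb p \<longleftrightarrow> (\<exists>c. \<forall>s. p s \<le> (s + 2) ^ c)"

lemma polyb_const: "polyb (\<lambda>_. a)"
proof -
  have "a \<le> (s + 2) ^ a" for s
  proof -
    have "a \<le> 2 ^ a" by (simp add: less_imp_le)
    also have "\<dots> \<le> (s + 2) ^ a" by (rule power_mono) auto
    finally show ?thesis .
  qed
  then show ?thesis unfolding polyb_def by blast
qed

lemma polyb_id: "polyb (\<lambda>s. s)"
  unfolding polyb_def by (intro exI[of _ 1]) auto

lemma polyb_mult: "polyb p \<Longrightarrow> polyb q \<Longrightarrow> polyb (\<lambda>s. p s * q s)"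
  unfolding polyb_def by (metis mult_le_mono power_add)

lemma polyb_add:
  assumes "polyb p" "polyb q"
  shows "polyb (\<lambda>s. p s + q s)"
proof -
  obtain c d where "\<And>s. p s \<le> (s + 2) ^ c" "\<And>s. q s \<le> (s + 2) ^ d"
    using assms unfolding polyb_def by blast
  have "p s + q s \<le> (s + 2) ^ (c + d + 1)" for s
  proof -
    have "p s + q s \<le> (s + 2) ^ (c + d) + (s + 2) ^ (c + d)"
      using \<open>\<And>s. p s \<le> (s + 2) ^ c\<close>[of s] \<open>\<And>s. q s \<le> (s + 2) ^ d\<close>[of s]
        power_increasing[of c "c + d" "s + 2"] power_increasing[of d "c + d" "s + 2"] by linarith
    also have "\<dots> \<le> (s + 2) ^ (c + d + 1)" by simp
    finally show ?thesis .
  qed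
  then show ?thesis unfolding polyb_def by blast
qed

lemma polyb_power: "polyb p \<Longrightarrow> polyb (\<lambda>s. p s ^ k)"
  by (induction k) (auto intro: polyb_mult polyb_const)

lemma polyb_compose:
  assumes "polyb p" "polyb q"
  shows "polyb (\<lambda>s. p (q s))"
proof -
  obtain c where c: "\<And>s. p s \<le> (s + 2) ^ c"
    using assms unfolding polyb_def by blast
  have "polyb (\<lambda>s. (q s + 2) ^ c)" by (intro polyb_power polyb_add polyb_const assms)
  then obtain d where "\<And>s. (q s + 2) ^ c \<le> (s + 2) ^ d" unfolding polyb_def by blast
  with c show ?thesis unfolding polyb_def by (meson order_trans)
qed

lemma polyb_ball:
  assumes "\<And>x. x \<in> set xs \<Longrightarrow> \<exists>p. polyb p \<and> (\<forall>s. Q x s (p s))"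
    and mono: "\<And>x s k k'. x \<in> set xs \<Longrightarrow> Q x s k \<Longrightarrow> k \<le> k' \<Longrightarrow> Q x s k'"
  shows "\<exists>p. polyb p \<and> (\<forall>x\<in>set xs. \<forall>s. Q x s (p s))"
  using assms
proof (induction xs)
  case Nil
  then show ?case using polyb_const by auto
next
  case (Cons x xs)
  obtain p where p: "polyb p" "\<forall>s. Q x s (p s)" using Cons.prems(1)[of x] by auto
  obtain q where q: "polyb q" "\<forall>y\<in>set xs. \<forall>s. Q y s (q s)"
    using Cons.IH Cons.prems by (metis list.set_intros(2))
  have "Q y s (p s + q s)" if "y \<in> set (x # xs)" for y s
  proof (cases "y = x")
    case True
    then show ?thesis using Cons.prems(2)[of x s "p s" "p s + q s"] p by simp
  next
    case False
    then show ?thesis using Cons.prems(2)[of y s "q s" "p s + q s"] q that by simp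
  qed
  with polyb_add[OF p(1) q(1)] show ?case by blast
qed

subsection \<open>Sharply bounded formulas have polynomial decision trees\<close>

definition bounded_env :: "nat set \<Rightarrow> nat \<Rightarrow> (nat \<Rightarrow> nat) \<Rightarrow> bool" where
  "bounded_env V s e \<longleftrightarrow> (\<forall>x\<in>V. bitlength (e x) \<le> s)"

lemma std_simps [simp]:
  "Dom (std \<alpha>) = UNIV" "fn (std \<alpha>) = otm_fun \<alpha>"
  "rl (std \<alpha>) Less as \<longleftrightarrow> as ! 0 < as ! 1" "rl (std \<alpha>) Alpha as \<longleftrightarrow> as ! 0 \<in> \<alpha>"
  by (simp_all add: std_def)

lemma PVa_simps [simp]:
  "funs PVa = {m. polytime m}" "rels PVa = {Less, Alpha}" "far PVa = arity"
  "rar PVa Less = 2" "rar PVa Alpha = 1"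
  by (simp_all add: PVa_def)

lemma PV_simps [simp]:
  "funs PV = {m. polytime m \<and> oracle_free m}" "rels PV = {Less}" "far PV = arity"
  "rar PV Less = 2" "rar PV Alpha = 1"
  by (simp_all add: PV_def)

text \<open>Depth and length have to be bounded together: the lengths of the arguments determine the
  running time of the outer machine, which in turn bounds both its number of queries and the length
  of its output. The time bound in \<open>polytime\<close> is uniform in the oracle, and so is the
  result.\<close>

lemma polyb_term:
  assumes "is_term PVa t"
  shows "\<exists>p. polyb p \<and> (\<forall>s e. bounded_env (tvars t) s e \<longrightarrow>
    dec (p s) (\<lambda>\<alpha>. teval (std \<alpha>) e t) \<and> (\<forall>\<alpha>. bitlength (teval (std \<alpha>) e t) \<le> p s))"
  using assms
proof (induction t)
  case (Var x)
  then show ?case using polyb_id by (auto simp: bounded_env_def intro!: dec_const)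
next
  case (Fun m ts)
  have "\<exists>p. polyb p \<and> (\<forall>t\<in>set ts. \<forall>s. \<forall>e. bounded_env (tvars t) s e \<longrightarrow>
    dec (p s) (\<lambda>\<alpha>. teval (std \<alpha>) e t) \<and> (\<forall>\<alpha>. bitlength (teval (std \<alpha>) e t) \<le> p s))"
    by (rule polyb_ball) (use Fun in \<open>auto intro: dec_mono order_trans\<close>)
  then obtain p where p: "polyb p"
    and pt: "\<And>t s e. t \<in> set ts \<Longrightarrow> bounded_env (tvars t) s e \<Longrightarrow>
      dec (p s) (\<lambda>\<alpha>. teval (std \<alpha>) e t) \<and> (\<forall>\<alpha>. bitlength (teval (std \<alpha>) e t) \<le> p s)"
    by blast
  from Fun.prems have m: "polytime m" "arity m = length ts" by auto
  then obtain c where c: "\<And>\<alpha> xs. length xs = arity m \<Longrightarrow> halts_in \<alpha> m xs (sum_list (map bitlength xs) ^ c + c)"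
    and wf: "wf_otm m"
    unfolding polytime_def by blast
  \<comment> \<open>\<open>S\<close> plays two roles: it bounds the total length of the arguments
    and the depth of the tree that evaluates all of them.\<close>
  define S where "S = (\<lambda>s. length ts * p s)"
  define T where "T = (\<lambda>s. S s ^ c + c)"
  have S: "polyb S" unfolding S_def by (intro polyb_mult polyb_const p)
  have T: "polyb T" unfolding T_def by (intro polyb_add polyb_power S polyb_const)
  have "dec (S s + T s) (\<lambda>\<alpha>. teval (std \<alpha>) e (Fun m ts)) \<and>
      (\<forall>\<alpha>. bitlength (teval (std \<alpha>) e (Fun m ts)) \<le> S s + T s)"
    if e: "bounded_env (tvars (Fun m ts)) s e" for s e
  proof -
    have et: "bounded_env (tvars t) s e" if "t \<in> set ts" for t
      using e that by (auto simp: bounded_env_def)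
    have args: "dec (S s) (\<lambda>\<alpha>. map (teval (std \<alpha>) e) ts)"
      unfolding S_def using pt[OF _ et] by (intro dec_map) blast
    have halt: "halts_in \<alpha> m (map (teval (std \<beta>) e) ts) (T s)" for \<alpha> \<beta>
    proof -
      let ?xs = "map (teval (std \<beta>) e) ts"
      have "sum_list (map (\<lambda>t. bitlength (teval (std \<beta>) e t)) ts) \<le> sum_list (map (\<lambda>_. p s) ts)"
        using pt[OF _ et] by (intro sum_list_mono) blast
      then have "sum_list (map bitlength ?xs) \<le> S s"
        unfolding S_def by (simp add: comp_def sum_list_triv)
      then have "sum_list (map bitlength ?xs) ^ c + c \<le> T s"
        unfolding T_def by (simp add: power_mono)
      then obtain k where k: "T s = (sum_list (map bitlength ?xs) ^ c + c) + k"
        using le_Suc_ex by blast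
      have "halts_in \<alpha> m ?xs (sum_list (map bitlength ?xs) ^ c + c)" using m by (intro c) simp
      then show ?thesis unfolding k halts_in_def run_add by (simp add: run_halted)
    qed
    have "dec (S s + T s) (\<lambda>\<alpha>. (\<lambda>xs \<alpha>. tape_number (snd (run \<alpha> m (T s) (init m xs)) ! 0)) (map (teval (std \<alpha>) e) ts) \<alpha>)"
      by (rule dec_bind[OF args]) (intro dec_comp[of _ _ "\<lambda>c. tape_number (snd c ! 0)"] dec_run)
    then have "dec (S s + T s) (\<lambda>\<alpha>. teval (std \<alpha>) e (Fun m ts))"
      using otm_fun_run[OF halt] by simp
    moreover have "bitlength (teval (std \<alpha>) e (Fun m ts)) \<le> T s" for \<alpha>
      using bitlength_otm_fun[OF wf halt[of \<alpha> \<alpha>]] m by simp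
    ultimately show ?thesis by (simp add: trans_le_add2)
  qed
  with polyb_add[OF S T] show ?case by blast
qed

definition poly_dec :: "nat set \<Rightarrow> (nat set \<Rightarrow> (nat \<Rightarrow> nat) \<Rightarrow> 'v) \<Rightarrow> bool" where
  "poly_dec V \<Phi> \<longleftrightarrow> (\<exists>p. polyb p \<and> (\<forall>s e. bounded_env V s e \<longrightarrow> dec (p s) (\<lambda>\<alpha>. \<Phi> \<alpha> e)))"

lemma poly_dec_term: "is_term PVa t \<Longrightarrow> poly_dec (tvars t) (\<lambda>\<alpha> e. teval (std \<alpha>) e t)"
  using polyb_term unfolding poly_dec_def by meson

lemma poly_dec_map:
  assumes "\<And>x. x \<in> set xs \<Longrightarrow> poly_dec (V x) (\<Phi> x)"
  shows "poly_dec (\<Union>x\<in>set xs. V x) (\<lambda>\<alpha> e. map (\<lambda>x. \<Phi> x \<alpha> e) xs)"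
proof -
  have "\<exists>p. polyb p \<and> (\<forall>x\<in>set xs. \<forall>s. \<forall>e. bounded_env (V x) s e \<longrightarrow> dec (p s) (\<lambda>\<alpha>. \<Phi> x \<alpha> e))"
    by (rule polyb_ball) (use assms in \<open>auto simp: poly_dec_def intro: dec_mono\<close>)
  then obtain p where p: "polyb p"
    and d: "\<And>x s e. x \<in> set xs \<Longrightarrow> bounded_env (V x) s e \<Longrightarrow> dec (p s) (\<lambda>\<alpha>. \<Phi> x \<alpha> e)" by blast
  have "dec (length xs * p s) (\<lambda>\<alpha>. map (\<lambda>x. \<Phi> x \<alpha> e) xs)"
    if "bounded_env (\<Union>x\<in>set xs. V x) s e" for s e
    using that by (intro dec_map d) (auto simp: bounded_env_def)
  with polyb_mult[OF polyb_const[of "length xs"] p] show ?thesis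
    unfolding poly_dec_def by (intro exI[of _ "\<lambda>s. length xs * p s"]) auto
qed

lemma poly_dec_bind:
  assumes "poly_dec V \<Phi>" "poly_dec V' \<Psi>"
  shows "poly_dec (V \<union> V') (\<lambda>\<alpha> e. f (\<Phi> \<alpha> e) (\<Psi> \<alpha> e))"
proof -
  obtain p q where p: "polyb p" "\<And>s e. bounded_env V s e \<Longrightarrow> dec (p s) (\<lambda>\<alpha>. \<Phi> \<alpha> e)"
    and q: "polyb q" "\<And>s e. bounded_env V' s e \<Longrightarrow> dec (q s) (\<lambda>\<alpha>. \<Psi> \<alpha> e)"
    using assms unfolding poly_dec_def by blast
  have "dec (p s + q s) (\<lambda>\<alpha>. f (\<Phi> \<alpha> e) (\<Psi> \<alpha> e))" if "bounded_env (V \<union> V') s e" for s e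
  proof -
    have "bounded_env V s e" "bounded_env V' s e" using that by (auto simp: bounded_env_def)
    from dec_bind_all[OF p(2)[OF this(1)] dec_comp[OF q(2)[OF this(2)]]] show ?thesis .
  qed
  with polyb_add[OF p(1) q(1)] show ?thesis unfolding poly_dec_def by blast
qed

lemma poly_dec_comp: "poly_dec V \<Phi> \<Longrightarrow> poly_dec V (\<lambda>\<alpha> e. f (\<Phi> \<alpha> e))"
  unfolding poly_dec_def using dec_comp by metis

lemma poly_dec_mono: "poly_dec V \<Phi> \<Longrightarrow> V \<subseteq> W \<Longrightarrow> poly_dec W \<Phi>"
  unfolding poly_dec_def bounded_env_def by (meson subsetD)

lemma length_termE:
  assumes "length_term t"
  obtains t' where "is_term PVa t'" "tvars t = tvars t'" "is_term PVa t"
    "\<And>\<alpha> e. teval (std \<alpha>) e t = bitlength (teval (std \<alpha>) e t')"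
  using assms
proof cases
  case (1 l t')
  have "otm_fun \<alpha> l xs = otm_fun {} l xs" for \<alpha> xs
    using 1 by (intro otm_fun_oracle_free) (simp add: pv_computes_def)
  moreover have "otm_fun {} l [a] = bitlength a" for a
    using 1(2) by (simp add: pv_computes_def)
  ultimately have "otm_fun \<alpha> l [a] = bitlength a" for \<alpha> a by metis
  with 1 show ?thesis by (intro that[of t']) (auto simp: pv_computes_def)
qed

text \<open>All truth values below a sharp bound are decided together, which makes the least witness
  decidable as well.\<close>

lemma poly_dec_sharp:
  assumes t: "length_term t" and \<Phi>: "poly_dec V \<Phi>"
  shows "poly_dec (tvars t \<union> (V - {x}))
    (\<lambda>\<alpha> e. let b = teval (std \<alpha>) e t in map (\<lambda>y. \<Phi> \<alpha> (e(x := y))) [0..<b])"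
proof -
  obtain t' where t': "is_term PVa t'" "tvars t = tvars t'"
    "\<And>\<alpha> e. teval (std \<alpha>) e t = bitlength (teval (std \<alpha>) e t')"
    using length_termE[OF t] by metis
  obtain p where p: "polyb p" "\<And>s e. bounded_env (tvars t') s e \<Longrightarrow>
    dec (p s) (\<lambda>\<alpha>. teval (std \<alpha>) e t') \<and> (\<forall>\<alpha>. bitlength (teval (std \<alpha>) e t') \<le> p s)"
    using polyb_term[OF t'(1)] by blast
  obtain q where q: "polyb q" "\<And>s e. bounded_env V s e \<Longrightarrow> dec (q s) (\<lambda>\<alpha>. \<Phi> \<alpha> e)"
    using \<Phi> unfolding poly_dec_def by blast
  have "dec (p s + p s * q (s + p s))
      (\<lambda>\<alpha>. let b = teval (std \<alpha>) e t in map (\<lambda>y. \<Phi> \<alpha> (e(x := y))) [0..<b])"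
    if e: "bounded_env (tvars t \<union> (V - {x})) s e" for s e
  proof -
    have e': "bounded_env (tvars t') s e" using e t'(2) by (auto simp: bounded_env_def)
    have 1: "dec (p s) (\<lambda>\<alpha>. teval (std \<alpha>) e t)"
      unfolding t'(3) by (rule dec_comp[of _ _ bitlength]) (use p(2)[OF e'] in blast)
    have 2: "dec (p s * q (s + p s)) (\<lambda>\<alpha>. map (\<lambda>y. \<Phi> \<alpha> (e(x := y))) [0..<b])"
      if "b \<in> range (\<lambda>\<alpha>. teval (std \<alpha>) e t)" for b
    proof -
      \<comment> \<open>The value of a length term is bounded by the polynomial \<open>p s\<close>
        and not merely by a number of that length. This keeps the number of instances polynomial,
        and their lengths as well.\<close>
      have b: "b \<le> p s" using that p(2)[OF e'] t'(3) by auto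
      have "dec (length [0..<b] * q (s + p s)) (\<lambda>\<alpha>. map (\<lambda>y. \<Phi> \<alpha> (e(x := y))) [0..<b])"
      proof (intro dec_map q)
        fix y assume "y \<in> set [0..<b]"
        with b have "bitlength y \<le> p s" using bitlength_le_self[of y] by simp
        with e show "bounded_env V (s + p s) (e(x := y))"
          by (auto simp: bounded_env_def intro: trans_le_add1 trans_le_add2)
      qed
      then show ?thesis by (rule dec_mono) (use b in simp)
    qed
    show ?thesis unfolding Let_def
      by (rule dec_bind[OF 1, of _ "\<lambda>b \<alpha>. map (\<lambda>y. \<Phi> \<alpha> (e(x := y))) [0..<b]"]) (rule 2)
  qed
  moreover have "polyb (\<lambda>s. p s + p s * q (s + p s))"
    by (intro polyb_add polyb_mult polyb_compose[OF q(1)] polyb_id p)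
  ultimately show ?thesis unfolding poly_dec_def by blast
qed

lemma sat_bex_std:
  assumes "x \<notin> tvars t"
  shows "sat (std \<alpha>) e (bex x t \<phi>) \<longleftrightarrow> (\<exists>y<teval (std \<alpha>) e t. sat (std \<alpha>) (e(x := y)) \<phi>)"
proof -
  have "teval (std \<alpha>) (e(x := y)) t = teval (std \<alpha>) e t" for y
    using assms by (intro teval_cong) auto
  then show ?thesis by (simp add: bex_def)
qed

lemma sat_ball_bex: "sat A e (ball x t \<phi>) \<longleftrightarrow> \<not> sat A e (bex x t (Neg \<phi>))"
  by (auto simp: bex_def ball_def)

lemma poly_dec_bex:
  assumes "length_term t" "x \<notin> tvars t" "poly_dec (fv \<phi>) (\<lambda>\<alpha> e. sat (std \<alpha>) e \<phi>)"
  shows "poly_dec (fv (bex x t \<phi>)) (\<lambda>\<alpha> e. sat (std \<alpha>) e (bex x t \<phi>))"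
    and "poly_dec (fv (bex x t \<phi>))
      (\<lambda>\<alpha> e. LEAST y. y < teval (std \<alpha>) e t \<and> sat (std \<alpha>) (e(x := y)) \<phi>)"
proof -
  let ?l = "\<lambda>\<alpha> e. let b = teval (std \<alpha>) e t in map (\<lambda>y. sat (std \<alpha>) (e(x := y)) \<phi>) [0..<b]"
  have 1: "poly_dec (fv (bex x t \<phi>)) ?l"
    using assms(2) by (intro poly_dec_mono[OF poly_dec_sharp[OF assms(1,3)]]) (auto simp: bex_def)
  show "poly_dec (fv (bex x t \<phi>)) (\<lambda>\<alpha> e. sat (std \<alpha>) e (bex x t \<phi>))"
    using poly_dec_comp[OF 1, of "\<lambda>l. True \<in> set l"]
    by (simp add: sat_bex_std[OF assms(2)] Let_def image_iff Bex_def)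
  show "poly_dec (fv (bex x t \<phi>))
      (\<lambda>\<alpha> e. LEAST y. y < teval (std \<alpha>) e t \<and> sat (std \<alpha>) (e(x := y)) \<phi>)"
    using poly_dec_comp[OF 1, of "\<lambda>l. LEAST y. y < length l \<and> l ! y"]
    by (simp add: Let_def cong: conj_cong)
qed

lemma poly_dec_quantifier_free:
  assumes "is_formula PVa \<phi>" "quantifier_free \<phi>"
  shows "poly_dec (fv \<phi>) (\<lambda>\<alpha> e. sat (std \<alpha>) e \<phi>)"
  using assms
proof (induction \<phi>)
  case (Eq s t)
  then show ?case using poly_dec_bind[OF poly_dec_term poly_dec_term, of s t "(=)"] by simp
next
  case (Rel R ts)
  then have m: "poly_dec (fv (Rel R ts)) (\<lambda>\<alpha> e. map (\<lambda>t. teval (std \<alpha>) e t) ts)"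
    using poly_dec_map[of ts tvars "\<lambda>t \<alpha> e. teval (std \<alpha>) e t"] by (auto intro: poly_dec_term)
  show ?case
  proof (cases R)
    case Less
    then show ?thesis using poly_dec_comp[OF m, of "\<lambda>l. l ! 0 < l ! 1"] by simp
  next
    case Alpha
    obtain p where p: "polyb p" "\<And>s e. bounded_env (fv (Rel R ts)) s e \<Longrightarrow>
        dec (p s) (\<lambda>\<alpha>. map (\<lambda>t. teval (std \<alpha>) e t) ts)"
      using m unfolding poly_dec_def by blast
    have "dec (p s + 1) (\<lambda>\<alpha>. sat (std \<alpha>) e (Rel R ts))" if "bounded_env (fv (Rel R ts)) s e" for s e
      using dec_bind[OF p(2)[OF that], of "Suc 0" "\<lambda>l \<alpha>. l ! 0 \<in> \<alpha>"] Alpha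
      by (simp add: dec_mem)
    with polyb_add[OF p(1) polyb_const[of 1]] show ?thesis unfolding poly_dec_def by blast
  qed
next
  case (Neg \<phi>)
  then show ?case using poly_dec_comp[of "fv \<phi>" "\<lambda>\<alpha> e. sat (std \<alpha>) e \<phi>" Not] by simp
next
  case (Conj \<phi>s)
  then have "poly_dec (fv (Conj \<phi>s)) (\<lambda>\<alpha> e. map (\<lambda>\<phi>. sat (std \<alpha>) e \<phi>) \<phi>s)"
    using poly_dec_map[of \<phi>s fv "\<lambda>\<phi> \<alpha> e. sat (std \<alpha>) e \<phi>"] by simp
  from poly_dec_comp[OF this, of "\<lambda>l. \<forall>b\<in>set l. b"] show ?case by simp
next
  case (Disj \<phi>s)
  then have "poly_dec (fv (Disj \<phi>s)) (\<lambda>\<alpha> e. map (\<lambda>\<phi>. sat (std \<alpha>) e \<phi>) \<phi>s)"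
    using poly_dec_map[of \<phi>s fv "\<lambda>\<phi> \<alpha> e. sat (std \<alpha>) e \<phi>"] by simp
  from poly_dec_comp[OF this, of "\<lambda>l. \<exists>b\<in>set l. b"] show ?case by simp
qed auto

lemma poly_dec_sharply_bounded:
  assumes "sharply_bounded \<phi>"
  shows "poly_dec (fv \<phi>) (\<lambda>\<alpha> e. sat (std \<alpha>) e \<phi>)"
  using assms
proof induction
  case (1 \<phi>)
  then show ?case by (rule poly_dec_quantifier_free)
next
  case (2 \<phi>)
  then show ?case using poly_dec_comp[of "fv \<phi>" "\<lambda>\<alpha> e. sat (std \<alpha>) e \<phi>" Not] by simp
next
  case (3 \<phi>s)
  then have "poly_dec (fv (Conj \<phi>s)) (\<lambda>\<alpha> e. map (\<lambda>\<phi>. sat (std \<alpha>) e \<phi>) \<phi>s)"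
    using poly_dec_map[of \<phi>s fv "\<lambda>\<phi> \<alpha> e. sat (std \<alpha>) e \<phi>"] by simp
  from poly_dec_comp[OF this, of "\<lambda>l. \<forall>b\<in>set l. b"] show ?case by simp
next
  case (4 \<phi>s)
  then have "poly_dec (fv (Disj \<phi>s)) (\<lambda>\<alpha> e. map (\<lambda>\<phi>. sat (std \<alpha>) e \<phi>) \<phi>s)"
    using poly_dec_map[of \<phi>s fv "\<lambda>\<phi> \<alpha> e. sat (std \<alpha>) e \<phi>"] by simp
  from poly_dec_comp[OF this, of "\<lambda>l. \<exists>b\<in>set l. b"] show ?case by simp
next
  case (5 \<phi> t x)
  then show ?case by (intro poly_dec_bex)
next
  case (6 \<phi> t x)
  have "poly_dec (fv (Neg \<phi>)) (\<lambda>\<alpha> e. sat (std \<alpha>) e (Neg \<phi>))"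
    using poly_dec_comp[OF 6(4), of Not] by simp
  from poly_dec_comp[OF poly_dec_bex(1)[OF 6(2,3) this], of Not] show ?case
    unfolding sat_ball_bex by (simp add: bex_def ball_def)
qed

subsection \<open>Forcing conditions\<close>

text \<open>Here \<open>A\<close> is a structure on the natural numbers, \<open>\<tau>\<close> the
  tupling function and \<open>r\<close> a bound on all arities. A query concerns at most
  \<open>r\<close> arguments and one function value, which is the origin of the factor
  \<open>r + 1\<close> everywhere below.\<close>

locale conditions =
  fixes L :: "(nat, nat) language" and A :: "(nat, nat, nat) struct"
    and \<tau> :: "nat list \<Rightarrow> nat" and r :: nat
  assumes disjoint: "funs L \<inter> rels L = {}"
    and inj: "inj \<tau>"
    and far_le: "f \<in> funs L \<Longrightarrow> far L f \<le> r"
    and rar_le: "R \<in> rels L \<Longrightarrow> rar L R \<le> r"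
begin

text \<open>The equivalence says that the relation is both functional and injective. Injectivity
  carries inequalities between elements of \<open>[n]\<close> over to \<open>A\<close>, and it makes
  the preimage of a function value unique, so that the value has well-defined bits.\<close>

definition cond :: "nat \<Rightarrow> (nat \<times> nat) set \<Rightarrow> bool" where
  "cond n \<sigma> \<longleftrightarrow> finite \<sigma> \<and> fst ` \<sigma> \<subseteq> {..<n} \<and>
     (\<forall>a b a' b'. (a, b) \<in> \<sigma> \<longrightarrow> (a', b') \<in> \<sigma> \<longrightarrow> (a = a' \<longleftrightarrow> b = b'))"

lemma cond_finite: "cond n \<sigma> \<Longrightarrow> finite \<sigma>"
  and cond_dom: "cond n \<sigma> \<Longrightarrow> fst ` \<sigma> \<subseteq> {..<n}"
  by (simp_all add: cond_def)

lemma cond_fun: "cond n \<sigma> \<Longrightarrow> (a, b) \<in> \<sigma> \<Longrightarrow> (a, b') \<in> \<sigma> \<Longrightarrow> b = b'"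
  unfolding cond_def by metis

lemma cond_inj: "cond n \<sigma> \<Longrightarrow> (a, b) \<in> \<sigma> \<Longrightarrow> (a', b) \<in> \<sigma> \<Longrightarrow> a = a'"
  unfolding cond_def by metis

abbreviation maps :: "(nat \<times> nat) set \<Rightarrow> nat list \<Rightarrow> nat list \<Rightarrow> bool" where
  "maps \<sigma> \<equiv> list_all2 (\<lambda>a b. (a, b) \<in> \<sigma>)"

text \<open>Queries that do not code an atomic fact about elements below \<open>n\<close> count as known; their
  answer is negative.\<close>

definition known :: "nat \<Rightarrow> (nat \<times> nat) set \<Rightarrow> nat set" where
  "known n \<sigma> = {x.
     (\<forall>R as. R \<in> rels L \<longrightarrow> length as = rar L R \<longrightarrow> set as \<subseteq> {..<n} \<longrightarrow> x = \<tau> (R # as) \<longrightarrow>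
        (\<exists>bs. maps \<sigma> as bs)) \<and>
     (\<forall>f as j. f \<in> funs L \<longrightarrow> length as = far L f \<longrightarrow> set as \<subseteq> {..<n} \<longrightarrow> x = \<tau> (f # as @ [j]) \<longrightarrow>
        (\<exists>bs v. maps \<sigma> as bs \<and> (v, fn A f bs) \<in> \<sigma>))}"

text \<open>A value in \<open>A\<close> is represented by its preimage \<open>v\<close> below
  \<open>n\<close>, and the oracle lists the bits of \<open>v\<close>. As soon as the value lies in
  the range of the condition, all of its bits are settled together.\<close>

definition answers :: "(nat \<times> nat) set \<Rightarrow> nat set" where
  "answers \<sigma> =
     {\<tau> (R # as) |R as bs. R \<in> rels L \<and> length as = rar L R \<and> maps \<sigma> as bs \<and> rl A R bs} \<union>
     {\<tau> (f # as @ [j]) |f as j bs v. f \<in> funs L \<and> length as = far L f \<and> maps \<sigma> as bs \<and>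
        (v, fn A f bs) \<in> \<sigma> \<and> bit v j}"

lemma maps_mono: "maps \<sigma> as bs \<Longrightarrow> \<sigma> \<subseteq> \<sigma>' \<Longrightarrow> maps \<sigma>' as bs"
  by (erule list_all2_mono) auto

lemma known_mono: "\<sigma> \<subseteq> \<sigma>' \<Longrightarrow> known n \<sigma> \<subseteq> known n \<sigma>'"
  unfolding known_def using maps_mono[of \<sigma> _ _ \<sigma>'] by blast

lemma cond_subset: "cond n \<sigma> \<Longrightarrow> \<sigma>' \<subseteq> \<sigma> \<Longrightarrow> cond n \<sigma>'"
proof -
  assume c: "cond n \<sigma>" and sub: "\<sigma>' \<subseteq> \<sigma>"
  have "a = a' \<longleftrightarrow> b = b'" if "(a, b) \<in> \<sigma>'" "(a', b') \<in> \<sigma>'" for a b a' b'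
    using that subsetD[OF sub] cond_fun[OF c] cond_inj[OF c] by metis
  moreover have "fst ` \<sigma>' \<subseteq> {..<n}" using image_mono[OF sub] cond_dom[OF c] by (rule order_trans)
  ultimately show ?thesis
    unfolding cond_def using c finite_subset[OF sub] by (simp add: cond_finite)
qed

lemma cond_empty: "cond n {}"
  by (simp add: cond_def)

lemma maps_dom: "maps \<sigma> as bs \<Longrightarrow> set as \<subseteq> fst ` \<sigma>"
proof (induction as arbitrary: bs)
  case (Cons a as)
  then obtain b cs where "(a, b) \<in> \<sigma>" "maps \<sigma> as cs" by (auto simp: list_all2_Cons1)
  with Cons.IH[of cs] show ?case by (auto intro: rev_image_eqI[of "(a, b)"])
qed simp

lemma maps_below: "cond n \<sigma> \<Longrightarrow> maps \<sigma> as bs \<Longrightarrow> set as \<subseteq> {..<n}"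
  using maps_dom cond_dom by (meson order_trans)

lemma maps_ex: "set as \<subseteq> fst ` \<sigma> \<Longrightarrow> \<exists>bs. maps \<sigma> as bs"
proof (induction as)
  case (Cons a as)
  then obtain b bs where "(a, b) \<in> \<sigma>" "maps \<sigma> as bs" by auto
  then show ?case by (intro exI[of _ "b # bs"]) simp
qed auto

lemma maps_unique: "cond n \<sigma> \<Longrightarrow> maps \<sigma> as bs \<Longrightarrow> maps \<sigma> as bs' \<Longrightarrow> bs = bs'"
proof (induction as arbitrary: bs bs')
  case (Cons a as)
  then obtain b b' cs cs' where "bs = b # cs" "bs' = b' # cs'" "(a, b) \<in> \<sigma>" "(a, b') \<in> \<sigma>"
    "maps \<sigma> as cs" "maps \<sigma> as cs'"
    by (auto simp: list_all2_Cons1)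
  with Cons.IH[of cs cs'] Cons.prems(1) cond_fun[of n \<sigma> a b b'] show ?case by auto
qed auto

lemma tau_rel_fun: "R \<in> rels L \<Longrightarrow> f \<in> funs L \<Longrightarrow> \<tau> (R # as) \<noteq> \<tau> (f # bs)"
  using disjoint inj by (auto simp: inj_eq)

lemma answers_rel:
  assumes "cond n \<sigma>" "R \<in> rels L" "length as = rar L R" "maps \<sigma> as bs"
  shows "\<tau> (R # as) \<in> answers \<sigma> \<longleftrightarrow> rl A R bs"
proof
  assume "\<tau> (R # as) \<in> answers \<sigma>"
  then obtain cs where "maps \<sigma> as cs" "rl A R cs"
    using assms(2) tau_rel_fun unfolding answers_def by (auto simp: inj_eq[OF inj])
  with maps_unique[OF assms(1,4)] show "rl A R bs" by auto
qed (use assms in \<open>auto simp: answers_def\<close>)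

lemma answers_fun:
  assumes "cond n \<sigma>" "f \<in> funs L" "length as = far L f" "maps \<sigma> as bs" "(v, fn A f bs) \<in> \<sigma>"
  shows "\<tau> (f # as @ [j]) \<in> answers \<sigma> \<longleftrightarrow> bit v j"
proof
  assume "\<tau> (f # as @ [j]) \<in> answers \<sigma>"
  then obtain cs w where "maps \<sigma> as cs" "(w, fn A f cs) \<in> \<sigma>" "bit w j"
    using assms(2) tau_rel_fun unfolding answers_def by (auto simp: inj_eq[OF inj]; metis)
  moreover from this have "cs = bs" using maps_unique[OF assms(1)] assms(4) by auto
  ultimately show "bit v j" using cond_inj[OF assms(1,5)] by blast
qed (use assms in \<open>auto simp: answers_def\<close>)

lemma answers_subset:
  assumes "\<sigma> \<subseteq> \<sigma>'"
  shows "answers \<sigma> \<subseteq> answers \<sigma>'"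
  unfolding answers_def using maps_mono[OF _ assms] assms by blast

text \<open>An extension has nothing new to say about a known query: the arguments already have
  images, these stay the only ones, and by injectivity the preimage of the value stays the same too.
  A query that codes no atomic fact below \<open>n\<close> is answered negatively by every
  condition.\<close>

lemma answers_known:
  assumes c: "cond n \<sigma>'" and sub: "\<sigma> \<subseteq> \<sigma>'" and x: "x \<in> known n \<sigma>"
  shows "x \<in> answers \<sigma>' \<longleftrightarrow> x \<in> answers \<sigma>"
proof
  assume "x \<in> answers \<sigma>'"
  then consider (R) R as bs where "x = \<tau> (R # as)" "R \<in> rels L" "length as = rar L R" "maps \<sigma>' as bs" "rl A R bs"
    | (f) f as j bs v where "x = \<tau> (f # as @ [j])" "f \<in> funs L" "length as = far L f" "maps \<sigma>' as bs"
        "(v, fn A f bs) \<in> \<sigma>'" "bit v j"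
    unfolding answers_def by blast
  then show "x \<in> answers \<sigma>"
  proof cases
    case R
    then obtain cs where cs: "maps \<sigma> as cs" using x maps_below[OF c] unfolding known_def by blast
    with maps_mono[OF this sub] maps_unique[OF c R(4)] have "cs = bs" by auto
    with R cs show ?thesis unfolding answers_def by blast
  next
    case f
    then obtain cs w where cs: "maps \<sigma> as cs" "(w, fn A f cs) \<in> \<sigma>"
      using x maps_below[OF c] unfolding known_def by blast
    with maps_mono[OF _ sub] maps_unique[OF c f(4)] have "cs = bs" by auto
    moreover from this have "w = v" using cs f(5) sub cond_inj[OF c, of w "fn A f bs" v] by auto
    ultimately show ?thesis using f cs unfolding answers_def by blast
  qed
qed (use answers_subset[OF sub] in auto)

lemma cond_card_below:
  assumes "cond n \<sigma>"
  shows "card {p \<in> \<sigma>. fst p \<in> set as} \<le> length as"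
proof -
  have "inj_on fst {p \<in> \<sigma>. fst p \<in> set as}"
    using cond_fun[OF assms] by (auto simp: inj_on_def)
  then have "card {p \<in> \<sigma>. fst p \<in> set as} = card (fst ` {p \<in> \<sigma>. fst p \<in> set as})"
    by (simp add: card_image)
  also have "\<dots> \<le> card (set as)" by (intro card_mono) auto
  also have "\<dots> \<le> length as" by (rule card_length)
  finally show ?thesis .
qed

text \<open>Only the pairs of the arguments and, for a function, the pair of the value matter. A
  condition is functional, so the arguments contribute at most as many pairs as there are
  arguments.\<close>

lemma known_support:
  assumes c: "cond n \<sigma>" and x: "x \<in> known n \<sigma>"
  shows "\<exists>s\<subseteq>\<sigma>. card s \<le> r + 1 \<and> x \<in> known n s"
proof -
  have res: "maps {p \<in> \<sigma>. fst p \<in> set as} as bs" if "maps \<sigma> as bs" for as bs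
    using that by (auto simp: list_all2_conv_all_nth)
  consider (R) R as where "R \<in> rels L" "length as = rar L R" "set as \<subseteq> {..<n}" "x = \<tau> (R # as)"
    | (f) f as j where "f \<in> funs L" "length as = far L f" "set as \<subseteq> {..<n}" "x = \<tau> (f # as @ [j])"
    | (no) "x \<in> known n {}"
    unfolding known_def by blast
  then show ?thesis
  proof cases
    case R
    then obtain bs where bs: "maps \<sigma> as bs" using x unfolding known_def by blast
    have "x \<in> known n {p \<in> \<sigma>. fst p \<in> set as}"
      using R res[OF bs] tau_rel_fun unfolding known_def by (auto simp: inj_eq[OF inj])
    moreover have "card {p \<in> \<sigma>. fst p \<in> set as} \<le> r + 1"
      using cond_card_below[OF c, of as] rar_le R by fastforce
    ultimately show ?thesis by (intro exI[of _ "{p \<in> \<sigma>. fst p \<in> set as}"]) auto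
  next
    case f
    then obtain bs v where bs: "maps \<sigma> as bs" "(v, fn A f bs) \<in> \<sigma>" using x unfolding known_def by blast
    let ?s = "insert (v, fn A f bs) {p \<in> \<sigma>. fst p \<in> set as}"
    have "maps ?s as bs" by (rule maps_mono[OF res[OF bs(1)]]) auto
    then have "x \<in> known n ?s"
      using f tau_rel_fun unfolding known_def by (auto simp: inj_eq[OF inj]; metis)
    moreover have "card ?s \<le> r + 1"
      using cond_card_below[OF c, of as] far_le f card_insert_le_m1[of "r + 1" "{p \<in> \<sigma>. fst p \<in> set as}"]
      by fastforce
    ultimately show ?thesis using bs by (intro exI[of _ ?s]) auto
  next
    case no
    then show ?thesis by (intro exI[of _ "{}"]) simp
  qed
qed

text \<open>Here the infinity of the structure enters: a finite condition leaves some element of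
  \<open>A\<close> free to become the image of \<open>a\<close>.\<close>

lemma extend_point:
  assumes c: "cond n \<sigma>" and a: "a < n"
  shows "\<exists>\<sigma>'. \<sigma> \<subseteq> \<sigma>' \<and> cond n \<sigma>' \<and> a \<in> fst ` \<sigma>' \<and> card \<sigma>' \<le> card \<sigma> + 1"
proof (cases "a \<in> fst ` \<sigma>")
  case True
  with c show ?thesis by (intro exI[of _ \<sigma>]) auto
next
  case False
  have "finite (snd ` \<sigma>)" using c by (simp add: cond_def)
  then obtain b where b: "b \<notin> snd ` \<sigma>" using ex_new_if_finite[OF infinite_UNIV_nat] by blast
  have "cond n (insert (a, b) \<sigma>)"
    using c a False b unfolding cond_def by (auto simp: image_iff Bex_def)
  then show ?thesis by (intro exI[of _ "insert (a, b) \<sigma>"]) (auto simp: card_insert_if cond_def)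
qed

text \<open>Here the size of the condition enters: the new value needs a preimage in
  \<open>[n]\<close> that is not in use yet.\<close>

lemma extend_value:
  assumes c: "cond n \<sigma>" and n: "card \<sigma> < n"
  shows "\<exists>\<sigma>'. \<sigma> \<subseteq> \<sigma>' \<and> cond n \<sigma>' \<and> b \<in> snd ` \<sigma>' \<and> card \<sigma>' \<le> card \<sigma> + 1"
proof (cases "b \<in> snd ` \<sigma>")
  case True
  with c show ?thesis by (intro exI[of _ \<sigma>]) auto
next
  case False
  have "card (fst ` \<sigma>) < card {..<n}"
    using n card_image_le[of \<sigma> fst] c by (auto simp: cond_def)
  then have "\<not> {..<n} \<subseteq> fst ` \<sigma>" using card_mono[of "fst ` \<sigma>" "{..<n}"] c by (auto simp: cond_def)
  then obtain a where a: "a < n" "a \<notin> fst ` \<sigma>" by auto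
  have "cond n (insert (a, b) \<sigma>)"
    using c a False unfolding cond_def by (auto simp: image_iff Bex_def)
  then show ?thesis by (intro exI[of _ "insert (a, b) \<sigma>"]) (auto simp: card_insert_if cond_def)
qed

lemma extend_points:
  assumes "cond n \<sigma>" "set as \<subseteq> {..<n}"
  shows "\<exists>\<sigma>'. \<sigma> \<subseteq> \<sigma>' \<and> cond n \<sigma>' \<and> set as \<subseteq> fst ` \<sigma>' \<and> card \<sigma>' \<le> card \<sigma> + length as"
  using assms(2)
proof (induction as)
  case Nil
  then show ?case using assms(1) by auto
next
  case (Cons a as)
  then obtain \<sigma>' where 1: "\<sigma> \<subseteq> \<sigma>'" "cond n \<sigma>'" "set as \<subseteq> fst ` \<sigma>'" "card \<sigma>' \<le> card \<sigma> + length as" by auto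
  from Cons.prems extend_point[OF 1(2), of a] obtain \<sigma>'' where
    2: "\<sigma>' \<subseteq> \<sigma>''" "cond n \<sigma>''" "a \<in> fst ` \<sigma>''" "card \<sigma>'' \<le> card \<sigma>' + 1" by auto
  from 1(3) image_mono[OF 2(1), of fst] have "set as \<subseteq> fst ` \<sigma>''" by (rule order_trans)
  with 1 2 show ?case by (intro exI[of _ \<sigma>'']) auto
qed

lemma extend_known:
  assumes c: "cond n \<sigma>" and n: "card \<sigma> + (r + 1) \<le> n"
  shows "\<exists>\<sigma>'. \<sigma> \<subseteq> \<sigma>' \<and> cond n \<sigma>' \<and> x \<in> known n \<sigma>' \<and> card \<sigma>' \<le> card \<sigma> + (r + 1)"
proof -
  consider (R) R as where "R \<in> rels L" "length as = rar L R" "set as \<subseteq> {..<n}" "x = \<tau> (R # as)"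
    | (f) f as j where "f \<in> funs L" "length as = far L f" "set as \<subseteq> {..<n}" "x = \<tau> (f # as @ [j])"
    | (no) "x \<in> known n {}"
    unfolding known_def by blast
  then show ?thesis
  proof cases
    case R
    from extend_points[OF c R(3)] obtain \<sigma>' where
      1: "\<sigma> \<subseteq> \<sigma>'" "cond n \<sigma>'" "set as \<subseteq> fst ` \<sigma>'" "card \<sigma>' \<le> card \<sigma> + length as" by blast
    have "x \<in> known n \<sigma>'"
      using R maps_ex[OF 1(3)] tau_rel_fun unfolding known_def by (auto simp: inj_eq[OF inj])
    with 1 R rar_le[OF R(1)] show ?thesis by (intro exI[of _ \<sigma>']) auto
  next
    case f
    from extend_points[OF c f(3)] obtain \<sigma>' where
      1: "\<sigma> \<subseteq> \<sigma>'" "cond n \<sigma>'" "set as \<subseteq> fst ` \<sigma>'" "card \<sigma>' \<le> card \<sigma> + length as" by blast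
    from maps_ex[OF 1(3)] obtain bs where bs: "maps \<sigma>' as bs" ..
    have "card \<sigma>' < n" using 1 f far_le[OF f(1)] n by linarith
    from extend_value[OF 1(2) this, of "fn A f bs"] obtain \<sigma>'' v where
      2: "\<sigma>' \<subseteq> \<sigma>''" "cond n \<sigma>''" "(v, fn A f bs) \<in> \<sigma>''" "card \<sigma>'' \<le> card \<sigma>' + 1" by auto
    have "x \<in> known n \<sigma>''"
      using f maps_mono[OF bs 2(1)] 2(3) tau_rel_fun unfolding known_def by (auto simp: inj_eq[OF inj]; metis)
    with 1 2 f far_le[OF f(1)] show ?thesis by (intro exI[of _ \<sigma>'']) auto
  next
    case no
    then show ?thesis using c known_mono[of "{}" \<sigma> n] by (intro exI[of _ \<sigma>]) auto
  qed
qed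

section \<open>Oracles that agree with a condition on finitely many queries\<close>

definition cone :: "nat set \<Rightarrow> (nat \<times> nat) set \<Rightarrow> nat set set" where
  "cone Z \<sigma> = {\<beta>. \<forall>z\<in>Z. z \<in> \<beta> \<longleftrightarrow> z \<in> answers \<sigma>}"

lemma answers_in_cone: "answers \<sigma> \<in> cone Z \<sigma>"
  by (simp add: cone_def)

lemma cone_antimono: "Z \<subseteq> Z' \<Longrightarrow> cone Z' \<sigma> \<subseteq> cone Z \<sigma>"
  by (auto simp: cone_def)

text \<open>A cone consists of arbitrary oracles with the prescribed answers, not only of those that
  come from conditions. It is thus determined by the answers on \<open>Z\<close>, and any condition
  that knows these queries may be replaced by another comparable one.\<close>

lemma cone_eq: "cond n \<sigma>' \<Longrightarrow> \<sigma> \<subseteq> \<sigma>' \<Longrightarrow> Z \<subseteq> known n \<sigma> \<Longrightarrow> cone Z \<sigma>' = cone Z \<sigma>"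
  using answers_known unfolding cone_def by blast

text \<open>Walk down the tree, making each query on the branch known before following its answer.
  The branch has at most \<open>h\<close> queries and each costs at most \<open>r + 1\<close> pairs;
  the queries met on the way form the certificate.\<close>

lemma dense_dec:
  assumes "dec h F" "cond n \<sigma>" "card \<sigma> + (r + 1) * h \<le> n"
  shows "\<exists>\<sigma>'. \<sigma> \<subseteq> \<sigma>' \<and> cond n \<sigma>' \<and> card \<sigma>' \<le> card \<sigma> + (r + 1) * h \<and>
    (\<exists>Z\<subseteq>known n \<sigma>'. finite Z \<and> card Z \<le> h \<and> (\<exists>v. \<forall>\<beta>\<in>cone Z \<sigma>'. F \<beta> = v))"
  using assms
proof (induction arbitrary: \<sigma> rule: dec.induct)
  case (dec_const h v)
  then show ?case by (intro exI[of _ \<sigma>] conjI exI[of _ "{}"]) auto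
next
  case (dec_if h F G x)
  have "card \<sigma> + (r + 1) \<le> n" using dec_if.prems by simp
  from extend_known[OF dec_if.prems(1) this, of x] obtain \<sigma>1 where
    1: "\<sigma> \<subseteq> \<sigma>1" "cond n \<sigma>1" "x \<in> known n \<sigma>1" "card \<sigma>1 \<le> card \<sigma> + (r + 1)" by blast
  define E where "E = (if x \<in> answers \<sigma>1 then F else G)"
  have n: "card \<sigma>1 + (r + 1) * h \<le> n" using 1 dec_if.prems by simp
  have "\<exists>\<sigma>'. \<sigma>1 \<subseteq> \<sigma>' \<and> cond n \<sigma>' \<and> card \<sigma>' \<le> card \<sigma>1 + (r + 1) * h \<and>
    (\<exists>Z\<subseteq>known n \<sigma>'. finite Z \<and> card Z \<le> h \<and> (\<exists>v. \<forall>\<beta>\<in>cone Z \<sigma>'. E \<beta> = v))"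
    unfolding E_def using dec_if.IH[OF 1(2) n] by simp
  then obtain \<sigma>' Z v where 2: "\<sigma>1 \<subseteq> \<sigma>'" "cond n \<sigma>'" "card \<sigma>' \<le> card \<sigma>1 + (r + 1) * h"
    "Z \<subseteq> known n \<sigma>'" "finite Z" "card Z \<le> h" "\<forall>\<beta>\<in>cone Z \<sigma>'. E \<beta> = v" by blast
  have ans: "x \<in> answers \<sigma>' \<longleftrightarrow> x \<in> answers \<sigma>1" using answers_known[OF 2(2,1) 1(3)] .
  have "(if x \<in> \<beta> then F \<beta> else G \<beta>) = v" if "\<beta> \<in> cone (insert x Z) \<sigma>'" for \<beta>
  proof -
    have "x \<in> \<beta> \<longleftrightarrow> x \<in> answers \<sigma>1" "\<beta> \<in> cone Z \<sigma>'" using that ans by (auto simp: cone_def)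
    with 2(7) show ?thesis by (auto simp: E_def)
  qed
  moreover have "insert x Z \<subseteq> known n \<sigma>'" using 2(4) subsetD[OF known_mono[OF 2(1)] 1(3)] by simp
  moreover have "card (insert x Z) \<le> Suc h" using 2 by (simp add: card_insert_if)
  moreover have "card \<sigma>' \<le> card \<sigma> + (r + 1) * Suc h" using 1 2 by simp
  ultimately show ?case using 1 2 by (intro exI[of _ \<sigma>'] conjI exI[of _ "insert x Z"]) auto
qed

text \<open>Add to \<open>p\<close> the supports of the queries in \<open>Z\<close>. The cost
  depends on the number of queries and not on the size of the surrounding condition.\<close>

lemma shrink:
  assumes c: "cond n \<sigma>" and p: "p \<subseteq> \<sigma>" and Z: "finite Z" "Z \<subseteq> known n \<sigma>"
  shows "\<exists>q. p \<subseteq> q \<and> q \<subseteq> \<sigma> \<and> Z \<subseteq> known n q \<and> card q \<le> card p + (r + 1) * card Z"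
  using Z
proof (induction Z)
  case empty
  then show ?case using p by (intro exI[of _ p]) auto
next
  case (insert x Z)
  then obtain q where q: "p \<subseteq> q" "q \<subseteq> \<sigma>" "Z \<subseteq> known n q" "card q \<le> card p + (r + 1) * card Z" by auto
  from known_support[OF c, of x] insert obtain s where s: "s \<subseteq> \<sigma>" "card s \<le> r + 1" "x \<in> known n s" by auto
  have "card (q \<union> s) \<le> card p + (r + 1) * card (insert x Z)"
    using card_Un_le[of q s] q s insert by simp
  moreover have "insert x Z \<subseteq> known n (q \<union> s)"
    using q s known_mono[of q "q \<union> s" n] known_mono[of s "q \<union> s" n] by auto
  ultimately show ?case using q s by (intro exI[of _ "q \<union> s"]) auto
qed

section \<open>Certificates with few queries\<close>

definition certified :: "nat \<Rightarrow> (nat \<times> nat) set \<Rightarrow> nat \<Rightarrow> (nat set set \<Rightarrow> bool) \<Rightarrow> bool" where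
  "certified n \<sigma> h Q \<longleftrightarrow> (\<exists>Z\<subseteq>known n \<sigma>. finite Z \<and> card Z \<le> h \<and> Q (cone Z \<sigma>))"

text \<open>The size allowed for \<open>q\<close> is what \<open>shrink\<close> produces from a
  certificate with \<open>h\<close> queries. The extension need not be compatible with the
  conditions chosen later; it only has to exist over \<open>p\<close>.\<close>

definition possible :: "nat \<Rightarrow> (nat \<times> nat) set \<Rightarrow> nat \<Rightarrow> (nat set set \<Rightarrow> bool) \<Rightarrow> bool" where
  "possible n p h Q \<longleftrightarrow> (\<exists>q. p \<subseteq> q \<and> cond n q \<and> card q \<le> card p + (r + 1) * h \<and> certified n q h Q)"

text \<open>The condition that carries the certificate may be much larger than \<open>p\<close>, but
  the part of it that is relevant for the certificate is small. Hence whatever is certified at a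
  later stage was already possible at the present one, and a least choice among the possible values
  cannot be undercut afterwards.\<close>

lemma certified_possible:
  assumes "cond n \<sigma>" "certified n \<sigma> h Q" "p \<subseteq> \<sigma>"
  shows "possible n p h Q"
proof -
  from assms(2) obtain Z where Z: "Z \<subseteq> known n \<sigma>" "finite Z" "card Z \<le> h" "Q (cone Z \<sigma>)"
    unfolding certified_def by blast
  from shrink[OF assms(1,3) Z(2,1)] obtain q where
    q: "p \<subseteq> q" "q \<subseteq> \<sigma>" "Z \<subseteq> known n q" "card q \<le> card p + (r + 1) * card Z" by blast
  have "card q \<le> card p + (r + 1) * h"
    using q(4) mult_le_mono2[OF Z(3), of "r + 1"] by linarith
  moreover have "certified n q h Q"
    using Z q cone_eq[OF assms(1) q(2,3)] unfolding certified_def by auto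
  ultimately show ?thesis using q cond_subset[OF assms(1) q(2)] unfolding possible_def by blast
qed

lemma certified_mono:
  assumes "cond n \<sigma>'" "certified n \<sigma> h Q" "\<sigma> \<subseteq> \<sigma>'" "h \<le> h'"
  shows "certified n \<sigma>' h' Q"
proof -
  from assms(2) obtain Z where Z: "Z \<subseteq> known n \<sigma>" "finite Z" "card Z \<le> h" "Q (cone Z \<sigma>)"
    unfolding certified_def by blast
  with cone_eq[OF assms(1,3) Z(1)] known_mono[OF assms(3), of n] assms(4) show ?thesis
    unfolding certified_def by (intro exI[of _ Z]) auto
qed

lemma certified_conj:
  assumes "certified n \<sigma> h Q" "certified n \<sigma> h' Q'"
    and "\<And>C C'. C' \<subseteq> C \<Longrightarrow> Q C \<Longrightarrow> Q C'" "\<And>C C'. C' \<subseteq> C \<Longrightarrow> Q' C \<Longrightarrow> Q' C'"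
  shows "certified n \<sigma> (h + h') (\<lambda>C. Q C \<and> Q' C)"
proof -
  obtain Z Z' where Z: "Z \<subseteq> known n \<sigma>" "finite Z" "card Z \<le> h" "Q (cone Z \<sigma>)"
    and Z': "Z' \<subseteq> known n \<sigma>" "finite Z'" "card Z' \<le> h'" "Q' (cone Z' \<sigma>)"
    using assms(1,2) unfolding certified_def by blast
  have "Q (cone (Z \<union> Z') \<sigma>)" "Q' (cone (Z \<union> Z') \<sigma>)"
    using assms(3)[OF cone_antimono[of Z "Z \<union> Z'" \<sigma>] Z(4)]
      assms(4)[OF cone_antimono[of Z' "Z \<union> Z'" \<sigma>] Z'(4)] by auto
  with Z Z' card_Un_le[of Z Z'] show ?thesis
    unfolding certified_def by (intro exI[of _ "Z \<union> Z'"]) auto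
qed

lemma certified_weaken: "certified n \<sigma> h Q \<Longrightarrow> (\<And>C. Q C \<Longrightarrow> Q' C) \<Longrightarrow> h \<le> h' \<Longrightarrow> certified n \<sigma> h' Q'"
  unfolding certified_def by (meson order_trans)

lemma certified_known:
  assumes "certified n \<sigma> h Q" "\<And>C C'. C' \<subseteq> C \<Longrightarrow> Q C \<Longrightarrow> Q C'"
  shows "Q (cone (known n \<sigma>) \<sigma>)"
  using assms cone_antimono unfolding certified_def by metis

lemma possible_dec:
  assumes "dec h F" "cond n \<sigma>" "card \<sigma> + (r + 1) * h \<le> n"
  shows "\<exists>v. possible n \<sigma> h (\<lambda>C. \<forall>\<beta>\<in>C. F \<beta> = v)"
  using dense_dec[OF assms] unfolding possible_def certified_def by blast

end

subsection \<open>Forcing bounded existential formulas\<close>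

text \<open>Records how a bounded existential formula was built, since forcing is defined along the
  construction and not along the formula: everything sharply bounded is a leaf \<open>SB\<close>.
  The two rules for existential quantifiers merge into \<open>SBex\<close>, a length term being a
  term.\<close>

datatype sg = SB "(otm, pv_rel) fm" | SConj "sg list" | SDisj "sg list"
  | SBex nat "otm trm" sg | SBall nat "otm trm" sg

instance sg :: countable by countable_datatype

fun to_fm :: "sg \<Rightarrow> (otm, pv_rel) fm" where
  "to_fm (SB \<theta>) = \<theta>"
| "to_fm (SConj gs) = Conj (map to_fm gs)"
| "to_fm (SDisj gs) = Disj (map to_fm gs)"
| "to_fm (SBex x t g) = bex x t (to_fm g)"
| "to_fm (SBall x t g) = ball x t (to_fm g)"

fun wf_sg :: "sg \<Rightarrow> bool" where
  "wf_sg (SB \<theta>) = sharply_bounded \<theta>"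
| "wf_sg (SConj gs) = (\<forall>g\<in>set gs. wf_sg g)"
| "wf_sg (SDisj gs) = (\<forall>g\<in>set gs. wf_sg g)"
| "wf_sg (SBex x t g) = (wf_sg g \<and> is_term PVa t \<and> x \<notin> tvars t)"
| "wf_sg (SBall x t g) = (wf_sg g \<and> length_term t \<and> x \<notin> tvars t)"

lemma Sigma_b_1_sg: "Sigma_b_1 \<chi> \<Longrightarrow> \<exists>g. wf_sg g \<and> to_fm g = \<chi>"
proof (induction rule: Sigma_b_1.induct)
  case (1 \<phi>)
  then show ?case by (intro exI[of _ "SB \<phi>"]) simp
next
  case (2 \<phi>s)
  then obtain G where "\<And>\<phi>. \<phi> \<in> set \<phi>s \<Longrightarrow> wf_sg (G \<phi>) \<and> to_fm (G \<phi>) = \<phi>" by metis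
  then show ?case by (intro exI[of _ "SConj (map G \<phi>s)"]) (simp add: map_idI)
next
  case (3 \<phi>s)
  then obtain G where "\<And>\<phi>. \<phi> \<in> set \<phi>s \<Longrightarrow> wf_sg (G \<phi>) \<and> to_fm (G \<phi>) = \<phi>" by metis
  then show ?case by (intro exI[of _ "SDisj (map G \<phi>s)"]) (simp add: map_idI)
next
  case (4 \<phi> t x)
  then obtain g where "wf_sg g" "to_fm g = \<phi>" by blast
  with 4 length_termE[OF 4(2)] show ?case by (intro exI[of _ "SBex x t g"]) auto
next
  case (5 \<phi> t x)
  then obtain g where "wf_sg g" "to_fm g = \<phi>" by blast
  with 5 show ?case by (intro exI[of _ "SBall x t g"]) auto
next
  case (6 \<phi> t x)
  then obtain g where "wf_sg g" "to_fm g = \<phi>" by blast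
  with 6 show ?case by (intro exI[of _ "SBex x t g"]) auto
qed

text \<open>Here \<open>C\<close> is the set of oracles that are still possible.\<close>

fun force :: "nat set set \<Rightarrow> sg \<Rightarrow> (nat \<Rightarrow> nat) \<Rightarrow> bool" where
  "force C (SB \<theta>) e = (\<forall>\<beta>\<in>C. sat (std \<beta>) e \<theta>)"
| "force C (SConj gs) e = (\<forall>g\<in>set gs. force C g e)"
| "force C (SDisj gs) e = (\<exists>g\<in>set gs. force C g e)"
| "force C (SBex x t g) e = (\<exists>y. (\<forall>\<beta>\<in>C. y < teval (std \<beta>) e t) \<and> force C g (e(x := y)))"
| "force C (SBall x t g) e =
    (\<exists>b. (\<forall>\<beta>\<in>C. teval (std \<beta>) e t = b) \<and> (\<forall>y<b. force C g (e(x := y))))"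

text \<open>Disjuncts, witnesses and the value of a sharp bound are chosen once for all oracles in
  \<open>C\<close>, so the choices remain good for fewer oracles.\<close>

lemma force_antimono: "force C g e \<Longrightarrow> C' \<subseteq> C \<Longrightarrow> force C' g e"
proof (induction g arbitrary: e)
  case (SBex x t g)
  then show ?case by simp (meson subsetD)
next
  case (SBall x t g)
  then show ?case by simp (meson subsetD)
qed auto

lemma force_cong:
  assumes "wf_sg g" "\<And>x. x \<in> fv (to_fm g) \<Longrightarrow> e x = e' x"
  shows "force C g e \<longleftrightarrow> force C g e'"
  using assms
proof (induction g arbitrary: e e')
  case (SB \<theta>)
  then have "sat (std \<beta>) e \<theta> \<longleftrightarrow> sat (std \<beta>) e' \<theta>" for \<beta> by (intro sat_cong) simp
  then show ?case by simp
next
  case (SConj gs)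
  have "force C g e \<longleftrightarrow> force C g e'" if "g \<in> set gs" for g
    using SConj.prems that by (intro SConj.IH[OF that]) auto
  then show ?case by simp
next
  case (SDisj gs)
  have "force C g e \<longleftrightarrow> force C g e'" if "g \<in> set gs" for g
    using SDisj.prems that by (intro SDisj.IH[OF that]) auto
  then show ?case by simp
next
  case (SBex x t g)
  have "force C g (e(x := y)) \<longleftrightarrow> force C g (e'(x := y))" for y
    using SBex.prems by (intro SBex.IH) (auto simp: bex_def)
  moreover have "teval (std \<beta>) e t = teval (std \<beta>) e' t" for \<beta>
    using SBex.prems by (intro teval_cong) (auto simp: bex_def)
  ultimately show ?case by simp
next
  case (SBall x t g)
  have "force C g (e(x := y)) \<longleftrightarrow> force C g (e'(x := y))" for y
    using SBall.prems by (intro SBall.IH) (auto simp: ball_def)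
  moreover have "teval (std \<beta>) e t = teval (std \<beta>) e' t" for \<beta>
    using SBall.prems by (intro teval_cong) (auto simp: ball_def)
  ultimately show ?case by simp
qed

subsection \<open>Ultrapowers\<close>

definition proj :: "('v \<Rightarrow> nat \<Rightarrow> 'b) \<Rightarrow> nat \<Rightarrow> 'v \<Rightarrow> 'b" where
  "proj e i = (\<lambda>x. e x i)"

lemma proj_upd: "proj (e(x := a)) i = (proj e i)(x := a i)"
  by (auto simp: proj_def)

abbreviation at_index :: "nat \<Rightarrow> (nat \<Rightarrow> 'b) list \<Rightarrow> 'b list" where
  "at_index i \<equiv> map (\<lambda>f. f i)"

lemma env_at_index [simp]: "x < K \<Longrightarrow> env (at_index i (map e [0..<K])) x = proj e i x"
  by (simp add: env_def proj_def)

text \<open>The ultrapower is built from the sequences in \<open>F\<close> instead of from all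
  sequences, so that \<open>F\<close> can be countable and all requirements can be listed. The
  assumption \<open>least_F\<close> provides definable Skolem functions, which the quantifier cases
  of \<open>los\<close> call for.\<close>

locale ultrapower =
  fixes U :: "nat filter" and F :: "point set"
  assumes ultra: "ultrafilter U"
    and const_F: "(\<lambda>_. c) \<in> F"
    and pv_F: "set fs \<subseteq> F \<Longrightarrow> (\<lambda>i. otm_fun {} m (at_index i fs)) \<in> F"
    and least_F: "set fs \<subseteq> F \<Longrightarrow>
      (\<lambda>i. LEAST a. sat std_PV ((env (at_index i fs))(x := a)) \<theta>) \<in> F"
begin

lemma U_not: "eventually (\<lambda>i. \<not> P i) U \<longleftrightarrow> \<not> eventually P U"
  by (rule ultrafilter_not[OF ultra])

lemma U_nonempty: "U \<noteq> bot"
  using ultra by (simp add: ultrafilter_def)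

text \<open>One member of each class modulo \<open>U\<close> is selected, so that the model lives on
  sequences and its equality is genuine equality.\<close>

definition rep :: "point \<Rightarrow> point" where
  "rep f = (SOME g. g \<in> F \<and> eventually (\<lambda>i. f i = g i) U)"

lemma rep:
  assumes "f \<in> F"
  shows "rep f \<in> F" "eventually (\<lambda>i. rep f i = f i) U"
proof -
  have "f \<in> F \<and> eventually (\<lambda>i. f i = f i) U" using assms by simp
  then have "rep f \<in> F \<and> eventually (\<lambda>i. f i = rep f i) U"
    unfolding rep_def
    by (rule someI[where P = "\<lambda>g. g \<in> F \<and> eventually (\<lambda>i. f i = g i) U"])
  then show "rep f \<in> F" "eventually (\<lambda>i. rep f i = f i) U" by (auto simp: eq_commute)
qed

lemma rep_cong:
  assumes "eventually (\<lambda>i. f i = g i) U"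
  shows "rep f = rep g"
proof -
  have "eventually (\<lambda>i. f i = h i) U \<longleftrightarrow> eventually (\<lambda>i. g i = h i) U" for h
    by (rule eventually_cong) (use assms in \<open>auto elim: eventually_mono\<close>)
  then show ?thesis unfolding rep_def by simp
qed

definition pts :: "point set" where
  "pts = rep ` F"

lemma pts_F: "f \<in> pts \<Longrightarrow> f \<in> F"
  unfolding pts_def using rep by auto

lemma rep_pts: "f \<in> F \<Longrightarrow> rep f \<in> pts"
  by (simp add: pts_def)

lemma rep_id: "f \<in> pts \<Longrightarrow> rep f = f"
  unfolding pts_def using rep_cong[OF rep(2)] by auto

lemma pts_eq_iff: "f \<in> pts \<Longrightarrow> g \<in> pts \<Longrightarrow> f = g \<longleftrightarrow> eventually (\<lambda>i. f i = g i) U"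
  using rep_id rep_cong by fastforce

definition M :: "(point, otm, pv_rel) struct" where
  "M = \<lparr>Dom = pts, fn = (\<lambda>m as. rep (\<lambda>i. otm_fun {} m (at_index i as))),
        rl = (\<lambda>R as. case R of Less \<Rightarrow> eventually (\<lambda>i. (as ! 0) i < (as ! 1) i) U | Alpha \<Rightarrow> False)\<rparr>"

lemma M_simps [simp]:
  "Dom M = pts" "fn M m as = rep (\<lambda>i. otm_fun {} m (at_index i as))"
  "rl M Less as \<longleftrightarrow> eventually (\<lambda>i. (as ! 0) i < (as ! 1) i) U"
  by (simp_all add: M_def)

lemma M_fn:
  assumes "set as \<subseteq> pts"
  shows "fn M m as \<in> pts" "eventually (\<lambda>i. fn M m as i = otm_fun {} m (at_index i as)) U"
proof -
  have "(\<lambda>i. otm_fun {} m (at_index i as)) \<in> F" using assms pts_F by (intro pv_F) auto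
  then show "fn M m as \<in> pts" "eventually (\<lambda>i. fn M m as i = otm_fun {} m (at_index i as)) U"
    using rep rep_pts by auto
qed

lemma is_struct_M: "is_struct PV M"
  using M_fn rep_pts[OF const_F] by (auto simp: is_struct_def)

lemma teval_M:
  assumes "range e \<subseteq> pts"
  shows "teval M e t \<in> pts \<and> eventually (\<lambda>i. teval M e t i = teval std_PV (proj e i) t) U"
proof (induction t)
  case (Var x)
  then show ?case using assms by (auto simp: proj_def)
next
  case (Fun m ts)
  then have ts: "set (map (teval M e) ts) \<subseteq> pts" by auto
  have "eventually (\<lambda>i. \<forall>t\<in>set ts. teval M e t i = teval std_PV (proj e i) t) U"
    using Fun by (intro eventually_ball_finite) auto
  then have "eventually (\<lambda>i. at_index i (map (teval M e) ts) = map (teval std_PV (proj e i)) ts) U"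
    by (rule eventually_mono) simp
  with M_fn(2)[OF ts, of m]
  have "eventually (\<lambda>i. teval M e (Fun m ts) i = teval std_PV (proj e i) (Fun m ts)) U"
  proof eventually_elim
    case (elim i)
    then show ?case by (simp del: M_simps map_map)
  qed
  with M_fn(1)[OF ts] show ?case by simp
qed

lemma los:
  assumes "is_formula PV \<theta>" "range e \<subseteq> pts"
  shows "sat M e \<theta> \<longleftrightarrow> eventually (\<lambda>i. sat std_PV (proj e i) \<theta>) U"
  using assms
proof (induction \<theta> arbitrary: e)
  case (Eq s t)
  have "sat M e (Eq s t) \<longleftrightarrow> eventually (\<lambda>i. teval M e s i = teval M e t i) U"
    using teval_M[OF Eq(2)] pts_eq_iff by simp
  also have "\<dots> \<longleftrightarrow> eventually (\<lambda>i. sat std_PV (proj e i) (Eq s t)) U"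
    by (rule eventually_cong[OF eventually_conj[OF conjunct2[OF teval_M[OF Eq(2), of s]]
          conjunct2[OF teval_M[OF Eq(2), of t]]]]) simp
  finally show ?case .
next
  case (Rel R ts)
  then have R: "R = Less" "length ts = 2" by (cases R; simp)+
  then obtain s t where ts: "ts = [s, t]" by (auto simp: numeral_2_eq_2 length_Suc_conv)
  have "sat M e (Rel R ts) \<longleftrightarrow> eventually (\<lambda>i. teval M e s i < teval M e t i) U"
    by (simp add: R ts)
  also have "\<dots> \<longleftrightarrow> eventually (\<lambda>i. sat std_PV (proj e i) (Rel R ts)) U"
    by (rule eventually_cong[OF eventually_conj[OF conjunct2[OF teval_M[OF Rel(2), of s]]
          conjunct2[OF teval_M[OF Rel(2), of t]]]]) (simp add: R ts)
  finally show ?case .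
next
  case (Neg \<theta>)
  then have "sat M e \<theta> \<longleftrightarrow> eventually (\<lambda>i. sat std_PV (proj e i) \<theta>) U" by simp
  then show ?case by (simp add: U_not)
next
  case (Conj \<theta>s)
  have "sat M e \<theta> \<longleftrightarrow> eventually (\<lambda>i. sat std_PV (proj e i) \<theta>) U" if "\<theta> \<in> set \<theta>s" for \<theta>
    using Conj.prems that by (intro Conj.IH[OF that]) auto
  then show ?case by (simp add: eventually_ball_finite_distrib)
next
  case (Disj \<theta>s)
  have "sat M e \<theta> \<longleftrightarrow> eventually (\<lambda>i. sat std_PV (proj e i) \<theta>) U" if "\<theta> \<in> set \<theta>s" for \<theta>
    using Disj.prems that by (intro Disj.IH[OF that]) auto
  then show ?case by (simp add: ultrafilter_bex[OF ultra])
next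
  case (Ex x \<theta>)
  have IH: "sat M (e(x := a)) \<theta> \<longleftrightarrow> eventually (\<lambda>i. sat std_PV ((proj e i)(x := a i)) \<theta>) U"
    if "a \<in> pts" for a
  proof -
    have "is_formula PV \<theta>" using Ex.prems(1) by simp
    from Ex.IH[OF this range_fun_upd[OF Ex.prems(2) that, of x]] show ?thesis unfolding proj_upd .
  qed
  show ?case
  proof
    assume "sat M e (Ex x \<theta>)"
    then obtain a where "a \<in> pts" "sat M (e(x := a)) \<theta>" by auto
    with IH have "eventually (\<lambda>i. sat std_PV ((proj e i)(x := a i)) \<theta>) U" by blast
    then show "eventually (\<lambda>i. sat std_PV (proj e i) (Ex x \<theta>)) U" by (rule eventually_mono) auto
  next
    assume r: "eventually (\<lambda>i. sat std_PV (proj e i) (Ex x \<theta>)) U"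
    define K where "K = Suc (Max (insert 0 (fv \<theta>)))"
    have K: "y < K" if "y \<in> fv \<theta>" for y
      using that unfolding K_def by (simp add: less_Suc_eq_le)
    \<comment> \<open>The least witness depends on the finitely many values of \<open>e\<close>
      below \<open>K\<close>, a bound for the variables of \<open>\<theta>\<close>; this is what
      puts \<open>w\<close> into \<open>F\<close>. At indices without a witness its value is
      arbitrary, and there are only negligibly many of them.\<close>
    define w where "w = (\<lambda>i. LEAST a. sat std_PV ((env (at_index i (map e [0..<K])))(x := a)) \<theta>)"
    have w: "w \<in> F" unfolding w_def using Ex.prems(2) pts_F by (intro least_F) auto
    have eq: "sat std_PV ((env (at_index i (map e [0..<K])))(x := a)) \<theta> \<longleftrightarrow> sat std_PV ((proj e i)(x := a)) \<theta>" for i a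
      using K by (intro sat_cong) (auto simp del: map_map)
    have "eventually (\<lambda>i. sat std_PV ((proj e i)(x := rep w i)) \<theta>) U"
      using r rep(2)[OF w]
    proof eventually_elim
      case (elim i)
      then obtain a where "sat std_PV ((proj e i)(x := a)) \<theta>" by auto
      then have "sat std_PV ((proj e i)(x := w i)) \<theta>" unfolding w_def eq by (rule LeastI)
      with elim show ?case by simp
    qed
    with IH[OF rep_pts[OF w]] have "sat M (e(x := rep w)) \<theta>" by simp
    with rep_pts[OF w] show "sat M e (Ex x \<theta>)" by auto
  qed
next
  case (All x \<theta>)
  have IH: "sat M (e(x := a)) \<theta> \<longleftrightarrow> eventually (\<lambda>i. sat std_PV ((proj e i)(x := a i)) \<theta>) U"
    if "a \<in> pts" for a
  proof -
    have "is_formula PV \<theta>" using All.prems(1) by simp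
    from All.IH[OF this range_fun_upd[OF All.prems(2) that, of x]] show ?thesis unfolding proj_upd .
  qed
  show ?case
  proof
    assume "eventually (\<lambda>i. sat std_PV (proj e i) (All x \<theta>)) U"
    then have "eventually (\<lambda>i. sat std_PV ((proj e i)(x := a i)) \<theta>) U" for a :: point
      by (rule eventually_mono) auto
    with IH show "sat M e (All x \<theta>)" by auto
  next
    assume l: "sat M e (All x \<theta>)"
    define K where "K = Suc (Max (insert 0 (fv \<theta>)))"
    have K: "y < K" if "y \<in> fv \<theta>" for y
      using that unfolding K_def by (simp add: less_Suc_eq_le)
    \<comment> \<open>The least counterexample, wherever there is one. If \<open>\<theta>\<close>
      holds even at this point, it holds at all points for almost every index.\<close>
    define w where "w = (\<lambda>i. LEAST a. sat std_PV ((env (at_index i (map e [0..<K])))(x := a)) (Neg \<theta>))"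
    have w: "w \<in> F" unfolding w_def using All.prems(2) pts_F by (intro least_F) auto
    have eq: "sat std_PV ((env (at_index i (map e [0..<K])))(x := a)) \<theta> \<longleftrightarrow> sat std_PV ((proj e i)(x := a)) \<theta>" for i a
      using K by (intro sat_cong) (auto simp del: map_map)
    have "eventually (\<lambda>i. sat std_PV ((proj e i)(x := rep w i)) \<theta>) U"
      using l IH[OF rep_pts[OF w]] rep_pts[OF w] by simp
    with rep(2)[OF w] show "eventually (\<lambda>i. sat std_PV (proj e i) (All x \<theta>)) U"
    proof eventually_elim
      case (elim i)
      show ?case
      proof (rule ccontr)
        assume "\<not> ?case"
        then obtain a where "sat std_PV ((proj e i)(x := a)) (Neg \<theta>)" by auto
        then have "sat std_PV ((env (at_index i (map e [0..<K])))(x := a)) (Neg \<theta>)" by (simp only: sat.simps eq simp_thms)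
        then have "sat std_PV ((env (at_index i (map e [0..<K])))(x := w i)) (Neg \<theta>)"
          unfolding w_def by (rule LeastI)
        with elim show False by (simp only: sat.simps eq simp_thms)
      qed
    qed
  qed
qed

lemma elementary_embedding_M: "elementary_embedding PV (\<lambda>c. rep (\<lambda>_. c)) std_PV M"
  unfolding elementary_embedding_def
proof (intro conjI allI impI)
  show "is_struct PV std_PV" by (simp add: is_struct_def)
  show "is_struct PV M" by (rule is_struct_M)
  show "(\<lambda>c. rep (\<lambda>_. c)) ` Dom std_PV \<subseteq> Dom M" using rep_pts[OF const_F] by auto
  fix \<theta> and e :: "nat \<Rightarrow> nat" assume \<theta>: "is_formula PV \<theta>"
  let ?e = "(\<lambda>c. rep (\<lambda>_. c)) \<circ> e"
  have "sat M ?e \<theta> \<longleftrightarrow> eventually (\<lambda>i. sat std_PV (proj ?e i) \<theta>) U"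
    using rep_pts[OF const_F] by (intro los \<theta>) auto
  also have "\<dots> \<longleftrightarrow> eventually (\<lambda>i. sat std_PV e \<theta>) U"
  proof (rule eventually_cong)
    show "eventually (\<lambda>i. \<forall>x\<in>fv \<theta>. rep (\<lambda>_. e x) i = e x) U"
      by (intro eventually_ball_finite finite_fv ballI rep(2) const_F)
    show "sat std_PV (proj ?e i) \<theta> \<longleftrightarrow> sat std_PV e \<theta>" if "\<forall>x\<in>fv \<theta>. rep (\<lambda>_. e x) i = e x" for i
      using that by (intro sat_cong) (simp add: proj_def)
  qed
  also have "\<dots> \<longleftrightarrow> sat std_PV e \<theta>" using U_nonempty by (cases "sat std_PV e \<theta>") auto
  finally show "sat std_PV e \<theta> = sat M ?e \<theta>" by simp
qed

end

subsection \<open>The subexponential cut\<close>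

text \<open>The length of \<open>f k\<close> is about \<open>k powr \<epsilon> k\<close>, and since
  the exponent tends to 0, each fixed power of it falls below \<open>k\<close>. This is the form in
  which subexponential growth meets the definition of the cut.\<close>

lemma subexp_growth_bitlength:
  assumes "subexp_growth f"
  shows "eventually (\<lambda>k. bitlength (f k) ^ j < k) sequentially"
proof -
  obtain \<epsilon> where \<epsilon>: "\<epsilon> \<longlonglongrightarrow> 0"
    and f: "\<forall>\<^sub>F k in sequentially. real (f k) \<le> 2 powr (real k powr \<epsilon> k)"
    using assms unfolding subexp_growth_def by blast
  \<comment> \<open>With this exponent the \<open>j\<close>-th power contributes at most the square
    root of \<open>k\<close>. The other square root absorbs the factor \<open>2 ^ j\<close> as soon
    as \<open>k\<close> exceeds \<open>4 ^ j\<close>.\<close>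
  define \<delta> where "\<delta> = 1 / (2 * (real j + 1))"
  have \<delta>: "\<delta> > 0" "\<delta> * real j \<le> 1 / 2" by (auto simp: \<delta>_def field_simps)
  have "\<forall>\<^sub>F k in sequentially. \<epsilon> k < \<delta>" using order_tendstoD(2)[OF \<epsilon> \<delta>(1)] .
  with f eventually_gt_at_top[of "4 ^ j"] show ?thesis
  proof eventually_elim
    case (elim k)
    then have k: "real k > 4 ^ j" "k > 0" by (simp_all flip: of_nat_less_iff)
    then have k1: "real k \<ge> 1" by simp
    define B where "B = nat \<lfloor>real k powr \<epsilon> k\<rfloor> + 1"
    have "real k powr \<epsilon> k < real B" unfolding B_def by linarith
    then have "(2::real) powr (real k powr \<epsilon> k) < 2 powr real B" by simp
    with elim(1) have "real (f k) < 2 powr real B" by (rule le_less_trans)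
    then have "real (f k) < real (2 ^ B)" by (simp add: powr_realpow)
    then have "f k < 2 ^ B" by (simp only: of_nat_less_iff)
    then have "bitlength (f k) \<le> B" by (rule bitlength_le)
    then have "real (bitlength (f k)) \<le> real B" by simp
    also have "\<dots> \<le> real k powr \<epsilon> k + 1"
      unfolding B_def using powr_ge_zero[of "real k" "\<epsilon> k"] by linarith
    also have "\<dots> \<le> real k powr \<delta> + 1"
      using elim k1 by (simp add: powr_mono)
    also have "\<dots> \<le> 2 * real k powr \<delta>"
      using k1 \<delta> ge_one_powr_ge_zero[of "real k" \<delta>] by simp
    finally have "real (bitlength (f k)) ^ j \<le> (2 * real k powr \<delta>) ^ j"
      by (intro power_mono) auto
    also have "\<dots> = 2 ^ j * real k powr (\<delta> * real j)"
      using k by (simp add: power_mult_distrib powr_power mult.commute)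
    also have "\<dots> \<le> 2 ^ j * real k powr (1 / 2)"
      using k1 \<delta> by (intro mult_left_mono powr_mono) auto
    also have "\<dots> < sqrt (real k) * sqrt (real k)"
    proof -
      have "2 ^ j = sqrt (4 ^ j)" by (simp add: real_sqrt_power)
      also have "\<dots> < sqrt (real k)" using k by simp
      finally have "2 ^ j < sqrt (real k)" .
      moreover have "0 < sqrt (real k)" using k by simp
      ultimately have "2 ^ j * sqrt (real k) < sqrt (real k) * sqrt (real k)" by (rule mult_strict_right_mono)
      then show ?thesis by (simp add: powr_half_sqrt)
    qed
    also have "\<dots> = real k" by simp
    finally show ?case by (metis of_nat_less_iff of_nat_power)
  qed
qed

text \<open>Needed to see that \<open>n\<close> itself belongs to the cut.\<close>

lemma subexp_growth_id: "subexp_growth (\<lambda>k. k)"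
  unfolding subexp_growth_def
proof (intro exI conjI)
  \<comment> \<open>Chosen so that \<open>k powr \<epsilon> k\<close> is the square of
    \<open>ln k\<close>; the square times \<open>ln 2\<close> is at least \<open>ln k\<close> once
    \<open>ln k\<close> is at least 2.\<close>
  let ?\<epsilon> = "\<lambda>k. 2 * (ln (ln (real k)) / ln (real k))"
  have ln: "filterlim (\<lambda>k. ln (real k)) at_top sequentially"
    by (rule filterlim_compose[OF ln_at_top filterlim_real_sequentially])
  have "(\<lambda>k. 2 * (ln (ln (real k)) / ln (real k))) \<longlonglongrightarrow> 2 * 0"
    by (intro tendsto_mult tendsto_const filterlim_compose[OF ln_x_over_x_tendsto_0 ln])
  then show "?\<epsilon> \<longlonglongrightarrow> 0" by simp
  have "\<forall>\<^sub>F k in sequentially. ln (real k) \<ge> 2"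
    using ln unfolding filterlim_at_top by blast
  then show "\<forall>\<^sub>F k in sequentially. real k \<le> 2 powr (real k powr ?\<epsilon> k)"
    using eventually_gt_at_top[of 0]
  proof eventually_elim
    case (elim k)
    define y where "y = ln (real k)"
    have y: "y \<ge> 2" using elim by (simp add: y_def)
    have k: "k \<noteq> 0" using elim by simp
    then have "real k powr ?\<epsilon> k = exp (2 * (ln y / y) * y)"
      unfolding y_def by (simp add: powr_def)
    also have "2 * (ln y / y) * y = 2 * ln y" using y by simp
    also have "exp (2 * ln y) = exp (ln y) * exp (ln y)" by (simp flip: exp_add)
    also have "\<dots> = y * y" using y by simp
    finally have *: "real k powr ?\<epsilon> k = y * y" .
    have "y \<le> y * y * ln 2"
    proof -
      have "1 / 2 \<le> ln (2 :: real)" using ln_le_minus_one[of "1 / 2"] by (simp add: ln_div)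
      then have "1 \<le> y * ln 2" using mult_mono[of 2 y "1 / 2" "ln 2"] y by simp
      then show ?thesis using mult_left_mono[of 1 "y * ln 2" y] y by (simp add: mult.assoc)
    qed
    then have "exp y \<le> exp (y * y * ln 2)" by simp
    moreover have "exp y = real k" using k by (simp add: y_def)
    ultimately show ?case unfolding * by (simp add: powr_def)
  qed
qed

locale ultrapower_cut = ultrapower U F for U F +
  fixes a :: point
  assumes a_F: "a \<in> F"
    and a_top: "filterlim a at_top U"
begin

text \<open>The nonstandard reading of size \<open>a powr o(1)\<close>: below the
  \<open>j\<close>-th root of \<open>a\<close> for each standard \<open>j\<close>. The class is
  closed under polynomials and contains only sequences that are eventually below
  \<open>a\<close>.\<close>

definition small :: "point \<Rightarrow> bool" where
  "small g \<longleftrightarrow> (\<forall>j. eventually (\<lambda>i. g i ^ j < a i) U)"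

lemma small_mono: "small g \<Longrightarrow> eventually (\<lambda>i. h i \<le> g i) U \<Longrightarrow> small h"
  unfolding small_def
proof
  fix j assume "\<forall>j. eventually (\<lambda>i. g i ^ j < a i) U" "eventually (\<lambda>i. h i \<le> g i) U"
  then have "eventually (\<lambda>i. g i ^ j < a i) U" "eventually (\<lambda>i. h i \<le> g i) U" by auto
  then show "eventually (\<lambda>i. h i ^ j < a i) U"
  proof eventually_elim
    case (elim i)
    then show ?case using power_mono[of "h i" "g i" j] by simp
  qed
qed

lemma small_const: "small (\<lambda>_. c)"
  unfolding small_def
proof
  fix j
  have "eventually (\<lambda>i. Suc (c ^ j) \<le> a i) U" using a_top unfolding filterlim_at_top by blast
  then show "eventually (\<lambda>i. c ^ j < a i) U" by (simp add: Suc_le_eq)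
qed

lemma small_mult:
  assumes "small g" "small h"
  shows "small (\<lambda>i. g i * h i)"
  unfolding small_def
proof
  fix j
  have "eventually (\<lambda>i. g i ^ (2 * j) < a i) U" "eventually (\<lambda>i. h i ^ (2 * j) < a i) U"
    using assms unfolding small_def by blast+
  then show "eventually (\<lambda>i. (g i * h i) ^ j < a i) U"
  proof eventually_elim
    case (elim i)
    have "(g i * h i) ^ j \<le> (max (g i) (h i) * max (g i) (h i)) ^ j"
      by (intro power_mono mult_mono) auto
    also have "\<dots> = max (g i) (h i) ^ (2 * j)"
      by (simp add: power_mult power2_eq_square)
    also have "\<dots> < a i" using elim by (simp add: max_def)
    finally show ?case .
  qed
qed

lemma small_add:
  assumes "small g" "small h"
  shows "small (\<lambda>i. g i + h i)"
proof -
  have 1: "small (\<lambda>i. max (g i) (h i))"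
    unfolding small_def
  proof
    fix j
    have "eventually (\<lambda>i. g i ^ j < a i) U" "eventually (\<lambda>i. h i ^ j < a i) U"
      using assms unfolding small_def by blast+
    then show "eventually (\<lambda>i. max (g i) (h i) ^ j < a i) U"
      by eventually_elim (simp add: max_def)
  qed
  show ?thesis by (rule small_mono[OF small_mult[OF small_const[of 2] 1]]) (auto simp: max_def)
qed

lemma small_power: "small g \<Longrightarrow> small (\<lambda>i. g i ^ k)"
  by (induction k) (auto intro: small_mult small_const)

lemma small_polyb:
  assumes "polyb p" "small g"
  shows "small (\<lambda>i. p (g i))"
proof -
  obtain c where "\<And>s. p s \<le> (s + 2) ^ c" using assms(1) unfolding polyb_def by blast
  then show ?thesis
    by (intro small_mono[OF small_power[OF small_add[OF assms(2) small_const[of 2]], of c]]) auto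
qed

lemma small_less: "small g \<Longrightarrow> eventually (\<lambda>i. g i < a i) U"
  unfolding small_def by (drule spec[of _ 1]) simp

lemma small_sum_list: "(\<And>g. g \<in> set gs \<Longrightarrow> small (h g)) \<Longrightarrow> small (\<lambda>i. sum_list (map (\<lambda>g. h g i) gs))"
  by (induction gs) (auto intro: small_add small_const)

definition cut :: "point set" where
  "cut = {f \<in> pts. small (\<lambda>i. bitlength (f i))}"

lemma cut_pts: "f \<in> cut \<Longrightarrow> f \<in> pts"
  by (simp add: cut_def)

lemma cut_F: "f \<in> cut \<Longrightarrow> f \<in> F"
  using cut_pts pts_F by blast

lemma small_sz:
  assumes "set fs \<subseteq> cut"
  shows "small (\<lambda>i. sz (at_index i fs))"
proof -
  have "small (\<lambda>i. sum_list (map (\<lambda>f. bitlength (f i)) fs))"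
    using assms by (intro small_sum_list) (auto simp: cut_def)
  then show ?thesis by (simp add: sz_def comp_def)
qed

lemma rep_cut:
  assumes "f \<in> F" "small (\<lambda>i. bitlength (f i))"
  shows "rep f \<in> cut"
proof -
  have "small (\<lambda>i. bitlength (rep f i))"
    by (rule small_mono[OF assms(2)]) (use rep(2)[OF assms(1)] in \<open>auto elim: eventually_mono\<close>)
  with rep_pts[OF assms(1)] show ?thesis by (simp add: cut_def)
qed

lemma small_below: "small g \<Longrightarrow> eventually (\<lambda>i. f i \<le> g i) U \<Longrightarrow> small (\<lambda>i. bitlength (f i))"
  by (erule small_mono) (auto elim!: eventually_mono intro: order_trans[OF bitlength_le_self])

lemma cut_downward:
  assumes "g \<in> cut" "eventually (\<lambda>i. f i \<le> g i) U"
  shows "small (\<lambda>i. bitlength (f i))"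
proof -
  have "small (\<lambda>i. bitlength (g i))" using assms by (simp add: cut_def)
  then show ?thesis
    by (rule small_mono) (use assms(2) in \<open>auto elim!: eventually_mono intro: floorlog_mono\<close>)
qed

lemma rep_a_cut: "rep a \<in> cut"
proof (rule rep_cut[OF a_F])
  show "small (\<lambda>i. bitlength (a i))"
    unfolding small_def
    using eventually_compose_filterlim[OF subexp_growth_bitlength[OF subexp_growth_id] a_top] by blast
qed

lemma subexponential:
  assumes \<theta>: "defines_fun \<theta> f" and f: "subexp_growth f"
  shows "extension_at M \<theta> (rep a) \<in> cut"
proof -
  have form: "is_formula PV \<theta>" and fv: "fv \<theta> \<subseteq> {0, 1}" and s: "\<And>e. sat std_PV e \<theta> \<longleftrightarrow> e 1 = f (e 0)"
    using \<theta> unfolding defines_fun_def by auto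
  \<comment> \<open>The sequence of the values of \<open>f\<close> along \<open>a\<close> is
    recovered as the least solution of its defining formula, and so it lies in
    \<open>F\<close>.\<close>
  have "(\<lambda>i. LEAST y. sat std_PV ((env (at_index i [a]))(1 := y)) \<theta>) \<in> F"
    using a_F by (intro least_F) auto
  moreover have "(LEAST y. y = c) = c" for c :: nat by (rule Least_equality) auto
  ultimately have fa: "(\<lambda>i. f (a i)) \<in> F" by (simp add: s env_def)
  have sat_iff: "sat M ((\<lambda>_. rep a)(1 := b)) \<theta> \<longleftrightarrow> b = rep (\<lambda>i. f (a i))" if b: "b \<in> pts" for b
  proof -
    have "sat M ((\<lambda>_. rep a)(1 := b)) \<theta> \<longleftrightarrow> eventually (\<lambda>i. b i = f (rep a i)) U"
      using los[OF form range_fun_upd[of "\<lambda>_. rep a" pts b 1]] b rep_pts[OF a_F]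
      by (simp add: s proj_def)
    also have "\<dots> \<longleftrightarrow> eventually (\<lambda>i. b i = rep (\<lambda>i. f (a i)) i) U"
      by (rule eventually_cong[OF eventually_conj[OF rep(2)[OF a_F] rep(2)[OF fa]]]) auto
    finally show ?thesis using pts_eq_iff[OF b rep_pts[OF fa]] by simp
  qed
  have "extension_at M \<theta> (rep a) = rep (\<lambda>i. f (a i))"
    unfolding extension_at_def
    by (rule the_equality) (use sat_iff rep_pts[OF fa] in auto)
  moreover have "rep (\<lambda>i. f (a i)) \<in> cut"
  proof (rule rep_cut[OF fa])
    show "small (\<lambda>i. bitlength (f (a i)))"
      unfolding small_def
      using eventually_compose_filterlim[OF subexp_growth_bitlength[OF f] a_top] by blast
  qed
  ultimately show ?thesis by simp
qed

end

subsection \<open>Requirements\<close>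

text \<open>The functionals are indexed by syntax, which keeps their number countable. The third
  kind selects one witness for a sharply bounded quantifier.\<close>

definition functionals :: "(nat set \<Rightarrow> (nat \<Rightarrow> nat) \<Rightarrow> nat) set" where
  "functionals =
     range (\<lambda>t \<beta> e. teval (std \<beta>) e t) \<union>
     range (\<lambda>\<theta> \<beta> e. of_bool (sat (std \<beta>) e \<theta>)) \<union>
     range (\<lambda>(x, t, \<theta>) \<beta> e. LEAST y. y < teval (std \<beta>) e t \<and> sat (std \<beta>) (e(x := y)) \<theta>)"

type_synonym req = "(nat set set \<Rightarrow> nat list \<Rightarrow> nat \<Rightarrow> bool) \<times> (nat list \<Rightarrow> nat \<Rightarrow> nat)"

text \<open>A requirement \<open>(Q, w)\<close> asks for the least \<open>m\<close> such that \<open>Q C xs m\<close> can be forced by \<open>w xs m\<close>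
  queries. The three kinds of requirements compute the value of a functional, the least witness of
  a bounded existential formula, and the longest initial segment on which such a formula holds.\<close>

definition value_req :: "(nat set \<Rightarrow> (nat \<Rightarrow> nat) \<Rightarrow> nat) \<Rightarrow> nat \<Rightarrow> req" where
  "value_req \<Phi> c = (\<lambda>C xs m. \<forall>\<beta>\<in>C. \<Phi> \<beta> (env xs) = m, \<lambda>xs m. (sz xs + 2) ^ c)"

definition least_req :: "sg \<Rightarrow> nat \<Rightarrow> nat \<Rightarrow> req" where
  "least_req g x c = (\<lambda>C xs m. force C g ((env xs)(x := m)), \<lambda>xs m. (sz xs + 2) ^ c)"

definition segment_req :: "sg \<Rightarrow> nat \<Rightarrow> nat \<Rightarrow> req" where
  "segment_req g x c =
     (\<lambda>C xs m. \<forall>y<hd xs - m. force C g ((env (tl xs))(x := y)),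
      \<lambda>xs m. (hd xs + sz (tl xs) + 2) ^ c * (hd xs - m))"

text \<open>All exponents are listed in advance, because the exponent that suffices for a given
  functional or formula emerges only from the later analysis.\<close>

definition reqs :: "req set" where
  "reqs = (\<lambda>(\<Phi>, c). value_req \<Phi> c) ` (functionals \<times> UNIV) \<union>
     range (\<lambda>(g, x, c). least_req g x c) \<union> range (\<lambda>(g, x, c). segment_req g x c)"

lemma countable_reqs: "countable reqs"
  unfolding reqs_def functionals_def by (intro countable_Un countable_image countable_SIGMA) auto

lemma value_req_in: "\<Phi> \<in> functionals \<Longrightarrow> value_req \<Phi> c \<in> reqs"
  unfolding reqs_def by (intro UnI1 image_eqI[of _ _ "(\<Phi>, c)"]) simp_all

lemma least_req_in: "least_req g x c \<in> reqs"
  unfolding reqs_def by (rule UnI1, rule UnI2, rule range_eqI[of _ _ "(g, x, c)"]) simp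

lemma segment_req_in: "segment_req g x c \<in> reqs"
  unfolding reqs_def by (rule UnI2, rule range_eqI[of _ _ "(g, x, c)"]) simp

text \<open>Conditions are coded by numbers so that a sequence of conditions can be a member of
  \<open>F\<close>.\<close>

definition decode :: "nat \<Rightarrow> (nat \<times> nat) set" where
  "decode c = set (from_nat c)"

lemma decode_surj: "finite \<sigma> \<Longrightarrow> \<exists>c. decode c = \<sigma>"
  unfolding decode_def by (metis finite_list from_nat_to_nat)

context conditions
begin

text \<open>If nothing is possible, \<open>LEAST\<close> returns an unspecified number; the test
  after it guards against this and leaves the condition unchanged.\<close>

definition next_cond :: "req \<Rightarrow> nat \<Rightarrow> nat \<Rightarrow> nat list \<Rightarrow> nat" where
  "next_cond j n c xs =
     (let m = LEAST m. possible n (decode c) (snd j xs m) (\<lambda>C. fst j C xs m)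
      in if possible n (decode c) (snd j xs m) (\<lambda>C. fst j C xs m)
         then SOME c'. decode c \<subseteq> decode c' \<and> cond n (decode c') \<and>
           card (decode c') \<le> card (decode c) + (r + 1) * snd j xs m \<and>
           certified n (decode c') (snd j xs m) (\<lambda>C. fst j C xs m)
         else c)"

lemma next_cond:
  fixes j n c xs
  defines "m \<equiv> LEAST m. possible n (decode c) (snd j xs m) (\<lambda>C. fst j C xs m)"
  assumes c: "cond n (decode c)"
  shows "decode c \<subseteq> decode (next_cond j n c xs)" "cond n (decode (next_cond j n c xs))"
    "card (decode (next_cond j n c xs)) \<le> card (decode c) + (r + 1) * snd j xs m"
    "possible n (decode c) (snd j xs m') (\<lambda>C. fst j C xs m') \<Longrightarrow> m \<le> m' \<and>
      certified n (decode (next_cond j n c xs)) (snd j xs m) (\<lambda>C. fst j C xs m)"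
proof -
  let ?p = "possible n (decode c) (snd j xs m) (\<lambda>C. fst j C xs m)"
  let ?P = "\<lambda>c'. decode c \<subseteq> decode c' \<and> cond n (decode c') \<and>
    card (decode c') \<le> card (decode c) + (r + 1) * snd j xs m \<and>
    certified n (decode c') (snd j xs m) (\<lambda>C. fst j C xs m)"
  have pos: "?P (next_cond j n c xs)" if "?p"
  proof -
    from that obtain q where q: "decode c \<subseteq> q" "cond n q"
      "card q \<le> card (decode c) + (r + 1) * snd j xs m"
      "certified n q (snd j xs m) (\<lambda>C. fst j C xs m)"
      unfolding possible_def by blast
    obtain c' where "decode c' = q" using decode_surj[OF cond_finite[OF q(2)]] by blast
    with q have "?P c'" by simp
    then have "?P (SOME c'. ?P c')" by (rule someI)
    moreover have "next_cond j n c xs = (SOME c'. ?P c')"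
      using that by (simp add: next_cond_def m_def[symmetric])
    ultimately show ?thesis by simp
  qed
  have neg: "next_cond j n c xs = c" if "\<not> ?p"
    using that by (simp add: next_cond_def m_def[symmetric])
  show "decode c \<subseteq> decode (next_cond j n c xs)" "cond n (decode (next_cond j n c xs))"
    "card (decode (next_cond j n c xs)) \<le> card (decode c) + (r + 1) * snd j xs m"
    using pos neg c by (cases ?p; simp)+
  assume m': "possible n (decode c) (snd j xs m') (\<lambda>C. fst j C xs m')"
  have "m \<le> m'" unfolding m_def
    by (rule Least_le[of "\<lambda>m. possible n (decode c) (snd j xs m) (\<lambda>C. fst j C xs m)", OF m'])
  moreover have ?p unfolding m_def
    by (rule LeastI[of "\<lambda>m. possible n (decode c) (snd j xs m) (\<lambda>C. fst j C xs m)", OF m'])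
  ultimately show "m \<le> m' \<and> certified n (decode (next_cond j n c xs)) (snd j xs m) (\<lambda>C. fst j C xs m)"
    using pos by simp
qed

text \<open>The operations that refer to conditions take the size of the structure and the code of a
  condition as their first two arguments, except the last one, which takes only the code.\<close>

definition ops :: "(nat list \<Rightarrow> nat) set" where
  "ops =
     range (\<lambda>c xs. c) \<union>
     range (\<lambda>m xs. otm_fun {} m xs) \<union>
     range (\<lambda>(\<theta>, x) xs. LEAST y. sat std_PV ((env xs)(x := y)) \<theta>) \<union>
     (\<lambda>j xs. next_cond j (xs ! 0) (xs ! 1) (drop 2 xs)) ` reqs \<union>
     (\<lambda>j xs. LEAST m. possible (xs ! 0) (decode (xs ! 1)) (snd j (drop 2 xs) m)
        (\<lambda>C. fst j C (drop 2 xs) m)) ` reqs \<union>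
     range (\<lambda>(x, t, g) xs. let C = cone (known (xs ! 0) (decode (xs ! 1))) (decode (xs ! 1)) in
        LEAST y. (\<forall>\<beta>\<in>C. y < teval (std \<beta>) (env (drop 2 xs)) t) \<and>
          force C g ((env (drop 2 xs))(x := y))) \<union>
     {\<lambda>xs. LEAST i. bit (xs ! 0) i \<noteq> bit (xs ! 1) i} \<union>
     {\<lambda>xs. xs ! 0 - xs ! 1} \<union>
     range (\<lambda>f xs. THE v. \<exists>bs. maps (decode (xs ! 0)) (tl xs) bs \<and> (v, fn A f bs) \<in> decode (xs ! 0))"

lemma countable_ops: "countable ops"
  unfolding ops_def by (intro countable_Un countable_image countable_reqs) auto

end

subsection \<open>The generic chain of conditions\<close>

locale generic = conditions L A \<tau> r for L A \<tau> r +
  fixes U :: "nat filter" and F :: "point set" and a :: point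
  assumes U: "ultrafilter U"
    and a: "a \<in> F" "filterlim a at_top U"
    and F: "countable F" "\<And>h fs. h \<in> ops \<Longrightarrow> set fs \<subseteq> F \<Longrightarrow> (\<lambda>i. h (at_index i fs)) \<in> F"
begin

sublocale ultrapower_cut U F a
proof
  show "ultrafilter U" "a \<in> F" "filterlim a at_top U" by (rule U a)+
  show "(\<lambda>_. c) \<in> F" for c using F(2)[of "\<lambda>xs. c" "[]"] by (simp add: ops_def)
  show "set fs \<subseteq> F \<Longrightarrow> (\<lambda>i. otm_fun {} m (at_index i fs)) \<in> F" for fs m
    by (rule F(2)) (auto simp: ops_def)
  show "(\<lambda>i. LEAST a. sat std_PV ((env (at_index i fs))(x := a)) \<theta>) \<in> F" if "set fs \<subseteq> F" for fs x \<theta>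
  proof -
    have "(\<lambda>xs. LEAST y. sat std_PV ((env xs)(x := y)) \<theta>) \<in>
        range (\<lambda>(\<theta>, x) xs. LEAST y. sat std_PV ((env xs)(x := y)) \<theta>)"
      by (rule range_eqI[of _ _ "(\<theta>, x)"]) simp
    then have "(\<lambda>xs. LEAST y. sat std_PV ((env xs)(x := y)) \<theta>) \<in> ops" unfolding ops_def by blast
    from F(2)[OF this that] show ?thesis .
  qed
qed

section \<open>Enumeration of the tasks and construction of the chain\<close>

definition tasks :: "(req \<times> point list) set" where
  "tasks = reqs \<times> lists F"

definition task :: "nat \<Rightarrow> req \<times> point list" where
  "task = from_nat_into tasks"

lemma task_surj:
  assumes "j \<in> reqs" "set fs \<subseteq> F"
  shows "\<exists>k. task k = (j, fs)"
proof -
  have "countable tasks" unfolding tasks_def by (intro countable_SIGMA countable_reqs countable_lists F)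
  moreover have "(j, fs) \<in> tasks" using assms by (auto simp: tasks_def)
  ultimately show ?thesis unfolding task_def using subset_range_from_nat_into by fastforce
qed

lemma task_in: "fst (task k) \<in> reqs" "set (snd (task k)) \<subseteq> F"
proof -
  have "(least_req (SB undefined) 0 0, []) \<in> tasks" using least_req_in by (auto simp: tasks_def)
  then have "task k \<in> tasks" unfolding task_def by (intro from_nat_into) auto
  then show "fst (task k) \<in> reqs" "set (snd (task k)) \<subseteq> F" by (auto simp: tasks_def)
qed

text \<open>The bound \<open>W\<close> does not depend on \<open>m\<close>, because the value at
  which a requirement will be met is unknown beforehand. Serving only such requirements keeps every
  stage of the chain small.\<close>

definition small_req :: "req \<Rightarrow> point list \<Rightarrow> bool" where
  "small_req j fs \<longleftrightarrow> (\<exists>W. small W \<and> eventually (\<lambda>i. \<forall>m. snd j (at_index i fs) m \<le> W i) U)"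

text \<open>Every stage is a sequence in \<open>F\<close>, with the step carried out at all indices
  simultaneously; only the index \<open>k\<close> of the chain is a standard number. Requirements
  that are too expensive are skipped.\<close>

primrec chain :: "nat \<Rightarrow> point" where
  "chain 0 = (\<lambda>_. to_nat ([] :: (nat \<times> nat) list))"
| "chain (Suc k) = (if small_req (fst (task k)) (snd (task k))
     then \<lambda>i. next_cond (fst (task k)) (a i) (chain k i) (at_index i (snd (task k))) else chain k)"

definition gcond :: "nat \<Rightarrow> nat \<Rightarrow> (nat \<times> nat) set" where
  "gcond k i = decode (chain k i)"

lemma chain_F: "chain k \<in> F"
proof (induction k)
  case 0
  show ?case by (simp add: const_F)
next
  case (Suc k)
  let ?j = "fst (task k)"
  have "(\<lambda>xs. next_cond ?j (xs ! 0) (xs ! 1) (drop 2 xs)) \<in> ops"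
    using task_in(1)[of k] unfolding ops_def by blast
  from F(2)[OF this, of "a # chain k # snd (task k)"] a Suc task_in(2)[of k] show ?case by simp
qed

lemma gcond_cond: "cond (a i) (gcond k i)"
proof (induction k)
  case 0
  show ?case by (simp add: gcond_def decode_def cond_empty)
next
  case (Suc k)
  then show ?case unfolding gcond_def using next_cond(2) by simp
qed

lemma gcond_Suc: "gcond k i \<subseteq> gcond (Suc k) i"
  using gcond_cond[of i k] next_cond(1) by (simp add: gcond_def)

lemma gcond_mono: "k \<le> k' \<Longrightarrow> gcond k i \<subseteq> gcond k' i"
  by (rule lift_Suc_mono_le[of "\<lambda>k. gcond k i"]) (rule gcond_Suc)

lemma gcond_small: "small (\<lambda>i. card (gcond k i))"
proof (induction k)
  case 0
  show ?case by (simp add: gcond_def decode_def small_const)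
next
  case (Suc k)
  let ?j = "fst (task k)" and ?fs = "snd (task k)"
  show ?case
  proof (cases "small_req ?j ?fs")
    case True
    then obtain W where W: "small W" "eventually (\<lambda>i. \<forall>m. snd ?j (at_index i ?fs) m \<le> W i) U"
      unfolding small_req_def by blast
    have "small (\<lambda>i. card (gcond k i) + (r + 1) * W i)"
      by (intro small_add small_mult small_const Suc W)
    then show ?thesis
    proof (rule small_mono)
      show "eventually (\<lambda>i. card (gcond (Suc k) i) \<le> card (gcond k i) + (r + 1) * W i) U"
        using W(2)
      proof eventually_elim
        case (elim i)
        let ?m = "LEAST m. possible (a i) (gcond k i) (snd ?j (at_index i ?fs) m) (\<lambda>C. fst ?j C (at_index i ?fs) m)"
        have "card (gcond (Suc k) i) \<le> card (gcond k i) + (r + 1) * snd ?j (at_index i ?fs) ?m"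
          using next_cond(3)[OF gcond_cond[of i k, unfolded gcond_def]] True by (simp add: gcond_def)
        also have "\<dots> \<le> card (gcond k i) + (r + 1) * W i" using elim by (intro add_left_mono mult_le_mono2) blast
        finally show ?case .
      qed
    qed
  next
    case False
    with Suc show ?thesis by (simp add: gcond_def)
  qed
qed

text \<open>The stages \<open>k\<close> and \<open>k'\<close> may come in either order: the
  certificate survives up to the later of the two, and that stage extends stage
  \<open>k\<close>.\<close>

lemma certified_possible_gcond:
  assumes "certified (a i) (gcond k' i) h Q"
  shows "possible (a i) (gcond k i) h Q"
proof -
  have "certified (a i) (gcond (max k k') i) h Q"
    by (rule certified_mono[OF gcond_cond assms gcond_mono]) auto
  from certified_possible[OF gcond_cond this gcond_mono] show ?thesis by simp
qed

text \<open>Some stage serves the given task. The value chosen there is computed from the codes of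
  the stage by one of the operations in \<open>ops\<close>, so it is a sequence in \<open>F\<close>
  and names an element of the ultrapower.\<close>

lemma requirement:
  assumes "j \<in> reqs" "set fs \<subseteq> F" "small_req j fs"
  shows "\<exists>k m. m \<in> F \<and> (\<forall>i m'.
    possible (a i) (gcond k i) (snd j (at_index i fs) m') (\<lambda>C. fst j C (at_index i fs) m') \<longrightarrow>
      m i \<le> m' \<and> certified (a i) (gcond (Suc k) i) (snd j (at_index i fs) (m i)) (\<lambda>C. fst j C (at_index i fs) (m i)))"
proof -
  obtain k where k: "task k = (j, fs)" using task_surj assms by blast
  define m where "m = (\<lambda>i. LEAST m. possible (a i) (gcond k i) (snd j (at_index i fs) m) (\<lambda>C. fst j C (at_index i fs) m))"
  have "(\<lambda>xs. LEAST m. possible (xs ! 0) (decode (xs ! 1)) (snd j (drop 2 xs) m)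
        (\<lambda>C. fst j C (drop 2 xs) m)) \<in> ops"
    using assms(1) unfolding ops_def by blast
  from F(2)[OF this, of "a # chain k # fs"] a chain_F assms(2) have "m \<in> F"
    by (simp add: m_def gcond_def)
  moreover have "m i \<le> m' \<and> certified (a i) (gcond (Suc k) i) (snd j (at_index i fs) (m i)) (\<lambda>C. fst j C (at_index i fs) (m i))"
    if "possible (a i) (gcond k i) (snd j (at_index i fs) m') (\<lambda>C. fst j C (at_index i fs) m')" for i m'
    using next_cond(4)[OF gcond_cond[of i k, unfolded gcond_def]] that k assms(3)
    by (simp add: gcond_def m_def)
  ultimately show ?thesis by blast
qed

text \<open>Eventual truth along the external chain: for all late stages and then for almost all
  indices. This replaces talk about the union of the chain. It is not assumed to be an ultrafilter;
  it decides those statements that some stage decides.\<close>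

definition gen :: "(nat \<times> nat) filter" where
  "gen = Abs_filter (\<lambda>P. \<exists>k0. \<forall>k\<ge>k0. eventually (\<lambda>i. P (k, i)) U)"

lemma eventually_gen:
  "eventually P gen \<longleftrightarrow> (\<exists>k0. \<forall>k\<ge>k0. eventually (\<lambda>i. P (k, i)) U)"
proof -
  have "is_filter (\<lambda>P. \<exists>k0 :: nat. \<forall>k\<ge>k0. eventually (\<lambda>i. P (k, i)) U)"
  proof
    fix P Q :: "nat \<times> nat \<Rightarrow> bool"
    assume "\<exists>k0. \<forall>k\<ge>k0. eventually (\<lambda>i. P (k, i)) U" "\<exists>k0. \<forall>k\<ge>k0. eventually (\<lambda>i. Q (k, i)) U"
    then obtain k0 k1 where "\<forall>k\<ge>k0. eventually (\<lambda>i. P (k, i)) U" "\<forall>k\<ge>k1. eventually (\<lambda>i. Q (k, i)) U" by blast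
    then show "\<exists>k0. \<forall>k\<ge>k0. eventually (\<lambda>i. P (k, i) \<and> Q (k, i)) U"
      by (intro exI[of _ "max k0 k1"]) (auto intro: eventually_conj)
  next
    fix P Q :: "nat \<times> nat \<Rightarrow> bool"
    assume "\<forall>z. P z \<longrightarrow> Q z" "\<exists>k0. \<forall>k\<ge>k0. eventually (\<lambda>i. P (k, i)) U"
    then show "\<exists>k0. \<forall>k\<ge>k0. eventually (\<lambda>i. Q (k, i)) U" by (blast intro: eventually_mono)
  qed auto
  then show ?thesis unfolding gen_def by (rule eventually_Abs_filter)
qed

lemma gen_U: "eventually (\<lambda>z. P (snd z)) gen \<longleftrightarrow> eventually P U"
  unfolding eventually_gen by auto

lemma gen_nonempty: "gen \<noteq> bot"
  using U_nonempty unfolding trivial_limit_def eventually_gen by auto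

definition approx :: "nat \<times> nat \<Rightarrow> nat set" where
  "approx z = answers (gcond (fst z) (snd z))"

lemma approx_in_cone:
  assumes "k \<le> k'" "Z \<subseteq> known (a i) (gcond k i)"
  shows "approx (k', i) \<in> cone Z (gcond k i)"
  using cone_eq[OF gcond_cond gcond_mono[OF assms(1)] assms(2)] answers_in_cone unfolding approx_def by auto

lemma certified_gen:
  assumes "eventually (\<lambda>i. certified (a i) (gcond k i) (h i) (\<lambda>C. \<forall>\<beta>\<in>C. P \<beta> i)) U"
  shows "eventually (\<lambda>z. P (approx z) (snd z)) gen"
  unfolding eventually_gen
proof (intro exI allI impI)
  fix k' assume "k \<le> k'"
  from assms show "eventually (\<lambda>i. P (approx (k', i)) (snd (k', i))) U"
  proof eventually_elim
    case (elim i)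
    then show ?case using approx_in_cone[OF \<open>k \<le> k'\<close>] unfolding certified_def by auto
  qed
qed

text \<open>The exponent \<open>c\<close> comes before \<open>e\<close> and \<open>s\<close>: it
  depends only on the functional, which later allows query bounds to be announced in advance. The
  value is an internal sequence \<open>y\<close>, certified at one stage.\<close>

lemma decided:
  assumes \<Phi>: "\<Phi> \<in> functionals" "poly_dec V \<Phi>" "finite V"
    and cong: "\<And>\<beta> e e'. (\<And>x. x \<in> V \<Longrightarrow> e x = e' x) \<Longrightarrow> \<Phi> \<beta> e = \<Phi> \<beta> e'"
  shows "\<exists>c. \<forall>e s. (\<forall>x\<in>V. e x \<in> F) \<longrightarrow> eventually (\<lambda>i. bounded_env V (s i) (proj e i)) U \<longrightarrow> small s \<longrightarrow>
    (\<exists>y\<in>F. \<exists>k. eventually (\<lambda>i. certified (a i) (gcond k i) ((s i + 2) ^ c)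
      (\<lambda>C. \<forall>\<beta>\<in>C. \<Phi> \<beta> (proj e i) = y i)) U)"
proof -
  obtain p where p: "polyb p" "\<And>s e. bounded_env V s e \<Longrightarrow> dec (p s) (\<lambda>\<beta>. \<Phi> \<beta> e)"
    using \<Phi>(2) unfolding poly_dec_def by blast
  then obtain c0 where c0: "\<And>s. p s \<le> (s + 2) ^ c0" unfolding polyb_def by blast
  define K where "K = Suc (Max (insert 0 V))"
  have K: "x < K" if "x \<in> V" for x
    using that \<Phi>(3) unfolding K_def by (simp add: less_Suc_eq_le)
  \<comment> \<open>A list of \<open>K\<close> entries of length at most \<open>s\<close> has total
    length at most \<open>K * s\<close>; the new exponent absorbs the factor
    \<open>K\<close>.\<close>
  have "polyb (\<lambda>s. (K * s + 2) ^ c0)" by (intro polyb_power polyb_add polyb_mult polyb_const polyb_id)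
  then obtain c where c: "\<And>s. (K * s + 2) ^ c0 \<le> (s + 2) ^ c" unfolding polyb_def by blast
  show ?thesis
  proof (intro exI[of _ c] allI impI)
    fix e :: "nat \<Rightarrow> point" and s
    assume e: "\<forall>x\<in>V. e x \<in> F" and s: "eventually (\<lambda>i. bounded_env V (s i) (proj e i)) U" "small s"
    \<comment> \<open>Variables outside \<open>V\<close> are set to 0, because nothing is known
      about \<open>e\<close> there and the list must consist of sequences in
      \<open>F\<close>.\<close>
    define fs where "fs = map (\<lambda>x. if x \<in> V then e x else (\<lambda>_. 0)) [0..<K]"
    have fs: "set fs \<subseteq> F" unfolding fs_def using e const_F by auto
    have eq: "\<Phi> \<beta> (env (at_index i fs)) = \<Phi> \<beta> (proj e i)" for \<beta> i
      by (rule cong) (use K in \<open>simp add: fs_def env_def proj_def\<close>)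
    have sz: "eventually (\<lambda>i. sz (at_index i fs) \<le> K * s i) U"
      using s(1)
    proof eventually_elim
      case (elim i)
      have "sz (at_index i fs) \<le> sum_list (map (\<lambda>_. s i) [0..<K])"
        unfolding sz_def fs_def map_map
        using elim by (intro sum_list_mono) (auto simp: bounded_env_def proj_def floorlog_def)
      then show ?case by (simp add: sum_list_triv)
    qed
    let ?j = "value_req \<Phi> c0"
    have sm: "small (\<lambda>i. (K * s i + 2) ^ c0)" by (intro small_power small_add small_mult small_const s)
    have sreq: "small_req ?j fs"
      unfolding small_req_def
    proof (intro exI conjI, rule sm)
      show "eventually (\<lambda>i. \<forall>m. snd ?j (at_index i fs) m \<le> (K * s i + 2) ^ c0) U"
        using sz by eventually_elim (simp add: value_req_def power_mono)
    qed
    from requirement[OF value_req_in[OF \<Phi>(1)] fs sreq] obtain k m where m: "m \<in> F"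
      "\<forall>i m'. possible (a i) (gcond k i) (snd ?j (at_index i fs) m') (\<lambda>C. fst ?j C (at_index i fs) m') \<longrightarrow>
      m i \<le> m' \<and> certified (a i) (gcond (Suc k) i) (snd ?j (at_index i fs) (m i)) (\<lambda>C. fst ?j C (at_index i fs) (m i))"
      by blast
    \<comment> \<open>Stage \<open>k\<close> is small, so it leaves room for making a whole branch
      of the tree known. Some value \<open>v\<close> is therefore possible, and the next stage
      certifies the least possible value \<open>m i\<close>, which need not be
      \<open>v\<close>.\<close>
    have "eventually (\<lambda>i. certified (a i) (gcond (Suc k) i) ((s i + 2) ^ c)
      (\<lambda>C. \<forall>\<beta>\<in>C. \<Phi> \<beta> (proj e i) = m i)) U"
      using sz small_less[OF small_add[OF gcond_small[of k] small_mult[OF small_const[of "r + 1"] sm]]]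
    proof eventually_elim
      case (elim i)
      let ?h = "(sz (at_index i fs) + 2) ^ c0"
      have h: "?h \<le> (K * s i + 2) ^ c0" using elim(1) by (intro power_mono) auto
      have "dec ?h (\<lambda>\<beta>. \<Phi> \<beta> (env (at_index i fs)))"
        by (rule dec_mono[OF p(2)[of "sz (at_index i fs)"]]) (use c0 bitlength_env in \<open>auto simp: bounded_env_def\<close>)
      moreover have "card (gcond k i) + (r + 1) * ?h \<le> a i"
        using elim(2) mult_le_mono2[OF h, of "r + 1"] by linarith
      ultimately obtain v where
        "possible (a i) (gcond k i) ?h (\<lambda>C. \<forall>\<beta>\<in>C. \<Phi> \<beta> (env (at_index i fs)) = v)"
        using possible_dec[OF _ gcond_cond] by blast
      then have "certified (a i) (gcond (Suc k) i) ?h (\<lambda>C. \<forall>\<beta>\<in>C. \<Phi> \<beta> (env (at_index i fs)) = m i)"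
        using m(2)[rule_format, of i v] by (simp add: value_req_def)
      then show ?case
        by (rule certified_weaken) (use order_trans[OF h c] eq in auto)
    qed
    with m(1) show "\<exists>y\<in>F. \<exists>k. eventually (\<lambda>i. certified (a i) (gcond k i) ((s i + 2) ^ c)
      (\<lambda>C. \<forall>\<beta>\<in>C. \<Phi> \<beta> (proj e i) = y i)) U" by blast
  qed
qed

lemma cut_bounded_env:
  assumes "finite V" "\<And>x. x \<in> V \<Longrightarrow> e x \<in> cut"
  obtains s where "small s" "\<And>i. bounded_env V (s i) (proj e i)"
proof -
  obtain vs where vs: "set vs = V" using finite_list[OF assms(1)] by blast
  define s where "s = (\<lambda>i. sz (at_index i (map e vs)))"
  have "small s" unfolding s_def by (rule small_sz) (use assms(2) vs in auto)
  moreover have "bounded_env V (s i) (proj e i)" for i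
    unfolding bounded_env_def s_def proj_def using vs by (auto intro!: bitlength_le_sz)
  ultimately show ?thesis by (rule that)
qed

lemma decided_gen:
  assumes \<Phi>: "\<Phi> \<in> functionals" "poly_dec V \<Phi>" "finite V"
    and cong: "\<And>\<beta> e e'. (\<And>x. x \<in> V \<Longrightarrow> e x = e' x) \<Longrightarrow> \<Phi> \<beta> e = \<Phi> \<beta> e'"
    and e: "\<And>x. x \<in> V \<Longrightarrow> e x \<in> cut"
  obtains y where "y \<in> F" "eventually (\<lambda>z. \<Phi> (approx z) (proj e (snd z)) = y (snd z)) gen"
proof -
  obtain s where s: "small s" "\<And>i. bounded_env V (s i) (proj e i)"
    using cut_bounded_env[OF \<Phi>(3), of e] e by blast
  obtain c where c: "\<forall>e s. (\<forall>x\<in>V. e x \<in> F) \<longrightarrow> eventually (\<lambda>i. bounded_env V (s i) (proj e i)) U \<longrightarrow> small s \<longrightarrow>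
    (\<exists>y\<in>F. \<exists>k. eventually (\<lambda>i. certified (a i) (gcond k i) ((s i + 2) ^ c)
      (\<lambda>C. \<forall>\<beta>\<in>C. \<Phi> \<beta> (proj e i) = y i)) U)"
    using decided[OF assms(1-4)] by blast
  have "\<forall>x\<in>V. e x \<in> F" using e cut_F by blast
  moreover have "eventually (\<lambda>i. bounded_env V (s i) (proj e i)) U" using s(2) by simp
  ultimately obtain y k where y: "y \<in> F" "eventually (\<lambda>i. certified (a i) (gcond k i) ((s i + 2) ^ c)
      (\<lambda>C. \<forall>\<beta>\<in>C. \<Phi> \<beta> (proj e i) = y i)) U" using c s(1) by meson
  from that[OF y(1) certified_gen[OF y(2)]] show ?thesis .
qed

subsection \<open>The generic model\<close>

definition N :: "(point, otm, pv_rel) struct" where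
  "N = \<lparr>Dom = cut,
     fn = (\<lambda>m as. THE b. b \<in> cut \<and>
       eventually (\<lambda>z. otm_fun (approx z) m (at_index (snd z) as) = b (snd z)) gen),
     rl = (\<lambda>R as. case R of Less \<Rightarrow> eventually (\<lambda>i. (as ! 0) i < (as ! 1) i) U
       | Alpha \<Rightarrow> eventually (\<lambda>z. (as ! 0) (snd z) \<in> approx z) gen)\<rparr>"

lemma N_simps [simp]:
  "Dom N = cut"
  "rl N Less as \<longleftrightarrow> eventually (\<lambda>i. (as ! 0) i < (as ! 1) i) U"
  "rl N Alpha as \<longleftrightarrow> eventually (\<lambda>z. (as ! 0) (snd z) \<in> approx z) gen"
  by (simp_all add: N_def)

lemma functionals_term: "(\<lambda>\<beta> e. teval (std \<beta>) e t) \<in> functionals"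
  unfolding functionals_def by blast

lemma functionals_sat: "(\<lambda>\<beta> e. of_bool (sat (std \<beta>) e \<theta>)) \<in> functionals"
  unfolding functionals_def by blast

lemma functionals_least:
  "(\<lambda>\<beta> e. LEAST y. y < teval (std \<beta>) e t \<and> sat (std \<beta>) (e(x := y)) \<theta>) \<in> functionals"
  unfolding functionals_def by (intro UnI2 range_eqI[of _ _ "(x, t, \<theta>)"]) simp

text \<open>The value is decided as a sequence in \<open>F\<close>, and its length is polynomial in
  the lengths of the arguments, hence small. A statement that mentions only the index and not the
  stage passes from \<open>gen\<close> to \<open>U\<close>.\<close>

lemma term_value:
  assumes t: "is_term PVa t" and e: "\<And>x. x \<in> tvars t \<Longrightarrow> e x \<in> cut"
  obtains b where "b \<in> cut" "eventually (\<lambda>z. teval (std (approx z)) (proj e (snd z)) t = b (snd z)) gen"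
proof -
  let ?\<Phi> = "\<lambda>\<beta> e. teval (std \<beta>) e t"
  have cong: "?\<Phi> \<beta> e = ?\<Phi> \<beta> e'" if "\<And>x. x \<in> tvars t \<Longrightarrow> e x = e' x" for \<beta> e e'
    using that by (rule teval_cong)
  obtain y where y: "y \<in> F" "eventually (\<lambda>z. ?\<Phi> (approx z) (proj e (snd z)) = y (snd z)) gen"
    using decided_gen[of ?\<Phi> "tvars t" e, OF functionals_term poly_dec_term[OF t] finite_tvars cong e] by blast
  obtain p where p: "polyb p" "\<And>s e \<beta>. bounded_env (tvars t) s e \<Longrightarrow> bitlength (teval (std \<beta>) e t) \<le> p s"
    using polyb_term[OF t] by blast
  obtain s where s: "small s" "\<And>i. bounded_env (tvars t) (s i) (proj e i)"
    using cut_bounded_env[OF finite_tvars, of t e] e by blast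
  have "eventually (\<lambda>z. bitlength (y (snd z)) \<le> p (s (snd z))) gen"
    using y(2) by eventually_elim (metis p(2) s(2))
  then have "eventually (\<lambda>i. bitlength (y i) \<le> p (s i)) U"
    using gen_U[of "\<lambda>i. bitlength (y i) \<le> p (s i)"] by simp
  then have "small (\<lambda>i. bitlength (y i))" by (rule small_mono[OF small_polyb[OF p(1) s(1)]])
  then have "rep y \<in> cut" by (rule rep_cut[OF y(1)])
  moreover have "eventually (\<lambda>z. rep y (snd z) = y (snd z)) gen"
    using rep(2)[OF y(1)] gen_U[of "\<lambda>i. rep y i = y i"] by simp
  with y(2) have "eventually (\<lambda>z. teval (std (approx z)) (proj e (snd z)) t = rep y (snd z)) gen"
    by eventually_elim simp
  ultimately show ?thesis by (rule that)
qed

lemma cut_eq_gen: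
  assumes "b \<in> cut" "b' \<in> cut" "eventually (\<lambda>z. f z = b (snd z)) gen" "eventually (\<lambda>z. f z = b' (snd z)) gen"
  shows "b = b'"
proof -
  have "eventually (\<lambda>z. b (snd z) = b' (snd z)) gen" using assms(3,4) by eventually_elim simp
  then have "eventually (\<lambda>i. b i = b' i) U" using gen_U[of "\<lambda>i. b i = b' i"] by simp
  with assms cut_pts pts_eq_iff show ?thesis by blast
qed

lemma N_fn:
  assumes m: "polytime m" "set as \<subseteq> cut" "length as = arity m"
  shows "fn N m as \<in> cut" "eventually (\<lambda>z. otm_fun (approx z) m (at_index (snd z) as) = fn N m as (snd z)) gen"
proof -
  define t where "t = Fun m (map Var [0..<arity m])"
  define e where "e = (\<lambda>x. as ! x)"
  have "is_term PVa t" using m by (auto simp: t_def)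
  moreover have "e x \<in> cut" if "x \<in> tvars t" for x using that m by (auto simp: t_def e_def)
  ultimately obtain b where b: "b \<in> cut"
    "eventually (\<lambda>z. teval (std (approx z)) (proj e (snd z)) t = b (snd z)) gen" by (rule term_value)
  have "teval (std \<beta>) (proj e i) t = otm_fun \<beta> m (at_index i as)" for \<beta> i
  proof -
    have "map (\<lambda>x. (as ! x) i) [0..<arity m] = at_index i as"
      using m(3) by (intro nth_equalityI) auto
    then show ?thesis by (simp add: t_def proj_def e_def comp_def)
  qed
  with b(2) have *: "eventually (\<lambda>z. otm_fun (approx z) m (at_index (snd z) as) = b (snd z)) gen" by simp
  have "(THE b. b \<in> cut \<and> eventually (\<lambda>z. otm_fun (approx z) m (at_index (snd z) as) = b (snd z)) gen) = b"
  proof (rule the_equality)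
    show "b \<in> cut \<and> eventually (\<lambda>z. otm_fun (approx z) m (at_index (snd z) as) = b (snd z)) gen"
      using b(1) * by blast
  next
    fix b' assume "b' \<in> cut \<and> eventually (\<lambda>z. otm_fun (approx z) m (at_index (snd z) as) = b' (snd z)) gen"
    then show "b' = b" using cut_eq_gen[OF _ b(1) _ *] by blast
  qed
  then have "fn N m as = b" by (simp add: N_def)
  with b * show "fn N m as \<in> cut" "eventually (\<lambda>z. otm_fun (approx z) m (at_index (snd z) as) = fn N m as (snd z)) gen"
    by simp_all
qed

lemma is_struct_N: "is_struct PVa N"
  using N_fn(1) rep_a_cut by (auto simp: is_struct_def)

lemma pv_cut_N: "pv_cut N M"
  unfolding pv_cut_def substruct_def
proof (intro conjI ballI allI impI)
  show "is_struct PV N" using N_fn(1) rep_a_cut by (auto simp: is_struct_def)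
  show "is_struct PV M" by (rule is_struct_M)
  show "Dom N \<subseteq> Dom M" using cut_pts by auto
  show "fn N f as = fn M f as" if f: "f \<in> funs PV" and as: "set as \<subseteq> Dom N" "length as = far PV f" for f as
  proof -
    have f': "polytime f" "oracle_free f" using f by auto
    have cut: "set as \<subseteq> cut" using as by simp
    then have pts: "set as \<subseteq> pts" using cut_pts by blast
    have "eventually (\<lambda>z. fn M f as (snd z) = otm_fun {} f (at_index (snd z) as)) gen"
      using M_fn(2)[OF pts, of f] gen_U[of "\<lambda>i. fn M f as i = otm_fun {} f (at_index i as)"] by simp
    then have "eventually (\<lambda>z. otm_fun (approx z) f (at_index (snd z) as) = fn M f as (snd z)) gen"
      by eventually_elim (use otm_fun_oracle_free[OF f'(2)] in metis)
    with N_fn(2)[OF f'(1) cut] as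
    have "eventually (\<lambda>z. fn N f as (snd z) = fn M f as (snd z)) gen"
      by (auto elim: eventually_elim2)
    then have "eventually (\<lambda>i. fn N f as i = fn M f as i) U"
      using gen_U[of "\<lambda>i. fn N f as i = fn M f as i"] by simp
    moreover have "fn N f as \<in> pts" using N_fn(1)[OF f'(1) cut] as cut_pts by simp
    ultimately show ?thesis using pts_eq_iff M_fn(1)[OF pts] by blast
  qed
  show "rl N R as = rl M R as" if "R \<in> rels PV" for R as using that by simp
  show "x \<in> Dom N" if "b \<in> Dom N" "x \<in> Dom M" "less_in M x b" for b x
  proof -
    have "eventually (\<lambda>i. x i \<le> b i) U" using that(3) by (auto elim: eventually_mono)
    with that cut_downward[of b x] show ?thesis by (simp add: cut_def)
  qed
qed

lemma teval_N:
  assumes "is_term PVa t" "range e \<subseteq> cut"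
  shows "teval N e t \<in> cut \<and>
    eventually (\<lambda>z. teval (std (approx z)) (proj e (snd z)) t = teval N e t (snd z)) gen"
  using assms(1)
proof (induction t)
  case (Var x)
  then show ?case using assms(2) by (auto simp: proj_def)
next
  case (Fun m ts)
  then have m: "polytime m" "length (map (teval N e) ts) = arity m" by auto
  have ts: "set (map (teval N e) ts) \<subseteq> cut" using Fun by auto
  have "eventually (\<lambda>z. \<forall>t\<in>set ts. teval (std (approx z)) (proj e (snd z)) t = teval N e t (snd z)) gen"
    using Fun by (intro eventually_ball_finite) auto
  then have "eventually (\<lambda>z. map (teval (std (approx z)) (proj e (snd z))) ts = at_index (snd z) (map (teval N e) ts)) gen"
    by (rule eventually_mono) simp
  with N_fn(2)[OF m(1) ts m(2)]
  have "eventually (\<lambda>z. teval (std (approx z)) (proj e (snd z)) (Fun m ts) = teval N e (Fun m ts) (snd z)) gen"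
  proof eventually_elim
    case (elim z)
    then show ?case by (simp del: map_map)
  qed
  with N_fn(1)[OF m(1) ts m(2)] show ?case by simp
qed

text \<open>On these formulas \<open>gen\<close> behaves like an ultrafilter: some stage certifies
  the truth value as a sequence of numbers, and \<open>U\<close> determines which number it
  is.\<close>

lemma sharply_bounded_decided:
  assumes \<theta>: "sharply_bounded \<theta>" and e: "\<And>x. x \<in> fv \<theta> \<Longrightarrow> e x \<in> cut"
  shows "eventually (\<lambda>z. sat (std (approx z)) (proj e (snd z)) \<theta>) gen \<or>
    eventually (\<lambda>z. \<not> sat (std (approx z)) (proj e (snd z)) \<theta>) gen"
proof -
  let ?\<Phi> = "\<lambda>\<beta> e. of_bool (sat (std \<beta>) e \<theta>) :: nat"
  have pd: "poly_dec (fv \<theta>) ?\<Phi>" by (rule poly_dec_comp[OF poly_dec_sharply_bounded[OF \<theta>]])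
  have cong: "?\<Phi> \<beta> e = ?\<Phi> \<beta> e'" if "\<And>x. x \<in> fv \<theta> \<Longrightarrow> e x = e' x" for \<beta> e e'
    using sat_cong[of \<theta> e e' "std \<beta>"] that by simp
  obtain y where y: "eventually (\<lambda>z. ?\<Phi> (approx z) (proj e (snd z)) = y (snd z)) gen"
    using decided_gen[of ?\<Phi> "fv \<theta>" e, OF functionals_sat pd finite_fv cong e] by blast
  consider "eventually (\<lambda>i. y i = 1) U" | "eventually (\<lambda>i. y i \<noteq> 1) U" using U_not by blast
  then show ?thesis
  proof cases
    case 1
    then have "eventually (\<lambda>z. y (snd z) = 1) gen" using gen_U[of "\<lambda>i. y i = 1"] by simp
    with y have "eventually (\<lambda>z. sat (std (approx z)) (proj e (snd z)) \<theta>) gen"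
    proof eventually_elim
      case (elim z)
      then have "of_bool (sat (std (approx z)) (proj e (snd z)) \<theta>) = (1 :: nat)" by (rule trans)
      then show ?case by (simp only: of_bool_eq_1_iff)
    qed
    then show ?thesis ..
  next
    case 2
    then have "eventually (\<lambda>z. y (snd z) \<noteq> 1) gen" using gen_U[of "\<lambda>i. y i \<noteq> 1"] by simp
    with y have "eventually (\<lambda>z. \<not> sat (std (approx z)) (proj e (snd z)) \<theta>) gen"
      by eventually_elim (metis of_bool_eq(2))
    then show ?thesis ..
  qed
qed

lemma gen_not:
  assumes "eventually P gen \<or> eventually (\<lambda>z. \<not> P z) gen"
  shows "eventually (\<lambda>z. \<not> P z) gen \<longleftrightarrow> \<not> eventually P gen"
proof -
  have "\<not> (eventually P gen \<and> eventually (\<lambda>z. \<not> P z) gen)"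
  proof
    assume "eventually P gen \<and> eventually (\<lambda>z. \<not> P z) gen"
    then have "eventually (\<lambda>z. False) gen" by (auto elim: eventually_elim2)
    then show False using gen_nonempty by simp
  qed
  with assms show ?thesis by blast
qed

lemma gen_less:
  assumes "b \<in> cut" "b' \<in> cut" "eventually (\<lambda>z. f z = b (snd z)) gen" "eventually (\<lambda>z. g z = b' (snd z)) gen"
  shows "eventually (\<lambda>z. f z < g z) gen \<longleftrightarrow> eventually (\<lambda>i. b i < b' i) U"
proof -
  have "eventually (\<lambda>z. f z < g z) gen \<longleftrightarrow> eventually (\<lambda>z. b (snd z) < b' (snd z)) gen"
    by (rule eventually_cong[OF eventually_conj[OF assms(3,4)]]) simp
  then show ?thesis using gen_U[of "\<lambda>i. b i < b' i"] by simp
qed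

lemma gen_eq:
  assumes "b \<in> cut" "b' \<in> cut" "eventually (\<lambda>z. f z = b (snd z)) gen" "eventually (\<lambda>z. g z = b' (snd z)) gen"
  shows "eventually (\<lambda>z. f z = g z) gen \<longleftrightarrow> b = b'"
proof -
  have "eventually (\<lambda>z. f z = g z) gen \<longleftrightarrow> eventually (\<lambda>z. b (snd z) = b' (snd z)) gen"
    by (rule eventually_cong[OF eventually_conj[OF assms(3,4)]]) simp
  then show ?thesis using gen_U[of "\<lambda>i. b i = b' i"] pts_eq_iff[OF cut_pts cut_pts] assms(1,2) by simp
qed

section \<open>Truth of sharply bounded formulas in the generic model\<close>

abbreviation gsat :: "(nat \<Rightarrow> point) \<Rightarrow> (otm, pv_rel) fm \<Rightarrow> bool" where
  "gsat e \<theta> \<equiv> eventually (\<lambda>z. sat (std (approx z)) (proj e (snd z)) \<theta>) gen"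

lemma gsat_neg:
  assumes "sharply_bounded \<theta>" "range e \<subseteq> cut"
  shows "gsat e (Neg \<theta>) \<longleftrightarrow> \<not> gsat e \<theta>"
proof -
  have "e x \<in> cut" for x using assms(2) by blast
  from gen_not[OF sharply_bounded_decided[OF assms(1) this]] show ?thesis by simp
qed

text \<open>From right to left, the witnesses present at the different stages could vary with the
  stage. The least witness is itself a functional with polynomial decision trees, so it is decided
  to be one sequence in \<open>F\<close>, and this sequence is a witness in
  \<open>N\<close>.\<close>

lemma gsat_bex:
  assumes sb: "sharply_bounded \<theta>" and t: "length_term t" "x \<notin> tvars t" and e: "range e \<subseteq> cut"
    and IH: "\<And>b. b \<in> cut \<Longrightarrow> sat N (e(x := b)) \<theta> \<longleftrightarrow> gsat (e(x := b)) \<theta>"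
  shows "sat N e (bex x t \<theta>) \<longleftrightarrow> gsat e (bex x t \<theta>)"
proof
  obtain t' where t': "is_term PVa t" using length_termE[OF t(1)] by metis
  note tN = teval_N[OF t' e]
  have upd: "teval N (e(x := b)) t = teval N e t" for b using t(2) by (intro teval_cong) auto
  {
    assume "sat N e (bex x t \<theta>)"
    then obtain b where b: "b \<in> cut" "eventually (\<lambda>i. b i < teval N e t i) U" "sat N (e(x := b)) \<theta>"
      by (auto simp: bex_def upd)
    have "eventually (\<lambda>z. b (snd z) < teval N e t (snd z)) gen"
      using b(2) gen_U[of "\<lambda>i. b i < teval N e t i"] by simp
    moreover have "gsat (e(x := b)) \<theta>" using IH b by blast
    moreover note conjunct2[OF tN]
    ultimately show "gsat e (bex x t \<theta>)"
      by eventually_elim (auto simp: sat_bex_std[OF t(2)] proj_upd)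
  next
    assume g: "gsat e (bex x t \<theta>)"
    let ?\<Phi> = "\<lambda>\<beta> e. LEAST y. y < teval (std \<beta>) e t \<and> sat (std \<beta>) (e(x := y)) \<theta>"
    have pd: "poly_dec (fv (bex x t \<theta>)) ?\<Phi>"
      by (rule poly_dec_bex(2)[OF t poly_dec_sharply_bounded[OF sb]])
    have cong: "?\<Phi> \<beta> e = ?\<Phi> \<beta> e'" if eq: "\<And>y. y \<in> fv (bex x t \<theta>) \<Longrightarrow> e y = e' y" for \<beta> e e'
    proof -
      have "teval (std \<beta>) e t = teval (std \<beta>) e' t" using t(2) eq by (intro teval_cong) (auto simp: bex_def)
      moreover have "sat (std \<beta>) (e(x := y)) \<theta> = sat (std \<beta>) (e'(x := y)) \<theta>" for y
        using eq by (intro sat_cong) (auto simp: bex_def)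
      ultimately show ?thesis by simp
    qed
    obtain y where y: "y \<in> F" "eventually (\<lambda>z. ?\<Phi> (approx z) (proj e (snd z)) = y (snd z)) gen"
      using decided_gen[OF functionals_least pd finite_fv cong, of e] e by blast
    have *: "eventually (\<lambda>z. y (snd z) < teval N e t (snd z) \<and>
        sat (std (approx z)) ((proj e (snd z))(x := y (snd z))) \<theta>) gen"
      using g y(2) conjunct2[OF tN]
    proof eventually_elim
      case (elim z)
      then obtain v where "v < teval (std (approx z)) (proj e (snd z)) t \<and>
          sat (std (approx z)) ((proj e (snd z))(x := v)) \<theta>"
        by (auto simp: sat_bex_std[OF t(2)])
      from LeastI[of "\<lambda>v. v < teval (std (approx z)) (proj e (snd z)) t \<and>
          sat (std (approx z)) ((proj e (snd z))(x := v)) \<theta>", OF this] elim(2,3)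
      show ?case by simp
    qed
    then have "eventually (\<lambda>z. y (snd z) < teval N e t (snd z)) gen" by eventually_elim simp
    then have less: "eventually (\<lambda>i. y i < teval N e t i) U" using gen_U[of "\<lambda>i. y i < teval N e t i"] by simp
    then have "eventually (\<lambda>i. y i \<le> teval N e t i) U" by (rule eventually_mono) simp
    with tN cut_downward have "small (\<lambda>i. bitlength (y i))" by blast
    with rep_cut y(1) have c: "rep y \<in> cut" by blast
    have r: "eventually (\<lambda>z. rep y (snd z) = y (snd z)) gen"
      using rep(2)[OF y(1)] gen_U[of "\<lambda>i. rep y i = y i"] by simp
    have "gsat (e(x := rep y)) \<theta>" using * r by eventually_elim (simp add: proj_upd)
    with IH c have "sat N (e(x := rep y)) \<theta>" by blast
    moreover have "eventually (\<lambda>i. rep y i < teval N e t i) U"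
      using less rep(2)[OF y(1)] by eventually_elim simp
    ultimately show "sat N e (bex x t \<theta>)" using c by (auto simp: bex_def upd)
  }
qed

lemma gsat_quantifier_free:
  assumes "is_formula PVa \<theta>" "quantifier_free \<theta>" "range e \<subseteq> cut"
  shows "sat N e \<theta> \<longleftrightarrow> gsat e \<theta>"
  using assms
proof (induction \<theta>)
  case (Eq s t)
  have "is_term PVa s" "is_term PVa t" using Eq by auto
  note N = teval_N[OF this(1) Eq(3)] teval_N[OF this(2) Eq(3)]
  show ?case
    using gen_eq[OF conjunct1[OF N(1)] conjunct1[OF N(2)] conjunct2[OF N(1)] conjunct2[OF N(2)]] by simp
next
  case (Rel R ts)
  show ?case
  proof (cases R)
    case Less
    with Rel obtain s t where ts: "ts = [s, t]" "is_term PVa s" "is_term PVa t"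
      by (auto simp: numeral_2_eq_2 length_Suc_conv)
    note N = teval_N[OF ts(2) Rel(3)] teval_N[OF ts(3) Rel(3)]
    show ?thesis unfolding Less ts(1)
      using gen_less[OF conjunct1[OF N(1)] conjunct1[OF N(2)] conjunct2[OF N(1)] conjunct2[OF N(2)]] by simp
  next
    case Alpha
    with Rel obtain t where t: "ts = [t]" "is_term PVa t"
      by (auto simp: length_Suc_conv)
    have "eventually (\<lambda>z. teval N e t (snd z) \<in> approx z) gen \<longleftrightarrow>
        eventually (\<lambda>z. teval (std (approx z)) (proj e (snd z)) t \<in> approx z) gen"
      by (rule eventually_cong[OF conjunct2[OF teval_N[OF t(2) Rel(3)]]]) simp
    then show ?thesis unfolding Alpha t(1) by simp
  qed
next
  case (Neg \<theta>)
  then have "sharply_bounded \<theta>" by (intro sharply_bounded.intros) auto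
  from gen_not[OF sharply_bounded_decided[OF this, of e]] Neg show ?case by auto
next
  case (Conj \<theta>s)
  have "sat N e \<theta> \<longleftrightarrow> gsat e \<theta>" if "\<theta> \<in> set \<theta>s" for \<theta>
    using Conj.prems that by (intro Conj.IH[OF that]) auto
  then show ?case by (simp add: eventually_ball_finite_distrib)
next
  case (Disj \<theta>s)
  have IH: "sat N e \<theta> \<longleftrightarrow> gsat e \<theta>" if "\<theta> \<in> set \<theta>s" for \<theta>
    using Disj.prems that by (intro Disj.IH[OF that]) auto
  \<comment> \<open>A filter need not be prime, so a disjunction cannot be split under
    \<open>gen\<close> directly. It is split through the negations of its members, each of which is
    decided.\<close>
  have d: "gsat e (Neg \<theta>) \<longleftrightarrow> \<not> gsat e \<theta>" if "\<theta> \<in> set \<theta>s" for \<theta>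
  proof -
    have "sharply_bounded \<theta>" using Disj.prems that by (intro sharply_bounded.intros) auto
    from gsat_neg[OF this Disj.prems(3)] show ?thesis .
  qed
  have "sharply_bounded (Disj \<theta>s)" using Disj.prems by (intro sharply_bounded.intros) auto
  then have "gsat e (Neg (Disj \<theta>s)) \<longleftrightarrow> \<not> gsat e (Disj \<theta>s)"
    by (rule gsat_neg[OF _ Disj.prems(3)])
  moreover have "gsat e (Neg (Disj \<theta>s)) \<longleftrightarrow> (\<forall>\<theta>\<in>set \<theta>s. gsat e (Neg \<theta>))"
    by (simp add: eventually_ball_finite_distrib)
  ultimately show ?case using IH d by auto
qed auto

lemma gsat_sharply_bounded:
  assumes "sharply_bounded \<theta>" "range e \<subseteq> cut"
  shows "sat N e \<theta> \<longleftrightarrow> gsat e \<theta>"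
  using assms
proof (induction arbitrary: e)
  case (1 \<theta>)
  then show ?case by (intro gsat_quantifier_free)
next
  case (2 \<theta>)
  then show ?case using gen_not[OF sharply_bounded_decided[OF 2(1), of e]] by auto
next
  case (3 \<theta>s)
  have "sat N e \<theta> \<longleftrightarrow> gsat e \<theta>" if "\<theta> \<in> set \<theta>s" for \<theta> using 3 that by blast
  then show ?case by (simp add: eventually_ball_finite_distrib)
next
  case (4 \<theta>s)
  have IH: "sat N e \<theta> \<longleftrightarrow> gsat e \<theta>" and sb: "sharply_bounded \<theta>" if "\<theta> \<in> set \<theta>s" for \<theta> using 4 that by blast+
  have d: "gsat e (Neg \<theta>) \<longleftrightarrow> \<not> gsat e \<theta>" if "\<theta> \<in> set \<theta>s" for \<theta>
    by (rule gsat_neg[OF sb[OF that] 4(2)])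
  have "sharply_bounded (Disj \<theta>s)" using sb by (auto intro: sharply_bounded.intros)
  then have "gsat e (Neg (Disj \<theta>s)) \<longleftrightarrow> \<not> gsat e (Disj \<theta>s)"
    by (rule gsat_neg[OF _ 4(2)])
  moreover have "gsat e (Neg (Disj \<theta>s)) \<longleftrightarrow> (\<forall>\<theta>\<in>set \<theta>s. gsat e (Neg \<theta>))"
    by (simp add: eventually_ball_finite_distrib)
  ultimately show ?case using IH d by auto
next
  case (5 \<theta> t x)
  show ?case
  proof (rule gsat_bex[OF 5(1-3,5)])
    fix b assume "b \<in> cut"
    then show "sat N (e(x := b)) \<theta> \<longleftrightarrow> gsat (e(x := b)) \<theta>" by (rule 5(4)[OF range_fun_upd[OF 5(5)]])
  qed
next
  case (6 \<theta> t x)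
  have sb: "sharply_bounded (Neg \<theta>)" using 6(1) by (rule sharply_bounded.intros)
  have IH: "sat N (e(x := b)) (Neg \<theta>) \<longleftrightarrow> gsat (e(x := b)) (Neg \<theta>)" if "b \<in> cut" for b
  proof -
    have r: "range (e(x := b)) \<subseteq> cut" by (rule range_fun_upd[OF 6(5) that])
    show ?thesis
      unfolding gsat_neg[OF 6(1) r] sat.simps(3)[of N] using 6(4)[OF r] by blast
  qed
  have "sharply_bounded (bex x t (Neg \<theta>))" using sb 6(2,3) by (rule sharply_bounded.intros)
  then have "eventually (\<lambda>z. \<not> sat (std (approx z)) (proj e (snd z)) (bex x t (Neg \<theta>))) gen \<longleftrightarrow>
      \<not> gsat e (bex x t (Neg \<theta>))"
    using gen_not[OF sharply_bounded_decided] 6(5) by blast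
  with gsat_bex[OF sb 6(2,3,5) IH] show ?case unfolding sat_ball_bex by blast
qed

end

context conditions
begin

lemma certified_list:
  assumes "\<And>g. g \<in> set gs \<Longrightarrow> certified n \<sigma> h (Q g)"
    and "\<And>g C C'. C' \<subseteq> C \<Longrightarrow> Q g C \<Longrightarrow> Q g C'"
  shows "certified n \<sigma> (length gs * h) (\<lambda>C. \<forall>g\<in>set gs. Q g C)"
  using assms(1)
proof (induction gs)
  case Nil
  then show ?case unfolding certified_def by (auto intro!: exI[of _ "{}"])
next
  case (Cons g gs)
  have "certified n \<sigma> (h + length gs * h) (\<lambda>C. Q g C \<and> (\<forall>g\<in>set gs. Q g C))"
  proof (rule certified_conj)
    show "certified n \<sigma> h (Q g)" using Cons.prems by simp
    show "certified n \<sigma> (length gs * h) (\<lambda>C. \<forall>g\<in>set gs. Q g C)" using Cons by simp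
  qed (use assms(2) in blast)+
  then show ?case by simp
qed

end

subsection \<open>Truth and forcing for bounded existential formulas\<close>

context generic
begin

text \<open>Truth in \<open>N\<close> leads to a certificate with few queries at some stage. The
  exponent \<open>c\<close> precedes the assignment, so that a least choice can be made at this
  price before any instance is known to be true.\<close>

definition truth_certified :: "sg \<Rightarrow> nat \<Rightarrow> bool" where
  "truth_certified g c \<longleftrightarrow> (\<forall>e s. range e \<subseteq> cut \<longrightarrow> small s \<longrightarrow>
     eventually (\<lambda>i. bounded_env (fv (to_fm g)) (s i) (proj e i)) U \<longrightarrow> sat N e (to_fm g) \<longrightarrow>
     (\<exists>k. eventually (\<lambda>i. certified (a i) (gcond k i) ((s i + 2) ^ c) (\<lambda>C. force C g (proj e i))) U))"

lemma truth_certifiedD: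
  assumes "truth_certified g c" "range e \<subseteq> cut" "small s"
    "eventually (\<lambda>i. bounded_env (fv (to_fm g)) (s i) (proj e i)) U" "sat N e (to_fm g)"
  obtains k where "\<And>k'. k \<le> k' \<Longrightarrow> eventually (\<lambda>i. certified (a i) (gcond k' i) ((s i + 2) ^ c)
    (\<lambda>C. force C g (proj e i))) U"
proof -
  obtain k where k: "eventually (\<lambda>i. certified (a i) (gcond k i) ((s i + 2) ^ c) (\<lambda>C. force C g (proj e i))) U"
    using assms unfolding truth_certified_def by meson
  have "eventually (\<lambda>i. certified (a i) (gcond k' i) ((s i + 2) ^ c) (\<lambda>C. force C g (proj e i))) U"
    if "k \<le> k'" for k'
    using k by eventually_elim (rule certified_mono[OF gcond_cond _ gcond_mono[OF that] order_refl])
  then show ?thesis by (rule that)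
qed

lemma truth_certified_mono:
  assumes "truth_certified g c" "c \<le> c'"
  shows "truth_certified g c'"
  unfolding truth_certified_def
proof (intro allI impI)
  fix e s assume "range e \<subseteq> cut" "small s"
    "eventually (\<lambda>i. bounded_env (fv (to_fm g)) (s i) (proj e i)) U" "sat N e (to_fm g)"
  then obtain k where k: "eventually (\<lambda>i. certified (a i) (gcond k i) ((s i + 2) ^ c) (\<lambda>C. force C g (proj e i))) U"
    using assms(1) unfolding truth_certified_def by meson
  have le: "(s i + 2) ^ c \<le> (s i + 2) ^ c'" for i using assms(2) by (intro power_increasing) auto
  have "eventually (\<lambda>i. certified (a i) (gcond k i) ((s i + 2) ^ c') (\<lambda>C. force C g (proj e i))) U"
    using k by eventually_elim (rule certified_weaken[OF _ _ le])
  then show "\<exists>k. eventually (\<lambda>i. certified (a i) (gcond k i) ((s i + 2) ^ c') (\<lambda>C. force C g (proj e i))) U" ..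
qed

lemma truth_certified_ball:
  assumes "\<And>g. g \<in> set gs \<Longrightarrow> \<exists>c. truth_certified g c"
  obtains c where "\<And>g. g \<in> set gs \<Longrightarrow> truth_certified g c"
proof -
  obtain f where f: "\<And>g. g \<in> set gs \<Longrightarrow> truth_certified g (f g)" using assms by metis
  have "truth_certified g (Max (insert 0 (f ` set gs)))" if "g \<in> set gs" for g
    using that by (intro truth_certified_mono[OF f[OF that]] Max_ge) auto
  then show ?thesis by (rule that)
qed

lemma truth_certified_SB:
  assumes \<theta>: "sharply_bounded \<theta>"
  shows "\<exists>c. truth_certified (SB \<theta>) c"
proof -
  let ?\<Phi> = "\<lambda>\<beta> e. of_bool (sat (std \<beta>) e \<theta>) :: nat"
  have pd: "poly_dec (fv \<theta>) ?\<Phi>" by (rule poly_dec_comp[OF poly_dec_sharply_bounded[OF \<theta>]])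
  have cong: "?\<Phi> \<beta> e = ?\<Phi> \<beta> e'" if "\<And>x. x \<in> fv \<theta> \<Longrightarrow> e x = e' x" for \<beta> e e'
    using sat_cong[of \<theta> e e' "std \<beta>"] that by simp
  obtain c where c: "\<forall>e s. (\<forall>x\<in>fv \<theta>. e x \<in> F) \<longrightarrow> eventually (\<lambda>i. bounded_env (fv \<theta>) (s i) (proj e i)) U \<longrightarrow> small s \<longrightarrow>
    (\<exists>y\<in>F. \<exists>k. eventually (\<lambda>i. certified (a i) (gcond k i) ((s i + 2) ^ c)
      (\<lambda>C. \<forall>\<beta>\<in>C. ?\<Phi> \<beta> (proj e i) = y i)) U)"
    using decided[of ?\<Phi> "fv \<theta>", OF functionals_sat pd finite_fv cong] by blast
  have "truth_certified (SB \<theta>) c"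
    unfolding truth_certified_def
  proof (intro allI impI)
    fix e s assume e: "range e \<subseteq> cut" and s: "small s"
      and b: "eventually (\<lambda>i. bounded_env (fv (to_fm (SB \<theta>))) (s i) (proj e i)) U"
      and sat: "sat N e (to_fm (SB \<theta>))"
    have "\<forall>x\<in>fv \<theta>. e x \<in> F" using e cut_F by blast
    with c s b obtain y k where y: "eventually (\<lambda>i. certified (a i) (gcond k i) ((s i + 2) ^ c)
      (\<lambda>C. \<forall>\<beta>\<in>C. ?\<Phi> \<beta> (proj e i) = y i)) U" unfolding to_fm.simps by meson
    have "gsat e \<theta>" using sat gsat_sharply_bounded[OF \<theta> e] by simp
    with certified_gen[OF y] have "eventually (\<lambda>z. y (snd z) = 1) gen"
      by eventually_elim (metis of_bool_eq(2))
    then have "eventually (\<lambda>i. y i = 1) U" using gen_U[of "\<lambda>i. y i = 1"] by simp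
    with y have "eventually (\<lambda>i. certified (a i) (gcond k i) ((s i + 2) ^ c) (\<lambda>C. force C (SB \<theta>) (proj e i))) U"
    proof eventually_elim
      case (elim i)
      from elim(1) show ?case
      proof (rule certified_weaken)
        fix C assume "\<forall>\<beta>\<in>C. ?\<Phi> \<beta> (proj e i) = y i"
        then have "\<forall>\<beta>\<in>C. ?\<Phi> \<beta> (proj e i) = 1" by (simp only: elim(2))
        then show "force C (SB \<theta>) (proj e i)" by (simp only: of_bool_eq_1_iff force.simps)
      qed simp
    qed
    then show "\<exists>k. eventually (\<lambda>i. certified (a i) (gcond k i) ((s i + 2) ^ c) (\<lambda>C. force C (SB \<theta>) (proj e i))) U" ..
  qed
  then show ?thesis ..
qed

lemma bounded_env_mono: "bounded_env V s e \<Longrightarrow> W \<subseteq> V \<Longrightarrow> s \<le> s' \<Longrightarrow> bounded_env W s' e"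
  unfolding bounded_env_def by (meson order_trans subsetD)

lemma term_bounded:
  assumes p: "\<And>s e \<beta>. bounded_env (tvars t) s e \<Longrightarrow> bitlength (teval (std \<beta>) e t) \<le> p s"
    and t: "is_term PVa t" and e: "range e \<subseteq> cut"
    and s: "eventually (\<lambda>i. bounded_env (tvars t) (s i) (proj e i)) U"
  shows "eventually (\<lambda>i. bitlength (teval N e t i) \<le> p (s i)) U"
proof -
  have "eventually (\<lambda>z. bounded_env (tvars t) (s (snd z)) (proj e (snd z))) gen"
    using s gen_U[of "\<lambda>i. bounded_env (tvars t) (s i) (proj e i)"] by simp
  then have "eventually (\<lambda>z. bitlength (teval N e t (snd z)) \<le> p (s (snd z))) gen"
    using conjunct2[OF teval_N[OF t e]]
  proof eventually_elim
    case (elim z)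
    from p[OF elim(1), of "approx z"] show ?case by (simp only: elim(2))
  qed
  then show ?thesis using gen_U[of "\<lambda>i. bitlength (teval N e t i) \<le> p (s i)"] by simp
qed

text \<open>A true instance provides two certificates, one for the bound on the witness and one for
  the matrix; at a common stage their union serves the quantified formula.\<close>

lemma truth_certified_SBex:
  assumes IH: "truth_certified g c1" and t: "is_term PVa t" "x \<notin> tvars t"
  shows "\<exists>c. truth_certified (SBex x t g) c"
proof -
  define less where "less = Rel Less [Var x, t]"
  have "sharply_bounded less" using t by (intro sharply_bounded.intros) (auto simp: less_def)
  then obtain c2 where c2: "truth_certified (SB less) c2" using truth_certified_SB by blast
  obtain p where p: "polyb p" "\<And>s e \<beta>. bounded_env (tvars t) s e \<Longrightarrow> bitlength (teval (std \<beta>) e t) \<le> p s"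
    using polyb_term[OF t(1)] by blast
  have "polyb (\<lambda>s. (s + p s + 2) ^ c1 + (s + p s + 2) ^ c2)"
    by (intro polyb_add polyb_power polyb_const polyb_id p)
  then obtain c where c: "\<And>s. (s + p s + 2) ^ c1 + (s + p s + 2) ^ c2 \<le> (s + 2) ^ c"
    unfolding polyb_def by blast
  have "truth_certified (SBex x t g) c"
    unfolding truth_certified_def
  proof (intro allI impI)
    fix e s assume e: "range e \<subseteq> cut" and s: "small s"
      and b: "eventually (\<lambda>i. bounded_env (fv (to_fm (SBex x t g))) (s i) (proj e i)) U"
      and sat: "sat N e (to_fm (SBex x t g))"
    have upd: "teval A' (e'(x := y)) t = teval A' e' t" for A' :: "(point, otm, pv_rel) struct" and e' y
      using t(2) by (intro teval_cong) auto
    have upd': "teval (std \<beta>) (e'(x := y)) t = teval (std \<beta>) e' t" for \<beta> e' y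
      using t(2) by (intro teval_cong) auto
    from sat obtain v where v: "v \<in> cut" "sat N (e(x := v)) less" "sat N (e(x := v)) (to_fm g)"
      by (auto simp: bex_def less_def)
    have e': "range (e(x := v)) \<subseteq> cut" using range_fun_upd[OF e v(1)] .
    \<comment> \<open>The witness lies below the value of \<open>t\<close>, so its length is at most
      \<open>p (s i)\<close>.\<close>
    define s' where "s' = (\<lambda>i. s i + p (s i))"
    have s': "small s'" unfolding s'_def by (intro small_add small_polyb[OF p(1)] s)
    have vars: "tvars t \<subseteq> fv (to_fm (SBex x t g))" "fv (to_fm g) - {x} \<subseteq> fv (to_fm (SBex x t g))"
      using t(2) by (auto simp: bex_def)
    have "eventually (\<lambda>i. bounded_env (tvars t) (s i) (proj e i)) U"
      using b by eventually_elim (erule bounded_env_mono[OF _ vars(1) order_refl])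
    from term_bounded[OF p(2) t(1) e this]
    have tb: "eventually (\<lambda>i. bitlength (teval N e t i) \<le> p (s i)) U" .
    have vt: "eventually (\<lambda>i. v i < teval N e t i) U" using v(2) by (simp add: less_def upd)
    have bnd: "eventually (\<lambda>i. bounded_env (insert x (fv (to_fm (SBex x t g)))) (s' i) (proj (e(x := v)) i)) U"
      using tb vt b
    proof eventually_elim
      case (elim i)
      have "bitlength (v i) \<le> bitlength (teval N e t i)" using elim(2) by (intro floorlog_mono) simp
      with elim(1) have "bitlength (v i) \<le> s' i" by (simp add: s'_def)
      then show ?case using elim(3) by (auto simp: bounded_env_def proj_def s'_def intro: trans_le_add1)
    qed
    have bg: "eventually (\<lambda>i. bounded_env (fv (to_fm g)) (s' i) (proj (e(x := v)) i)) U"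
      using bnd by eventually_elim (erule bounded_env_mono, use vars in auto)
    have bl: "eventually (\<lambda>i. bounded_env (fv (to_fm (SB less))) (s' i) (proj (e(x := v)) i)) U"
      using bnd by eventually_elim (erule bounded_env_mono, use vars in \<open>auto simp: less_def\<close>)
    obtain k1 where k1: "\<And>k'. k1 \<le> k' \<Longrightarrow> eventually (\<lambda>i. certified (a i) (gcond k' i) ((s' i + 2) ^ c1)
        (\<lambda>C. force C g (proj (e(x := v)) i))) U"
      using truth_certifiedD[OF IH e' s' bg v(3)] by blast
    have "sat N (e(x := v)) (to_fm (SB less))" using v(2) by simp
    from truth_certifiedD[OF c2 e' s' bl this] obtain k2 where
      k2: "\<And>k'. k2 \<le> k' \<Longrightarrow> eventually (\<lambda>i. certified (a i) (gcond k' i) ((s' i + 2) ^ c2)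
        (\<lambda>C. force C (SB less) (proj (e(x := v)) i))) U" by blast
    let ?k = "max k1 k2"
    have "eventually (\<lambda>i. certified (a i) (gcond ?k i) ((s i + 2) ^ c) (\<lambda>C. force C (SBex x t g) (proj e i))) U"
      using k1[of ?k, simplified] k2[of ?k, simplified]
    proof eventually_elim
      case (elim i)
      have "certified (a i) (gcond ?k i) ((s' i + 2) ^ c1 + (s' i + 2) ^ c2)
          (\<lambda>C. force C g (proj (e(x := v)) i) \<and> force C (SB less) (proj (e(x := v)) i))"
      proof (rule certified_conj)
        show "certified (a i) (gcond ?k i) ((s' i + 2) ^ c1) (\<lambda>C. force C g (proj (e(x := v)) i))" using elim(1) by simp
        show "certified (a i) (gcond ?k i) ((s' i + 2) ^ c2) (\<lambda>C. force C (SB less) (proj (e(x := v)) i))" using elim(2) by simp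
      qed (rule force_antimono, assumption+)+
      then show ?case
      proof (rule certified_weaken)
        show "(s' i + 2) ^ c1 + (s' i + 2) ^ c2 \<le> (s i + 2) ^ c" using c[of "s i"] by (simp add: s'_def)
        fix C assume "force C g (proj (e(x := v)) i) \<and> force C (SB less) (proj (e(x := v)) i)"
        then show "force C (SBex x t g) (proj e i)" unfolding proj_upd
          by (auto simp: less_def upd' intro!: exI[of _ "v i"])
      qed
    qed
    then show "\<exists>k. eventually (\<lambda>i. certified (a i) (gcond k i) ((s i + 2) ^ c) (\<lambda>C. force C (SBex x t g) (proj e i))) U" ..
  qed
  then show ?thesis ..
qed

text \<open>If \<open>g\<close> holds below the bound, the longest initial segment on which it can be forced with
  few queries is everything: otherwise its truth at the end of the segment would come with a
  certificate that prolongs the segment.\<close>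

lemma truth_certified_SBall:
  assumes g: "wf_sg g" and IH: "truth_certified g c1" and t: "length_term t" "x \<notin> tvars t"
  shows "\<exists>c. truth_certified (SBall x t g) c"
proof -
  obtain t' where t': "is_term PVa t'" "tvars t = tvars t'" "is_term PVa t"
    "\<And>\<alpha> e. teval (std \<alpha>) e t = bitlength (teval (std \<alpha>) e t')"
    using length_termE[OF t(1)] by metis
  obtain p where p: "polyb p" "\<And>s e \<beta>. bounded_env (tvars t') s e \<Longrightarrow> bitlength (teval (std \<beta>) e t') \<le> p s"
    using polyb_term[OF t'(1)] by blast
  let ?\<Phi> = "\<lambda>\<beta> e. teval (std \<beta>) e t"
  have cong: "?\<Phi> \<beta> e = ?\<Phi> \<beta> e'" if "\<And>x. x \<in> tvars t \<Longrightarrow> e x = e' x" for \<beta> e e'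
    using that by (rule teval_cong)
  obtain c2 where c2: "\<forall>e s. (\<forall>x\<in>tvars t. e x \<in> F) \<longrightarrow> eventually (\<lambda>i. bounded_env (tvars t) (s i) (proj e i)) U \<longrightarrow> small s \<longrightarrow>
    (\<exists>y\<in>F. \<exists>k. eventually (\<lambda>i. certified (a i) (gcond k i) ((s i + 2) ^ c2)
      (\<lambda>C. \<forall>\<beta>\<in>C. ?\<Phi> \<beta> (proj e i) = y i)) U)"
    using decided[of ?\<Phi> "tvars t", OF functionals_term poly_dec_term[OF t'(3)] finite_tvars cong] by blast
  define V where "V = fv (to_fm g) - {x}"
  define K where "K = Suc (Max (insert 0 V))"
  have K: "v < K" if "v \<in> V" for v using that unfolding K_def V_def by (simp add: less_Suc_eq_le)
  have "polyb (\<lambda>s. (p s + K * s + 2) ^ c1 * p s + (s + 2) ^ c2)"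
    by (intro polyb_add polyb_mult polyb_power polyb_const polyb_id p)
  then obtain c where c: "\<And>s. (p s + K * s + 2) ^ c1 * p s + (s + 2) ^ c2 \<le> (s + 2) ^ c"
    unfolding polyb_def by blast
  have "truth_certified (SBall x t g) c"
    unfolding truth_certified_def
  proof (intro allI impI)
    fix e s assume e: "range e \<subseteq> cut" and s: "small s"
      and bs: "eventually (\<lambda>i. bounded_env (fv (to_fm (SBall x t g))) (s i) (proj e i)) U"
      and sat: "sat N e (to_fm (SBall x t g))"
    have vars: "tvars t \<subseteq> fv (to_fm (SBall x t g))" "V \<subseteq> fv (to_fm (SBall x t g))"
      using t(2) by (auto simp: ball_def V_def)
    have bt: "eventually (\<lambda>i. bounded_env (tvars t) (s i) (proj e i)) U"
      using bs by eventually_elim (erule bounded_env_mono[OF _ vars(1) order_refl])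
    define b where "b = teval N e t"
    have b: "b \<in> cut" "eventually (\<lambda>z. teval (std (approx z)) (proj e (snd z)) t = b (snd z)) gen"
      using teval_N[OF t'(3) e] by (auto simp: b_def)
    have bp: "eventually (\<lambda>i. b i \<le> p (s i)) U"
    proof -
      have "eventually (\<lambda>z. bounded_env (tvars t') (s (snd z)) (proj e (snd z))) gen"
        using bt gen_U[of "\<lambda>i. bounded_env (tvars t') (s i) (proj e i)"] t'(2) by simp
      with b(2) have "eventually (\<lambda>z. b (snd z) \<le> p (s (snd z))) gen"
      proof eventually_elim
        case (elim z)
        from p(2)[OF elim(2), of "approx z"] show ?case by (simp only: elim(1)[symmetric] t'(4))
      qed
      then show ?thesis using gen_U[of "\<lambda>i. b i \<le> p (s i)"] by simp
    qed
    have holds: "sat N (e(x := v)) (to_fm g)" if "v \<in> cut" "eventually (\<lambda>i. v i < b i) U" for v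
    proof -
      have "teval N (e(x := v)) t = b" unfolding b_def using t(2) by (intro teval_cong) auto
      with sat that show ?thesis by (auto simp: ball_def)
    qed
    have "\<forall>x\<in>tvars t. e x \<in> F" using e cut_F by blast
    with c2 bt s obtain y k1 where y: "eventually (\<lambda>i. certified (a i) (gcond k1 i) ((s i + 2) ^ c2)
      (\<lambda>C. \<forall>\<beta>\<in>C. ?\<Phi> \<beta> (proj e i) = y i)) U" by meson
    have yb: "eventually (\<lambda>i. y i = b i) U"
    proof -
      have "eventually (\<lambda>z. y (snd z) = b (snd z)) gen"
        using certified_gen[OF y] b(2) by eventually_elim (rule trans[OF sym])
      then show ?thesis using gen_U[of "\<lambda>i. y i = b i"] by simp
    qed
    define vs where "vs = map (\<lambda>v. if v \<in> V then e v else (\<lambda>_. 0)) [0..<K]"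
    define fs where "fs = b # vs"
    have fs: "set fs \<subseteq> F" unfolding fs_def vs_def using e cut_F[OF b(1)] cut_F const_F by auto
    \<comment> \<open>Adding \<open>b i\<close> itself, which is small because the bound is sharp,
      covers the length of every value of the quantified variable.\<close>
    define s' where "s' = (\<lambda>i. b i + sz (at_index i vs))"
    have szv: "eventually (\<lambda>i. sz (at_index i vs) \<le> K * s i) U"
      using bs
    proof eventually_elim
      case (elim i)
      have "sz (at_index i vs) \<le> sum_list (map (\<lambda>_. s i) [0..<K])"
        unfolding sz_def vs_def map_map
        using bounded_env_mono[OF elim vars(2) order_refl] by (intro sum_list_mono) (auto simp: bounded_env_def proj_def floorlog_def)
      then show ?case by (simp add: sum_list_triv)
    qed
    have s'p: "eventually (\<lambda>i. s' i \<le> p (s i) + K * s i) U"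
      using szv bp by eventually_elim (simp add: s'_def)
    have s': "small s'"
      by (rule small_mono[OF _ s'p]) (intro small_add small_mult small_const small_polyb[OF p(1)] s)
    have env_eq: "force C g ((env (at_index i vs))(x := v)) \<longleftrightarrow> force C g ((proj e i)(x := v))" for C i v
      by (rule force_cong[OF g]) (use K in \<open>auto simp: vs_def env_def proj_def V_def\<close>)
    \<comment> \<open>The number \<open>m\<close> counts the values missing at the end, so that the
      least possible \<open>m\<close> gives the longest segment. The head of \<open>fs\<close>
      carries the bound \<open>b\<close>.\<close>
    let ?j = "segment_req g x c1"
    have w: "snd ?j (at_index i fs) m = (s' i + 2) ^ c1 * (b i - m)" for i m
      by (simp add: segment_req_def fs_def s'_def)
    have Q: "fst ?j C (at_index i fs) m \<longleftrightarrow> (\<forall>v<b i - m. force C g ((proj e i)(x := v)))" for C i m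
      by (simp add: segment_req_def fs_def env_eq)
    have sreq: "small_req ?j fs"
      unfolding small_req_def
    proof (intro exI conjI)
      show "small (\<lambda>i. (s' i + 2) ^ c1 * p (s i))"
        by (intro small_mult small_power small_add small_const s' small_polyb[OF p(1)] s)
      show "eventually (\<lambda>i. \<forall>m. snd ?j (at_index i fs) m \<le> (s' i + 2) ^ c1 * p (s i)) U"
        using bp
      proof eventually_elim
        case (elim i)
        show ?case unfolding w
        proof
          fix m
          have "b i - m \<le> p (s i)" using elim by simp
          then show "(s' i + 2) ^ c1 * (b i - m) \<le> (s' i + 2) ^ c1 * p (s i)" by (rule mult_le_mono2)
        qed
      qed
    qed
    obtain k m where m: "m \<in> F" and
      km': "\<forall>i m'. possible (a i) (gcond k i) ((s' i + 2) ^ c1 * (b i - m')) (\<lambda>C. \<forall>v<b i - m'. force C g ((proj e i)(x := v))) \<longrightarrow>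
      m i \<le> m' \<and> certified (a i) (gcond (Suc k) i) ((s' i + 2) ^ c1 * (b i - m i)) (\<lambda>C. \<forall>v<b i - m i. force C g ((proj e i)(x := v)))"
      using requirement[OF segment_req_in fs sreq] unfolding w Q by (elim exE conjE) (rule that)
    note km = km'[rule_format]
    \<comment> \<open>With all values missing nothing is to be forced, so the requirement is always
      satisfiable and \<open>m\<close> is at most \<open>b\<close>.\<close>
    have triv: "possible (a i) (gcond k i) ((s' i + 2) ^ c1 * (b i - b i)) (\<lambda>C. \<forall>v<b i - b i. force C g ((proj e i)(x := v)))" for i
      unfolding possible_def certified_def using gcond_cond by (intro exI[of _ "gcond k i"] conjI exI[of _ "{}"]) auto
    have cert: "certified (a i) (gcond (Suc k) i) ((s' i + 2) ^ c1 * (b i - m i)) (\<lambda>C. \<forall>v<b i - m i. force C g ((proj e i)(x := v)))"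
      and mb: "m i \<le> b i" for i
      using km[OF triv] by auto
    have m0: "eventually (\<lambda>i. m i = 0) U"
    proof (rule ccontr)
      assume "\<not> ?thesis"
      then have pos: "eventually (\<lambda>i. m i \<noteq> 0) U" using U_not by blast
      \<comment> \<open>The first value beyond the segment. It is a sequence in \<open>F\<close>
        below \<open>b\<close>, so it names an element of the cut at which \<open>g\<close>
        holds.\<close>
      define d where "d = (\<lambda>i. b i - m i)"
      have "(\<lambda>xs. xs ! 0 - xs ! 1) \<in> ops" unfolding ops_def by blast
      from F(2)[OF this, of "[b, m]"] cut_F[OF b(1)] m have d: "d \<in> F" by (simp add: d_def)
      have "eventually (\<lambda>i. d i \<le> b i) U" by (simp add: d_def)
      with cut_downward b(1) have "small (\<lambda>i. bitlength (d i))" by blast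
      with rep_cut d have dc: "rep d \<in> cut" by blast
      have dlt: "eventually (\<lambda>i. rep d i < b i) U"
        using pos rep(2)[OF d]
      proof eventually_elim
        case (elim i)
        then show ?case using mb[of i] by (simp add: d_def)
      qed
      have e': "range (e(x := rep d)) \<subseteq> cut" using range_fun_upd[OF e dc] .
      have "eventually (\<lambda>i. bounded_env (fv (to_fm g)) (s' i) (proj (e(x := rep d)) i)) U"
        using dlt
      proof eventually_elim
        case (elim i)
        have "bitlength (rep d i) \<le> s' i"
          using elim bitlength_le_self[of "rep d i"] by (simp add: s'_def)
        moreover have "bitlength (e v i) \<le> s' i" if v: "v \<in> V" for v
        proof -
          have "e v i \<in> set (at_index i vs)" using v K[OF v] by (auto simp: vs_def intro!: image_eqI[of _ _ v])
          from bitlength_le_sz[OF this] show ?thesis by (simp add: s'_def)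
        qed
        ultimately show ?case by (auto simp: bounded_env_def proj_def V_def)
      qed
      from truth_certifiedD[OF IH e' s' this holds[OF dc dlt]] obtain k2 where
        k2: "\<And>k'. k2 \<le> k' \<Longrightarrow> eventually (\<lambda>i. certified (a i) (gcond k' i) ((s' i + 2) ^ c1)
          (\<lambda>C. force C g (proj (e(x := rep d)) i))) U" by blast
      let ?k = "max (Suc k) k2"
      have "eventually (\<lambda>i. False) U"
        using k2[of ?k, simplified] pos rep(2)[OF d]
      proof eventually_elim
        case (elim i)
        have 1: "certified (a i) (gcond ?k i) ((s' i + 2) ^ c1 * d i) (\<lambda>C. \<forall>v<d i. force C g ((proj e i)(x := v)))"
          unfolding d_def by (rule certified_mono[OF gcond_cond cert gcond_mono order_refl]) simp
        have 2: "certified (a i) (gcond ?k i) ((s' i + 2) ^ c1) (\<lambda>C. force C g ((proj e i)(x := d i)))"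
          using elim(1,3) unfolding proj_upd by simp
        have Suc: "b i - (m i - 1) = Suc (d i)" using elim(2) mb[of i] by (simp add: d_def)
        have "certified (a i) (gcond ?k i) ((s' i + 2) ^ c1 * d i + (s' i + 2) ^ c1)
            (\<lambda>C. (\<forall>v<d i. force C g ((proj e i)(x := v))) \<and> force C g ((proj e i)(x := d i)))"
          by (rule certified_conj[OF 1 2]) (blast intro: force_antimono)+
        \<comment> \<open>The budget of a segment is proportional to its length, so one more
          certificate fits exactly; this makes \<open>m i - 1\<close> possible at stage
          \<open>k\<close>, against the choice of \<open>m\<close>.\<close>
        then have "certified (a i) (gcond ?k i) ((s' i + 2) ^ c1 * (b i - (m i - 1)))
            (\<lambda>C. \<forall>v<b i - (m i - 1). force C g ((proj e i)(x := v)))"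
          unfolding Suc by (rule certified_weaken) (auto simp: less_Suc_eq)
        from conjunct1[OF km[OF certified_possible_gcond[OF this]]] elim(2) show False by linarith
      qed
      then show False using U_nonempty by simp
    qed
    let ?k = "max (Suc k) k1"
    have "eventually (\<lambda>i. certified (a i) (gcond ?k i) ((s i + 2) ^ c) (\<lambda>C. force C (SBall x t g) (proj e i))) U"
      using m0 y yb bp s'p
    proof eventually_elim
      case (elim i)
      have 1: "certified (a i) (gcond ?k i) ((s' i + 2) ^ c1 * b i) (\<lambda>C. \<forall>v<b i. force C g ((proj e i)(x := v)))"
        using certified_mono[OF gcond_cond[of i ?k] cert[of i] gcond_mono[of "Suc k" ?k i] order_refl] elim(1) by simp
      have 2: "certified (a i) (gcond ?k i) ((s i + 2) ^ c2) (\<lambda>C. \<forall>\<beta>\<in>C. ?\<Phi> \<beta> (proj e i) = b i)"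
        using certified_mono[OF gcond_cond[of i ?k] elim(2) gcond_mono[of k1 ?k i] order_refl] elim(3) by simp
      have "certified (a i) (gcond ?k i) ((s' i + 2) ^ c1 * b i + (s i + 2) ^ c2)
          (\<lambda>C. (\<forall>v<b i. force C g ((proj e i)(x := v))) \<and> (\<forall>\<beta>\<in>C. ?\<Phi> \<beta> (proj e i) = b i))"
        by (rule certified_conj[OF 1 2]) (blast intro: force_antimono)+
      then show ?case
      proof (rule certified_weaken)
        have "(s' i + 2) ^ c1 * b i \<le> (p (s i) + K * s i + 2) ^ c1 * p (s i)"
          using elim(4,5) by (intro mult_le_mono power_mono) auto
        with c[of "s i"] show "(s' i + 2) ^ c1 * b i + (s i + 2) ^ c2 \<le> (s i + 2) ^ c" by linarith
      qed auto
    qed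
    then show "\<exists>k. eventually (\<lambda>i. certified (a i) (gcond k i) ((s i + 2) ^ c) (\<lambda>C. force C (SBall x t g) (proj e i))) U" ..
  qed
  then show ?thesis ..
qed

lemma truth_certified_ex: "wf_sg g \<Longrightarrow> \<exists>c. truth_certified g c"
proof (induction g)
  case (SB \<theta>)
  then show ?case using truth_certified_SB by simp
next
  case (SConj gs)
  then obtain c where c: "\<And>g. g \<in> set gs \<Longrightarrow> truth_certified g c" using truth_certified_ball[of gs] by auto
  have "polyb (\<lambda>s. length gs * (s + 2) ^ c)" by (intro polyb_mult polyb_power polyb_add polyb_const polyb_id)
  then obtain d where d: "\<And>s. length gs * (s + 2) ^ c \<le> (s + 2) ^ d" unfolding polyb_def by blast
  have "truth_certified (SConj gs) d"
    unfolding truth_certified_def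
  proof (intro allI impI)
    fix e s assume e: "range e \<subseteq> cut" and s: "small s"
      and b: "eventually (\<lambda>i. bounded_env (fv (to_fm (SConj gs))) (s i) (proj e i)) U"
      and sat: "sat N e (to_fm (SConj gs))"
    have "\<exists>k. \<forall>k'\<ge>k. eventually (\<lambda>i. certified (a i) (gcond k' i) ((s i + 2) ^ c) (\<lambda>C. force C g (proj e i))) U"
      if g: "g \<in> set gs" for g
    proof -
      have sub: "fv (to_fm g) \<subseteq> fv (to_fm (SConj gs))" using g by auto
      have h: "eventually (\<lambda>i. bounded_env (fv (to_fm g)) (s i) (proj e i)) U"
        using b by eventually_elim (erule bounded_env_mono[OF _ sub order_refl])
      have "sat N e (to_fm g)" using sat g by simp
      from truth_certifiedD[OF c[OF g] e s h this] obtain k where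
        "\<And>k'. k \<le> k' \<Longrightarrow> eventually (\<lambda>i. certified (a i) (gcond k' i) ((s i + 2) ^ c)
          (\<lambda>C. force C g (proj e i))) U" by blast
      then show ?thesis by blast
    qed
    then have "\<forall>g\<in>set gs. \<exists>k. \<forall>k'\<ge>k. eventually (\<lambda>i. certified (a i) (gcond k' i) ((s i + 2) ^ c) (\<lambda>C. force C g (proj e i))) U" by blast
    from bchoice[OF this] obtain k where
      "\<forall>g\<in>set gs. \<forall>k'\<ge>k g. eventually (\<lambda>i. certified (a i) (gcond k' i) ((s i + 2) ^ c) (\<lambda>C. force C g (proj e i))) U" ..
    then have k: "eventually (\<lambda>i. certified (a i) (gcond k' i) ((s i + 2) ^ c) (\<lambda>C. force C g (proj e i))) U"
      if "g \<in> set gs" "k g \<le> k'" for g k' using that by blast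
    define k0 where "k0 = Max (insert 0 (k ` set gs))"
    have "eventually (\<lambda>i. \<forall>g\<in>set gs. certified (a i) (gcond k0 i) ((s i + 2) ^ c) (\<lambda>C. force C g (proj e i))) U"
      by (intro eventually_ball_finite ballI k) (auto simp: k0_def)
    then have "eventually (\<lambda>i. certified (a i) (gcond k0 i) ((s i + 2) ^ d) (\<lambda>C. force C (SConj gs) (proj e i))) U"
    proof eventually_elim
      case (elim i)
      have "certified (a i) (gcond k0 i) (length gs * (s i + 2) ^ c) (\<lambda>C. \<forall>g\<in>set gs. force C g (proj e i))"
        by (rule certified_list) (use elim force_antimono in blast)+
      then show ?case by (rule certified_weaken) (use d in auto)
    qed
    then show "\<exists>k. eventually (\<lambda>i. certified (a i) (gcond k i) ((s i + 2) ^ d) (\<lambda>C. force C (SConj gs) (proj e i))) U" ..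
  qed
  then show ?case ..
next
  case (SDisj gs)
  then obtain c where c: "\<And>g. g \<in> set gs \<Longrightarrow> truth_certified g c" using truth_certified_ball[of gs] by auto
  have "truth_certified (SDisj gs) c"
    unfolding truth_certified_def
  proof (intro allI impI)
    fix e s assume e: "range e \<subseteq> cut" and s: "small s"
      and b: "eventually (\<lambda>i. bounded_env (fv (to_fm (SDisj gs))) (s i) (proj e i)) U"
      and sat: "sat N e (to_fm (SDisj gs))"
    from sat obtain g where g: "g \<in> set gs" "sat N e (to_fm g)" by auto
    have sub: "fv (to_fm g) \<subseteq> fv (to_fm (SDisj gs))" using g by auto
    have "eventually (\<lambda>i. bounded_env (fv (to_fm g)) (s i) (proj e i)) U"
      using b by eventually_elim (erule bounded_env_mono[OF _ sub order_refl])
    from truth_certifiedD[OF c[OF g(1)] e s this g(2)] obtain k where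
      "eventually (\<lambda>i. certified (a i) (gcond k i) ((s i + 2) ^ c) (\<lambda>C. force C g (proj e i))) U" by blast
    then have "eventually (\<lambda>i. certified (a i) (gcond k i) ((s i + 2) ^ c) (\<lambda>C. force C (SDisj gs) (proj e i))) U"
      by eventually_elim (erule certified_weaken, use g(1) in auto)
    then show "\<exists>k. eventually (\<lambda>i. certified (a i) (gcond k i) ((s i + 2) ^ c) (\<lambda>C. force C (SDisj gs) (proj e i))) U" ..
  qed
  then show ?case ..
next
  case (SBex x t g)
  then show ?case using truth_certified_SBex by auto
next
  case (SBall x t g)
  then show ?case using truth_certified_SBall by auto
qed

section \<open>From forcing to truth\<close>

abbreviation possible_oracles :: "nat \<Rightarrow> nat \<Rightarrow> nat set set" where
  "possible_oracles k i \<equiv> cone (known (a i) (gcond k i)) (gcond k i)"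

lemma approx_possible: "k \<le> k' \<Longrightarrow> approx (k', i) \<in> possible_oracles k i"
  by (rule approx_in_cone) auto

lemma possible_oracles_gen:
  assumes "eventually (\<lambda>i. \<forall>\<beta>\<in>possible_oracles k i. P \<beta> i) U"
  shows "eventually (\<lambda>z. P (approx z) (snd z)) gen"
  unfolding eventually_gen
proof (intro exI allI impI)
  fix k' assume "k \<le> k'"
  from assms show "eventually (\<lambda>i. P (approx (k', i)) (snd (k', i))) U"
    by eventually_elim (use approx_possible[OF \<open>k \<le> k'\<close>] in auto)
qed

text \<open>The stage \<open>k\<close> stays fixed throughout the induction, so being forced is a
  statement about one internal condition. Witnesses can hence be selected index by index through an
  operation in \<open>ops\<close>, which makes them elements of the cut.\<close>

lemma forced_true:
  assumes "wf_sg g" "range e \<subseteq> cut" "eventually (\<lambda>i. force (possible_oracles k i) g (proj e i)) U"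
  shows "sat N e (to_fm g)"
  using assms
proof (induction g arbitrary: e)
  case (SB \<theta>)
  then have "gsat e \<theta>"
    using possible_oracles_gen[of k "\<lambda>\<beta> i. sat (std \<beta>) (proj e i) \<theta>"] by simp
  with SB gsat_sharply_bounded show ?case by simp
next
  case (SConj gs)
  have "sat N e (to_fm g)" if "g \<in> set gs" for g
  proof (rule SConj.IH[OF that _ SConj.prems(2)])
    show "wf_sg g" using SConj.prems that by simp
    show "eventually (\<lambda>i. force (possible_oracles k i) g (proj e i)) U"
      using SConj.prems(3) by eventually_elim (use that in simp)
  qed
  then show ?case by simp
next
  case (SDisj gs)
  then obtain g where g: "g \<in> set gs" "eventually (\<lambda>i. force (possible_oracles k i) g (proj e i)) U"
    using ultrafilter_bex[OF ultra, of "set gs" "\<lambda>g i. force (possible_oracles k i) g (proj e i)"] by auto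
  then have "sat N e (to_fm g)" using SDisj by auto
  with g(1) show ?case by auto
next
  case (SBex x t g)
  then have t: "is_term PVa t" "x \<notin> tvars t" and g: "wf_sg g" by auto
  define K where "K = Suc (Max (insert 0 (fv (to_fm g) \<union> tvars t)))"
  have K: "v < K" if "v \<in> fv (to_fm g) \<union> tvars t" for v
    using that unfolding K_def by (simp add: less_Suc_eq_le)
  define y where "y = (\<lambda>i. LEAST y. (\<forall>\<beta>\<in>possible_oracles k i. y < teval (std \<beta>) (env (at_index i (map e [0..<K]))) t) \<and>
      force (possible_oracles k i) g ((env (at_index i (map e [0..<K])))(x := y)))"
  have "y \<in> F"
  proof -
    have "(\<lambda>xs. let C = cone (known (xs ! 0) (decode (xs ! 1))) (decode (xs ! 1)) in
        LEAST y. (\<forall>\<beta>\<in>C. y < teval (std \<beta>) (env (drop 2 xs)) t) \<and>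
          force C g ((env (drop 2 xs))(x := y))) \<in>
      range (\<lambda>(x, t, g) xs. let C = cone (known (xs ! 0) (decode (xs ! 1))) (decode (xs ! 1)) in
        LEAST y. (\<forall>\<beta>\<in>C. y < teval (std \<beta>) (env (drop 2 xs)) t) \<and>
          force C g ((env (drop 2 xs))(x := y)))" (is "?h \<in> _")
      by (rule range_eqI[of _ _ "(x, t, g)"]) simp
    then have "?h \<in> ops" unfolding ops_def by blast
    moreover have "set (a # chain k # map e [0..<K]) \<subseteq> F" using SBex.prems(2) cut_F a chain_F by auto
    ultimately have "(\<lambda>i. ?h (at_index i (a # chain k # map e [0..<K]))) \<in> F" by (rule F(2))
    then show ?thesis by (simp add: y_def gcond_def Let_def del: map_map)
  qed
  have eqt: "teval (std \<beta>) (env (at_index i (map e [0..<K]))) t = teval (std \<beta>) (proj e i) t" for \<beta> i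
    using K by (intro teval_cong) (auto simp del: map_map)
  have eqg: "force C g ((env (at_index i (map e [0..<K])))(x := v)) \<longleftrightarrow> force C g ((proj e i)(x := v))" for C i v
    using K by (intro force_cong[OF g]) (auto simp del: map_map)
  have y: "eventually (\<lambda>i. (\<forall>\<beta>\<in>possible_oracles k i. y i < teval (std \<beta>) (proj e i) t) \<and>
      force (possible_oracles k i) g ((proj e i)(x := y i))) U"
    using SBex.prems(3)
  proof eventually_elim
    case (elim i)
    then obtain v where v: "(\<forall>\<beta>\<in>possible_oracles k i. v < teval (std \<beta>) (proj e i) t) \<and>
      force (possible_oracles k i) g ((proj e i)(x := v))" by auto
    show ?case unfolding y_def eqt eqg by (rule LeastI[of "\<lambda>v. (\<forall>\<beta>\<in>possible_oracles k i. v < teval (std \<beta>) (proj e i) t) \<and>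
      force (possible_oracles k i) g ((proj e i)(x := v))", OF v])
  qed
  have "eventually (\<lambda>i. \<forall>\<beta>\<in>possible_oracles k i. y i < teval (std \<beta>) (proj e i) t) U"
    using y by eventually_elim blast
  from possible_oracles_gen[OF this] conjunct2[OF teval_N[OF t(1) SBex.prems(2)]]
  have "eventually (\<lambda>z. y (snd z) < teval N e t (snd z)) gen"
    by eventually_elim simp
  then have less: "eventually (\<lambda>i. y i < teval N e t i) U" using gen_U[of "\<lambda>i. y i < teval N e t i"] by simp
  then have "eventually (\<lambda>i. y i \<le> teval N e t i) U" by (rule eventually_mono) simp
  with teval_N[OF t(1) SBex.prems(2)] cut_downward have "small (\<lambda>i. bitlength (y i))" by blast
  with rep_cut \<open>y \<in> F\<close> have c: "rep y \<in> cut" by blast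
  have "sat N (e(x := rep y)) (to_fm g)"
  proof (rule SBex.IH[OF g range_fun_upd[OF SBex.prems(2) c]])
    show "eventually (\<lambda>i. force (possible_oracles k i) g (proj (e(x := rep y)) i)) U"
      using y rep(2)[OF \<open>y \<in> F\<close>] by eventually_elim (simp add: proj_upd)
  qed
  moreover have "eventually (\<lambda>i. rep y i < teval N e t i) U"
    using less rep(2)[OF \<open>y \<in> F\<close>] by eventually_elim simp
  moreover have "teval N (e(x := rep y)) t = teval N e t" using t(2) by (intro teval_cong) auto
  ultimately show ?case
    using c unfolding to_fm.simps bex_def sat.simps by (intro bexI[of _ "rep y"]) simp_all
next
  case (SBall x t g)
  then have t: "length_term t" "x \<notin> tvars t" and g: "wf_sg g" by auto
  then have t': "is_term PVa t" using length_termE by metis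
  have "sat N (e(x := b)) (to_fm g)" if b: "b \<in> cut" "eventually (\<lambda>i. b i < teval N e t i) U" for b
  proof (rule SBall.IH[OF g range_fun_upd[OF SBall.prems(2) b(1)]])
    from conjunct2[OF teval_N[OF t' SBall.prems(2)]] obtain k0 where
      "\<forall>k'\<ge>k0. eventually (\<lambda>i. teval (std (approx (k', i))) (proj e i) t = teval N e t i) U"
      unfolding eventually_gen by auto
    \<comment> \<open>A stage that extends \<open>k\<close> and at which the bound has its value in
      \<open>N\<close>. Its oracle is among those possible at \<open>k\<close>, so the forced value
      of the bound is the value in \<open>N\<close>.\<close>
    then obtain k' where k': "k \<le> k'"
      "eventually (\<lambda>i. teval (std (approx (k', i))) (proj e i) t = teval N e t i) U"
      using max.cobounded1 max.cobounded2 by blast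
    show "eventually (\<lambda>i. force (possible_oracles k i) g (proj (e(x := b)) i)) U"
      using SBall.prems(3) k'(2) b(2)
    proof eventually_elim
      case (elim i)
      from elim(1) obtain v where v: "\<forall>\<beta>\<in>possible_oracles k i. teval (std \<beta>) (proj e i) t = v"
        "\<forall>y<v. force (possible_oracles k i) g ((proj e i)(x := y))" by auto
      from v(1) approx_possible[OF k'(1)] elim(2) have "v = teval N e t i" by auto
      with v(2) elim(3) show ?case by (simp add: proj_upd)
    qed
  qed
  moreover have "teval N (e(x := b)) t = teval N e t" for b using t(2) by (intro teval_cong) auto
  ultimately show ?case by (auto simp: ball_def)
qed

text \<open>The chosen \<open>m\<close> is true because the next stage certifies it, and minimal
  because a smaller true value would be certified within the same budget, hence would have been
  possible when \<open>m\<close> was chosen. The choice itself only concerns extensions of stage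
  \<open>k\<close> and is thus an internal minimum.\<close>

lemma minimization_N:
  assumes \<chi>: "Sigma_b_1 \<chi>"
  shows "minimization N \<chi> x"
  unfolding minimization_def
proof (intro allI impI)
  fix e assume e: "range e \<subseteq> Dom N" and sat: "sat N e \<chi>"
  obtain g where g: "wf_sg g" "to_fm g = \<chi>" using Sigma_b_1_sg[OF \<chi>] by blast
  obtain c where c: "truth_certified g c" using truth_certified_ex[OF g(1)] by blast
  \<comment> \<open>The variable \<open>x\<close> is included so that \<open>s\<close> covers the
    length of \<open>e x\<close> and with it the length of every candidate up to
    \<open>e x\<close>.\<close>
  define K where "K = Suc (Max (insert x (fv \<chi>)))"
  have K: "v < K" if "v \<in> insert x (fv \<chi>)" for v
    using that unfolding K_def by (simp add: less_Suc_eq_le)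
  define fs where "fs = map e [0..<K]"
  have e: "range e \<subseteq> cut" using e by simp
  have fs: "set fs \<subseteq> F" "set fs \<subseteq> cut" unfolding fs_def using e cut_F by auto
  define s where "s = (\<lambda>i. sz (at_index i fs))"
  have s: "small s" unfolding s_def by (rule small_sz[OF fs(2)])
  have es: "bitlength (e v i) \<le> s i" if "v \<in> insert x (fv \<chi>)" for v i
    unfolding s_def by (rule bitlength_le_sz) (use K[OF that] in \<open>auto simp: fs_def\<close>)
  have env_eq: "force C g ((env (at_index i fs))(x := v)) \<longleftrightarrow> force C g ((proj e i)(x := v))" for C i v
    unfolding fs_def using K g(2) by (intro force_cong[OF g(1)]) (auto simp del: map_map)
  let ?j = "least_req g x c"
  have w: "snd ?j (at_index i fs) m' = (s i + 2) ^ c" for i m' by (simp add: least_req_def s_def)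
  have Q: "fst ?j C (at_index i fs) m' \<longleftrightarrow> force C g ((proj e i)(x := m'))" for C i m'
    using env_eq by (simp add: least_req_def del: fun_upd_apply)
  have sreq: "small_req ?j fs"
    unfolding small_req_def
  proof (intro exI conjI)
    show "small (\<lambda>i. (s i + 2) ^ c)" by (intro small_power small_add small_const s)
  qed (simp add: w)
  obtain k m where m: "m \<in> F" and
    km': "\<forall>i m'. possible (a i) (gcond k i) ((s i + 2) ^ c) (\<lambda>C. force C g ((proj e i)(x := m'))) \<longrightarrow>
      m i \<le> m' \<and> certified (a i) (gcond (Suc k) i) ((s i + 2) ^ c) (\<lambda>C. force C g ((proj e i)(x := m i)))"
    using requirement[OF least_req_in fs(1) sreq] unfolding w Q by (elim exE conjE) (rule that)
  note km = km'[rule_format]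
  \<comment> \<open>Applied to \<open>e x\<close> this shows that the requirement can be met at all;
    applied to smaller true values it yields minimality.\<close>
  have least: "eventually (\<lambda>i. m i \<le> b i \<and>
      certified (a i) (gcond (Suc k) i) ((s i + 2) ^ c) (\<lambda>C. force C g ((proj e i)(x := m i)))) U"
    if b: "b \<in> cut" "eventually (\<lambda>i. b i \<le> e x i) U" "sat N (e(x := b)) \<chi>" for b
  proof -
    have "eventually (\<lambda>i. bounded_env (fv (to_fm g)) (s i) (proj (e(x := b)) i)) U"
      using b(2)
    proof eventually_elim
      case (elim i)
      have "bitlength (b i) \<le> s i" using floorlog_mono[OF elim] es[of x i] by (meson insertI1 order_trans)
      then show ?case using es[of _ i] by (auto simp: bounded_env_def proj_def g(2))
    qed
    from truth_certifiedD[OF c range_fun_upd[OF e b(1)] s this] b(3) g(2) obtain k' where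
      "eventually (\<lambda>i. certified (a i) (gcond k' i) ((s i + 2) ^ c) (\<lambda>C. force C g (proj (e(x := b)) i))) U" by blast
    then show ?thesis
    proof eventually_elim
      case (elim i)
      from km[OF certified_possible_gcond[OF elim[unfolded proj_upd]]] show ?case .
    qed
  qed
  have l: "eventually (\<lambda>i. m i \<le> e x i \<and>
      certified (a i) (gcond (Suc k) i) ((s i + 2) ^ c) (\<lambda>C. force C g ((proj e i)(x := m i)))) U"
    using least[of "e x"] e sat by auto
  then have le: "eventually (\<lambda>i. m i \<le> e x i) U" by eventually_elim simp
  have "e x \<in> cut" using e by auto
  from rep_cut[OF m cut_downward[OF this le]] have rm: "rep m \<in> cut" .
  have le': "eventually (\<lambda>i. rep m i \<le> e x i) U" using le rep(2)[OF m] by eventually_elim simp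
  have "less_in N (rep m) (e x) \<or> rep m = e x"
  proof (rule disjCI)
    assume "rep m \<noteq> e x"
    then have "eventually (\<lambda>i. rep m i \<noteq> e x i) U"
      using pts_eq_iff[OF cut_pts cut_pts, OF rm \<open>e x \<in> cut\<close>] U_not by blast
    with le' have "eventually (\<lambda>i. rep m i < e x i) U" by eventually_elim simp
    then show "less_in N (rep m) (e x)" by simp
  qed
  moreover have "sat N (e(x := rep m)) \<chi>"
    unfolding g(2)[symmetric]
  proof (rule forced_true[OF g(1) range_fun_upd[OF e rm]])
    show "eventually (\<lambda>i. force (possible_oracles (Suc k) i) g (proj (e(x := rep m)) i)) U"
      using l rep(2)[OF m]
    proof eventually_elim
      case (elim i)
      from conjunct2[OF elim(1)] have "force (possible_oracles (Suc k) i) g ((proj e i)(x := m i))"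
        by (rule certified_known) (blast intro: force_antimono)
      with elim(2) show ?case by (simp add: proj_upd)
    qed
  qed
  moreover have "\<not> sat N (e(x := b)) \<chi>" if b: "b \<in> cut" "less_in N b (rep m)" for b
  proof
    assume "sat N (e(x := b)) \<chi>"
    have lt: "eventually (\<lambda>i. b i < rep m i) U" using b(2) by simp
    with le' have "eventually (\<lambda>i. b i \<le> e x i) U" by eventually_elim simp
    from least[OF b(1) this \<open>sat N (e(x := b)) \<chi>\<close>] lt rep(2)[OF m]
    have "eventually (\<lambda>i. False) U" by eventually_elim simp
    then show False using U_nonempty by simp
  qed
  ultimately show "\<exists>b\<in>Dom N. (less_in N b (e x) \<or> b = e x) \<and> sat N (e(x := b)) \<chi> \<and>
      (\<forall>c\<in>Dom N. less_in N c b \<longrightarrow> \<not> sat N (e(x := c)) \<chi>)"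
    using rm by auto
qed

section \<open>The universal axioms\<close>

lemma is_formula_alls: "is_formula L' (alls xs \<phi>) \<longleftrightarrow> is_formula L' \<phi>"
  by (induction xs) (auto simp: alls_def)

lemma model_N: "model_forall_T12_PVa N"
  unfolding model_forall_T12_PVa_def
proof (intro conjI ballI allI impI)
  show "is_struct PVa N" by (rule is_struct_N)
  show "minimization N \<chi> x" if "Sigma_b_1 \<chi>" for \<chi> x using that by (rule minimization_N)
  fix \<sigma> assume "\<sigma> \<in> forall_PVa"
  then obtain xs \<phi> where \<sigma>: "is_formula PVa \<sigma>" "quantifier_free \<phi>" "\<sigma> = alls xs \<phi>" "\<And>\<alpha>. models (std \<alpha>) \<sigma>"
    unfolding forall_PVa_def by blast
  have std: "sat (std \<alpha>) e \<phi>" for \<alpha> e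
  proof -
    have "models (std \<alpha>) \<phi>" using \<sigma>(4)[of \<alpha>] unfolding \<sigma>(3) models_alls .
    then show ?thesis by (simp add: models_def)
  qed
  have "is_formula PVa \<phi>" using \<sigma> by (simp add: is_formula_alls)
  then have "sat N e \<phi>" if "range e \<subseteq> cut" for e
    using gsat_quantifier_free[OF _ \<sigma>(2) that] std by simp
  then show "models N \<sigma>" unfolding \<sigma>(3) models_alls by (simp add: models_def)
qed

end

subsection \<open>The structure coded by the generic oracle\<close>

lemma models_exs:
  assumes "fv (exs ys \<phi>) = {}" "Dom A \<noteq> {}"
  shows "models A (exs ys \<phi>) \<longleftrightarrow> (\<exists>e. range e \<subseteq> Dom A \<and> sat A e \<phi>)"
proof
  obtain a where "a \<in> Dom A" using assms(2) by blast
  then have r: "range (\<lambda>_ :: nat. a) \<subseteq> Dom A" by auto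
  assume "models A (exs ys \<phi>)"
  with r have "sat A (\<lambda>_. a) (exs ys \<phi>)" unfolding models_def by blast
  then show "\<exists>e. range e \<subseteq> Dom A \<and> sat A e \<phi>"
  proof (rule sat_exs_elim[OF _ r])
    fix e' assume "sat A e' \<phi>" "range e' \<subseteq> Dom A"
    then show ?thesis by (intro exI[of _ e'] conjI)
  qed
next
  assume "\<exists>e. range e \<subseteq> Dom A \<and> sat A e \<phi>"
  then obtain e where e: "range e \<subseteq> Dom A" "sat A e \<phi>" by blast
  have "fv (exs ys \<phi>) = fv \<phi> - set ys" by (induction ys) (auto simp: exs_def)
  with assms(1) have fv: "fv \<phi> \<subseteq> set ys" by auto
  show "models A (exs ys \<phi>)"
    unfolding models_def
  proof (intro allI impI)
    fix e' :: "nat \<Rightarrow> _" assume e': "range e' \<subseteq> Dom A"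
    define d where "d = (\<lambda>x. if x \<in> set ys then e x else e' x)"
    have "d x = e x" if "x \<in> fv \<phi>" for x using that fv by (auto simp: d_def)
    then have "sat A d \<phi>" using e(2) sat_cong[of \<phi> d e A] by blast
    then show "sat A e' (exs ys \<phi>)"
      by (rule sat_exs_intro) (use e e' in \<open>auto simp: d_def\<close>)
  qed
qed

context generic
begin

lemma N_pv:
  assumes m: "pv_computes m k G" and as: "set as \<subseteq> cut" "length as = k"
  shows "fn N m as \<in> cut" "eventually (\<lambda>i. fn N m as i = G (at_index i as)) U"
proof -
  have m': "polytime m" "oracle_free m" "arity m = k" "\<And>xs. length xs = k \<Longrightarrow> otm_fun {} m xs = G xs"
    using m by (auto simp: pv_computes_def)
  have len: "length as = arity m" using as m' by simp
  show "fn N m as \<in> cut" by (rule N_fn(1)[OF m'(1) as(1) len])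
  have "eventually (\<lambda>z. fn N m as (snd z) = G (at_index (snd z) as)) gen"
    using N_fn(2)[OF m'(1) as(1) len]
  proof eventually_elim
    case (elim z)
    have "otm_fun (approx z) m (at_index (snd z) as) = G (at_index (snd z) as)"
      using otm_fun_oracle_free[OF m'(2), of "approx z" _ "{}"] m'(4) as(2) by simp
    with elim show ?case by simp
  qed
  then show "eventually (\<lambda>i. fn N m as i = G (at_index i as)) U"
    using gen_U[of "\<lambda>i. fn N m as i = G (at_index i as)"] by simp
qed

abbreviation stage :: "nat \<times> nat \<Rightarrow> (nat \<times> nat) set" where
  "stage z \<equiv> gcond (fst z) (snd z)"

lemma stage_cond: "cond (a (snd z)) (stage z)"
  by (rule gcond_cond)

text \<open>A certificate for the answer to a query must contain that query: otherwise flipping the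
  answer would not leave the cone.\<close>

lemma query_known:
  assumes x: "x \<in> cut"
  shows "eventually (\<lambda>z. x (snd z) \<in> known (a (snd z)) (stage z)) gen"
proof -
  define \<theta> where "\<theta> = Rel Alpha [Var 0 :: otm trm]"
  have sb: "sharply_bounded \<theta>" by (intro sharply_bounded.intros) (auto simp: \<theta>_def)
  let ?\<Phi> = "\<lambda>\<beta> e. of_bool (sat (std \<beta>) e \<theta>) :: nat"
  have pd: "poly_dec (fv \<theta>) ?\<Phi>" by (rule poly_dec_comp[OF poly_dec_sharply_bounded[OF sb]])
  have cong: "?\<Phi> \<beta> e = ?\<Phi> \<beta> e'" if "\<And>x. x \<in> fv \<theta> \<Longrightarrow> e x = e' x" for \<beta> e e'
    using sat_cong[of \<theta> e e' "std \<beta>"] that by simp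
  obtain c where c: "\<forall>e s. (\<forall>x\<in>fv \<theta>. e x \<in> F) \<longrightarrow> eventually (\<lambda>i. bounded_env (fv \<theta>) (s i) (proj e i)) U \<longrightarrow> small s \<longrightarrow>
    (\<exists>y\<in>F. \<exists>k. eventually (\<lambda>i. certified (a i) (gcond k i) ((s i + 2) ^ c)
      (\<lambda>C. \<forall>\<beta>\<in>C. ?\<Phi> \<beta> (proj e i) = y i)) U)"
    using decided[of ?\<Phi> "fv \<theta>", OF functionals_sat pd finite_fv cong] by blast
  have "\<forall>v\<in>fv \<theta>. x \<in> F" using cut_F[OF x] by simp
  moreover have "eventually (\<lambda>i. bounded_env (fv \<theta>) (bitlength (x i)) (proj (\<lambda>_. x) i)) U"
    by (simp add: bounded_env_def proj_def)
  moreover have "small (\<lambda>i. bitlength (x i))" using x by (simp add: cut_def)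
  ultimately have "\<exists>y\<in>F. \<exists>k. eventually (\<lambda>i. certified (a i) (gcond k i) ((bitlength (x i) + 2) ^ c)
      (\<lambda>C. \<forall>\<beta>\<in>C. ?\<Phi> \<beta> (proj (\<lambda>_. x) i) = y i)) U"
    using c[rule_format, of "\<lambda>_. x" "\<lambda>i. bitlength (x i)"] by blast
  then obtain y k where
    "eventually (\<lambda>i. certified (a i) (gcond k i) ((bitlength (x i) + 2) ^ c)
      (\<lambda>C. \<forall>\<beta>\<in>C. ?\<Phi> \<beta> (proj (\<lambda>_. x) i) = y i)) U" by blast
  then have k: "eventually (\<lambda>i. x i \<in> known (a i) (gcond k i)) U"
  proof eventually_elim
    case (elim i)
    then obtain Z where Z: "Z \<subseteq> known (a i) (gcond k i)"
      "\<And>\<beta>. \<beta> \<in> cone Z (gcond k i) \<Longrightarrow> of_bool (x i \<in> \<beta>) = y i"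
      unfolding certified_def by (auto simp: \<theta>_def proj_def)
    have "x i \<in> Z"
    proof (rule ccontr)
      assume "x i \<notin> Z"
      let ?\<beta> = "answers (gcond k i)"
      have "insert (x i) ?\<beta> \<in> cone Z (gcond k i)" "?\<beta> - {x i} \<in> cone Z (gcond k i)"
        using \<open>x i \<notin> Z\<close> by (auto simp: cone_def)
      from Z(2)[OF this(1)] Z(2)[OF this(2)] show False by simp
    qed
    with Z(1) show ?case by blast
  qed
  show ?thesis
    unfolding eventually_gen
  proof (intro exI allI impI)
    fix k' assume "k \<le> k'"
    show "eventually (\<lambda>i. x (snd (k', i)) \<in> known (a (snd (k', i))) (stage (k', i))) U"
      using k by eventually_elim (use known_mono[OF gcond_mono[OF \<open>k \<le> k'\<close>]] in auto)
  qed
qed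

end

locale generic_structure = generic L A \<tau> r U F a for L A \<tau> r U F a +
  fixes P :: pv_names
  assumes names: "valid_names P"
    and tau: "\<And>k. pv_computes (tup P k) k \<tau>"
begin

definition n :: point where
  "n = rep a"

lemma n: "n \<in> cut" "eventually (\<lambda>i. n i = a i) U"
  using rep_a_cut rep(2)[OF a_F] by (auto simp: n_def)

lemma n_gen: "eventually (\<lambda>z. n (snd z) = a (snd z)) gen"
  using n(2) gen_U[of "\<lambda>i. n i = a i"] by simp

lemma numeral_N: "numeral_in P N c \<in> cut" "eventually (\<lambda>i. numeral_in P N c i = c) U"
proof -
  have "pv_computes (num P c) 0 (\<lambda>xs. c)" using names by (simp add: valid_names_def)
  from N_pv[OF this, of "[]"] show "numeral_in P N c \<in> cut" "eventually (\<lambda>i. numeral_in P N c i = c) U"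
    by (simp_all add: numeral_in_def)
qed

lemma n_nonzero: "n \<noteq> numeral_in P N 0"
proof
  assume *: "n = numeral_in P N 0"
  have "eventually (\<lambda>i. 1 \<le> a i) U" using a_top unfolding filterlim_at_top by blast
  with n(2) numeral_N(2)[of 0] have "eventually (\<lambda>i. False) U"
    unfolding *[symmetric] by eventually_elim simp
  then show False using U_nonempty by simp
qed

lemma tuple_N:
  assumes "set as \<subseteq> cut"
  shows "tuple_in P N as \<in> cut" "eventually (\<lambda>z. tuple_in P N as (snd z) = \<tau> (at_index (snd z) as)) gen"
  using N_pv[OF tau[of "length as"] assms] gen_U[of "\<lambda>i. tuple_in P N as i = \<tau> (at_index i as)"]
  by (simp_all add: tuple_in_def)

lemma tuple_symbol:
  fixes S :: nat
  assumes "set as \<subseteq> cut"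
  defines "x \<equiv> tuple_in P N (numeral_in P N S # as)"
  shows "x \<in> cut" "eventually (\<lambda>z. x (snd z) = \<tau> (S # at_index (snd z) as)) gen"
    "x \<in> alpha_of N \<longleftrightarrow> eventually (\<lambda>z. \<tau> (S # at_index (snd z) as) \<in> approx z) gen"
    "eventually (\<lambda>z. \<tau> (S # at_index (snd z) as) \<in> known (a (snd z)) (stage z)) gen"
proof -
  have as: "set (numeral_in P N S # as) \<subseteq> cut" using assms(1) numeral_N by auto
  have "eventually (\<lambda>z. numeral_in P N S (snd z) = S) gen"
    using numeral_N(2)[of S] gen_U[of "\<lambda>i. numeral_in P N S i = S"] by simp
  with tuple_N(2)[OF as] show x: "eventually (\<lambda>z. x (snd z) = \<tau> (S # at_index (snd z) as)) gen"
    unfolding x_def by eventually_elim simp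
  show c: "x \<in> cut" unfolding x_def by (rule tuple_N(1)[OF as])
  then have "x \<in> alpha_of N \<longleftrightarrow> eventually (\<lambda>z. x (snd z) \<in> approx z) gen"
    by (simp add: alpha_of_def)
  also have "\<dots> \<longleftrightarrow> eventually (\<lambda>z. \<tau> (S # at_index (snd z) as) \<in> approx z) gen"
    by (rule eventually_cong[OF x]) simp
  finally show "x \<in> alpha_of N \<longleftrightarrow> eventually (\<lambda>z. \<tau> (S # at_index (snd z) as) \<in> approx z) gen" .
  show "eventually (\<lambda>z. \<tau> (S # at_index (snd z) as) \<in> known (a (snd z)) (stage z)) gen"
    using query_known[OF c] x by eventually_elim simp
qed

abbreviation B :: "(point, nat, nat) struct" where
  "B \<equiv> B_struct P N n (alpha_of N)"

lemma Dom_B: "Dom B = {x \<in> cut. eventually (\<lambda>i. x i < n i) U}"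
  by (simp add: B_struct_def)

lemma Dom_B_cut: "set as \<subseteq> Dom B \<Longrightarrow> set as \<subseteq> cut"
  by (auto simp: Dom_B)

lemma Dom_B_below:
  assumes "set as \<subseteq> Dom B"
  shows "eventually (\<lambda>z. set (at_index (snd z) as) \<subseteq> {..<a (snd z)}) gen"
proof -
  have "eventually (\<lambda>i. \<forall>x\<in>set as. x i < n i) U"
    using assms by (intro eventually_ball_finite) (auto simp: Dom_B)
  then have "eventually (\<lambda>z. \<forall>x\<in>set as. x (snd z) < n (snd z)) gen"
    using gen_U[of "\<lambda>i. \<forall>x\<in>set as. x i < n i"] by simp
  with n_gen show ?thesis by eventually_elim auto
qed

text \<open>The code of the atomic fact is an element of the cut, so late stages know this query and
  give images to the arguments. The query is also decided by \<open>gen\<close>, so the answers at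
  late stages agree with the relation of \<open>B\<close>.\<close>

lemma B_rel:
  assumes R: "R \<in> rels L" "length as = rar L R" and as: "set as \<subseteq> Dom B"
  shows "eventually (\<lambda>z. \<exists>bs. maps (stage z) (at_index (snd z) as) bs \<and> (rl A R bs \<longleftrightarrow> rl B R as)) gen"
proof -
  note x = tuple_symbol[OF Dom_B_cut[OF as], of R]
  let ?x = "tuple_in P N (numeral_in P N R # as)"
  have rl: "rl B R as \<longleftrightarrow> eventually (\<lambda>z. \<tau> (R # at_index (snd z) as) \<in> approx z) gen"
    using x(3) by (simp add: B_struct_def)
  have ex: "eventually (\<lambda>z. \<exists>bs. maps (stage z) (at_index (snd z) as) bs \<and>
      (rl A R bs \<longleftrightarrow> \<tau> (R # at_index (snd z) as) \<in> approx z)) gen"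
    using x(4) Dom_B_below[OF as]
  proof eventually_elim
    case (elim z)
    have len: "length (at_index (snd z) as) = rar L R" using R by simp
    then obtain bs where bs: "maps (stage z) (at_index (snd z) as) bs"
      using elim R(1) unfolding known_def by blast
    with answers_rel[OF stage_cond R(1) len bs] show ?case by (auto simp: approx_def)
  qed
  have "sharply_bounded (Rel Alpha [Var 0 :: otm trm])" by (intro sharply_bounded.intros) auto
  from sharply_bounded_decided[OF this, of "\<lambda>_. ?x"] x(1)
  have "eventually (\<lambda>z. ?x (snd z) \<in> approx z) gen \<or> eventually (\<lambda>z. ?x (snd z) \<notin> approx z) gen"
    by (simp add: proj_def)
  then have "eventually (\<lambda>z. (\<tau> (R # at_index (snd z) as) \<in> approx z) \<longleftrightarrow> rl B R as) gen"
  proof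
    assume "eventually (\<lambda>z. ?x (snd z) \<in> approx z) gen"
    with x(2) have "eventually (\<lambda>z. \<tau> (R # at_index (snd z) as) \<in> approx z) gen" by eventually_elim simp
    with rl show ?thesis by simp
  next
    assume "eventually (\<lambda>z. ?x (snd z) \<notin> approx z) gen"
    with x(2) have *: "eventually (\<lambda>z. \<tau> (R # at_index (snd z) as) \<notin> approx z) gen" by eventually_elim simp
    then have "\<not> rl B R as"
      unfolding rl using gen_not[of "\<lambda>z. \<tau> (R # at_index (snd z) as) \<in> approx z"] by blast
    with * show ?thesis by simp
  qed
  with ex show ?thesis by eventually_elim simp
qed

text \<open>Two different elements differ at some bit for almost every index, and the first such
  position must be found inside \<open>N\<close>. It is a sequence in \<open>F\<close> because
  \<open>ops\<close> contains this search, and it lies below the length of \<open>n\<close> since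
  both numbers are below the corresponding power of 2.\<close>

lemma bits_unique:
  assumes b: "b \<in> cut" "b' \<in> cut"
    and lt: "less_in N b (fn N (pow P) [n])" "less_in N b' (fn N (pow P) [n])"
    and bits: "\<And>i. i \<in> cut \<Longrightarrow> less_in N i (fn N (len P) [n]) \<Longrightarrow>
      fn N (bitf P) [i, b] = numeral_in P N 1 \<longleftrightarrow> fn N (bitf P) [i, b'] = numeral_in P N 1"
  shows "b = b'"
proof (rule ccontr)
  assume "b \<noteq> b'"
  then have ne: "eventually (\<lambda>i. b i \<noteq> b' i) U" using pts_eq_iff[OF cut_pts cut_pts, OF b] U_not by blast
  have pv: "pv_computes (pow P) 1 (\<lambda>xs. 2 ^ bitlength (xs ! 0))" "pv_computes (len P) 1 (\<lambda>xs. bitlength (xs ! 0))"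
    "pv_computes (bitf P) 2 (\<lambda>xs. of_bool (bit (xs ! 1) (xs ! 0)))"
    using names by (auto simp: valid_names_def)
  define j where "j = (\<lambda>i. LEAST j. bit (b i) j \<noteq> bit (b' i) j)"
  have "(\<lambda>xs. LEAST i. bit (xs ! 0) i \<noteq> bit (xs ! 1) i) \<in> ops" unfolding ops_def by blast
  from F(2)[OF this, of "[b, b']"] b cut_F have j: "j \<in> F" by (simp add: j_def)
  have pow: "eventually (\<lambda>i. fn N (pow P) [n] i = 2 ^ bitlength (n i)) U" using N_pv(2)[OF pv(1), of "[n]"] n by simp
  have len: "eventually (\<lambda>i. fn N (len P) [n] i = bitlength (n i)) U" using N_pv(2)[OF pv(2), of "[n]"] n by simp
  have "eventually (\<lambda>i. b i < fn N (pow P) [n] i) U" "eventually (\<lambda>i. b' i < fn N (pow P) [n] i) U" using lt by simp_all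
  with ne pow have jj: "eventually (\<lambda>i. bit (b i) (j i) \<noteq> bit (b' i) (j i) \<and> j i < bitlength (n i)) U"
  proof eventually_elim
    case (elim i)
    then obtain j' where "bit (b i) j' \<noteq> bit (b' i) j'" by (auto simp: bit_eq_iff)
    then have d: "bit (b i) (j i) \<noteq> bit (b' i) (j i)" unfolding j_def by (rule LeastI)
    have high: "\<not> bit c m" if "c < 2 ^ bitlength (n i)" "bitlength (n i) \<le> m" for c m :: nat
    proof -
      have "c < 2 ^ m" using that power_increasing[of "bitlength (n i)" m "2 :: nat"] by linarith
      then show ?thesis by (simp add: bit_iff_odd)
    qed
    have "j i < bitlength (n i)"
    proof (rule ccontr)
      assume "\<not> ?thesis"
      with high[of "b i" "j i"] high[of "b' i" "j i"] elim d show False by simp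
    qed
    with d show ?case by blast
  qed
  have "small (\<lambda>i. bitlength (n i))" using n by (simp add: cut_def)
  then have "small (\<lambda>i. bitlength (j i))"
    by (rule small_below) (use jj in eventually_elim, simp)
  with rep_cut[OF j] have rj: "rep j \<in> cut" by blast
  have jr: "eventually (\<lambda>i. rep j i = j i) U" by (rule rep(2)[OF j])
  have "less_in N (rep j) (fn N (len P) [n])"
  proof -
    have "eventually (\<lambda>i. rep j i < fn N (len P) [n] i) U" using jj jr len by eventually_elim simp
    then show ?thesis by simp
  qed
  from bits[OF rj this]
  have iff: "fn N (bitf P) [rep j, b] = numeral_in P N 1 \<longleftrightarrow> fn N (bitf P) [rep j, b'] = numeral_in P N 1" .
  have bit1: "fn N (bitf P) [rep j, c] = numeral_in P N 1 \<longleftrightarrow> eventually (\<lambda>i. bit (c i) (j i)) U" if c: "c \<in> cut" for c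
  proof -
    have s: "set [rep j, c] \<subseteq> cut" "length [rep j, c] = 2" using rj c by auto
    have "fn N (bitf P) [rep j, c] = numeral_in P N 1 \<longleftrightarrow>
        eventually (\<lambda>i. fn N (bitf P) [rep j, c] i = numeral_in P N 1 i) U"
      by (rule pts_eq_iff[OF cut_pts cut_pts, OF N_pv(1)[OF pv(3) s] numeral_N(1)])
    also have "\<dots> \<longleftrightarrow> eventually (\<lambda>i. bit (c i) (j i)) U"
      by (rule eventually_cong[OF eventually_conj[OF eventually_conj[OF N_pv(2)[OF pv(3) s] numeral_N(2)[of 1]] jr]])
        (simp add: of_bool_def)
    finally show ?thesis .
  qed
  have "eventually (\<lambda>i. bit (b i) (j i)) U \<longleftrightarrow> eventually (\<lambda>i. bit (b' i) (j i)) U"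
    using iff bit1 b by blast
  moreover have "eventually (\<lambda>i. bit (b' i) (j i)) U \<longleftrightarrow> eventually (\<lambda>i. \<not> bit (b i) (j i)) U"
    by (rule eventually_cong[OF jj]) auto
  ultimately show False using U_not[of "\<lambda>i. bit (b i) (j i)"] by blast
qed

text \<open>Knowing any one bit query already puts the function value into the range of a stage. Its
  preimage is a sequence in \<open>F\<close> below \<open>n\<close>, all bits of which the oracle
  answers correctly, so it is the element that \<open>B\<close> assigns.\<close>

lemma B_fun:
  assumes f: "f \<in> funs L" "length as = far L f" and as: "set as \<subseteq> Dom B"
  shows "eventually (\<lambda>z. \<exists>bs. maps (stage z) (at_index (snd z) as) bs \<and> (fn B f as (snd z), fn A f bs) \<in> stage z) gen"
proof -
  note cut = Dom_B_cut[OF as]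
  \<comment> \<open>Bit position 0 is just a convenient choice: whether a bit query of this form is
    known does not depend on the position.\<close>
  have cut0: "set (as @ [numeral_in P N 0]) \<subseteq> cut" using cut numeral_N by auto
  have "eventually (\<lambda>z. \<exists>bs v. maps (stage z) (at_index (snd z) as) bs \<and> (v, fn A f bs) \<in> stage z) gen"
    using tuple_symbol(4)[OF cut0, of f] Dom_B_below[OF as]
  proof eventually_elim
    case (elim z)
    have len: "length (at_index (snd z) as) = far L f" using f by simp
    have "\<tau> (f # at_index (snd z) as @ [numeral_in P N 0 (snd z)]) \<in> known (a (snd z)) (stage z)" using elim(1) by simp
    with elim(2) len f(1) show ?case unfolding known_def by blast
  qed
  then obtain k where k: "eventually (\<lambda>i. \<exists>bs v. maps (gcond k i) (at_index i as) bs \<and> (v, fn A f bs) \<in> gcond k i) U"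
    unfolding eventually_gen by auto
  \<comment> \<open>The preimage is read off from the single stage \<open>k\<close>; it is unique
    there, and later stages keep it.\<close>
  define v where "v = (\<lambda>i. THE v. \<exists>bs. maps (gcond k i) (at_index i as) bs \<and> (v, fn A f bs) \<in> gcond k i)"
  have "(\<lambda>xs. THE v. \<exists>bs. maps (decode (xs ! 0)) (tl xs) bs \<and> (v, fn A f bs) \<in> decode (xs ! 0)) \<in> ops"
    unfolding ops_def by blast
  moreover have "set (chain k # as) \<subseteq> F" using cut cut_F chain_F by auto
  ultimately have "(\<lambda>i. (\<lambda>xs. THE v. \<exists>bs. maps (decode (xs ! 0)) (tl xs) bs \<and> (v, fn A f bs) \<in> decode (xs ! 0))
      (at_index i (chain k # as))) \<in> F" by (rule F(2))
  then have vF: "v \<in> F" by (simp add: v_def gcond_def)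
  have v: "eventually (\<lambda>i. \<exists>bs. maps (gcond k i) (at_index i as) bs \<and> (v i, fn A f bs) \<in> gcond k i) U"
    using k
  proof eventually_elim
    case (elim i)
    then obtain bs w where w: "maps (gcond k i) (at_index i as) bs" "(w, fn A f bs) \<in> gcond k i" by blast
    show ?case unfolding v_def
    proof (rule theI)
      show "\<exists>bs. maps (gcond k i) (at_index i as) bs \<and> (w, fn A f bs) \<in> gcond k i" using w by blast
      fix w' assume "\<exists>bs. maps (gcond k i) (at_index i as) bs \<and> (w', fn A f bs) \<in> gcond k i"
      then show "w' = w" using maps_unique[OF gcond_cond w(1)] cond_inj[OF gcond_cond w(2)] by metis
    qed
  qed
  have va: "eventually (\<lambda>i. v i < n i) U"
    using v n(2)
  proof eventually_elim
    case (elim i)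
    then have "v i \<in> fst ` gcond k i" by force
    then have "v i < a i" using cond_dom[OF gcond_cond[of i k]] by auto
    with elim show ?case by simp
  qed
  define b where "b = rep v"
  have bv: "eventually (\<lambda>i. b i = v i) U" unfolding b_def by (rule rep(2)[OF vF])
  have bn: "eventually (\<lambda>i. b i < n i) U" using va bv by eventually_elim simp
  have "eventually (\<lambda>i. v i \<le> n i) U" using va by eventually_elim simp
  then have b: "b \<in> cut" unfolding b_def by (intro rep_cut[OF vF] cut_downward[OF n(1)])
  have bgen: "eventually (\<lambda>z. \<exists>bs. maps (stage z) (at_index (snd z) as) bs \<and> (b (snd z), fn A f bs) \<in> stage z) gen"
    unfolding eventually_gen
  proof (intro exI allI impI)
    fix k' assume "k \<le> k'"
    show "eventually (\<lambda>i. \<exists>bs. maps (stage (k', i)) (at_index (snd (k', i)) as) bs \<and>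
        (b (snd (k', i)), fn A f bs) \<in> stage (k', i)) U"
      using v bv
    proof eventually_elim
      case (elim i)
      then obtain bs where "maps (gcond k i) (at_index i as) bs" "(b i, fn A f bs) \<in> gcond k i" by auto
      with maps_mono[OF _ gcond_mono[OF \<open>k \<le> k'\<close>]] subsetD[OF gcond_mono[OF \<open>k \<le> k'\<close>]]
      have "maps (gcond k' i) (at_index i as) bs" "(b i, fn A f bs) \<in> gcond k' i" by blast+
      then show ?case by auto
    qed
  qed
  have pv: "pv_computes (pow P) 1 (\<lambda>xs. 2 ^ bitlength (xs ! 0))" "pv_computes (len P) 1 (\<lambda>xs. bitlength (xs ! 0))"
    "pv_computes (bitf P) 2 (\<lambda>xs. of_bool (bit (xs ! 1) (xs ! 0)))" "pv_computes (prd P) 1 (\<lambda>xs. xs ! 0 - 1)"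
    using names by (auto simp: valid_names_def)
  have bpow: "less_in N b (fn N (pow P) [n])"
  proof -
    have "eventually (\<lambda>i. fn N (pow P) [n] i = 2 ^ bitlength (n i)) U" using N_pv(2)[OF pv(1), of "[n]"] n by simp
    with bn have "eventually (\<lambda>i. b i < fn N (pow P) [n] i) U"
      by eventually_elim (use less_two_power_bitlength less_trans in metis)
    then show ?thesis by simp
  qed
  have bits: "fn N (bitf P) [i, b] = numeral_in P N 1 \<longleftrightarrow> tuple_in P N (numeral_in P N f # as @ [i]) \<in> alpha_of N"
    if i: "i \<in> cut" for i
  proof -
    have s: "set [i, b] \<subseteq> cut" "length [i, b] = 2" using i b by auto
    have asi: "set (as @ [i]) \<subseteq> cut" using cut i by auto
    have "fn N (bitf P) [i, b] = numeral_in P N 1 \<longleftrightarrow>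
        eventually (\<lambda>x. fn N (bitf P) [i, b] x = numeral_in P N 1 x) U"
      by (rule pts_eq_iff[OF cut_pts cut_pts, OF N_pv(1)[OF pv(3) s] numeral_N(1)])
    also have "\<dots> \<longleftrightarrow> eventually (\<lambda>x. bit (b x) (i x)) U"
      by (rule eventually_cong[OF eventually_conj[OF N_pv(2)[OF pv(3) s] numeral_N(2)[of 1]]]) (simp add: of_bool_def)
    also have "\<dots> \<longleftrightarrow> eventually (\<lambda>z. bit (b (snd z)) (i (snd z))) gen"
      using gen_U[of "\<lambda>x. bit (b x) (i x)"] by simp
    also have "\<dots> \<longleftrightarrow> eventually (\<lambda>z. \<tau> (f # at_index (snd z) (as @ [i])) \<in> approx z) gen"
    proof (rule eventually_cong[OF bgen])
      fix z assume "\<exists>bs. maps (stage z) (at_index (snd z) as) bs \<and> (b (snd z), fn A f bs) \<in> stage z"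
      then obtain bs where bs: "maps (stage z) (at_index (snd z) as) bs" "(b (snd z), fn A f bs) \<in> stage z" by blast
      have "length (at_index (snd z) as) = far L f" using f by simp
      from answers_fun[OF stage_cond f(1) this bs]
      show "bit (b (snd z)) (i (snd z)) \<longleftrightarrow> \<tau> (f # at_index (snd z) (as @ [i])) \<in> approx z"
        by (simp add: approx_def)
    qed
    also have "\<dots> \<longleftrightarrow> tuple_in P N (numeral_in P N f # as @ [i]) \<in> alpha_of N"
      using tuple_symbol(3)[OF asi, of f] by simp
    finally show ?thesis .
  qed
  have "coded_value P N n (alpha_of N) f as = b"
    unfolding coded_value_def
  proof (rule the_equality)
    show "b \<in> Dom N \<and> less_in N b (fn N (pow P) [n]) \<and> (\<forall>i\<in>Dom N. less_in N i (fn N (len P) [n]) \<longrightarrow>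
        (fn N (bitf P) [i, b] = numeral_in P N 1 \<longleftrightarrow> tuple_in P N (numeral_in P N f # as @ [i]) \<in> alpha_of N))"
      using b bpow bits by (simp del: N_simps(2,3))
  next
    fix b' assume b': "b' \<in> Dom N \<and> less_in N b' (fn N (pow P) [n]) \<and> (\<forall>i\<in>Dom N. less_in N i (fn N (len P) [n]) \<longrightarrow>
        (fn N (bitf P) [i, b'] = numeral_in P N 1 \<longleftrightarrow> tuple_in P N (numeral_in P N f # as @ [i]) \<in> alpha_of N))"
    show "b' = b"
      by (rule bits_unique) (use b' b bpow bits in \<open>simp_all del: N_simps(2,3)\<close>)
  qed
  \<comment> \<open>The truncation in \<open>B_struct\<close> changes nothing: \<open>b\<close> is
    below \<open>n\<close>, so if it is not below the predecessor of \<open>n\<close>, it equals the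
    predecessor.\<close>
  moreover have "(if less_in N b (fn N (prd P) [n]) then b else fn N (prd P) [n]) = b"
  proof (cases "less_in N b (fn N (prd P) [n])")
    case False
    have s: "set [n] \<subseteq> cut" "length [n] = 1" using n by auto
    have "eventually (\<lambda>i. \<not> b i < fn N (prd P) [n] i) U" using False U_not by simp
    with bn N_pv(2)[OF pv(4) s] have "eventually (\<lambda>i. fn N (prd P) [n] i = b i) U"
      by eventually_elim simp
    with pts_eq_iff[OF cut_pts cut_pts, OF N_pv(1)[OF pv(4) s] b] have "fn N (prd P) [n] = b" by blast
    then show ?thesis by simp
  qed simp
  ultimately have "fn B f as = b" unfolding B_struct_def Let_def struct.simps by (simp only:)
  with bgen show ?thesis by simp
qed

text \<open>The elements named by \<open>e\<close> need not occur at the stage yet, so the claim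
  covers every extension of the stage and every assignment \<open>d\<close> matched to
  \<open>e\<close> by that extension. Injectivity of conditions serves the inequalities,
  functionality the equations.\<close>

lemma B_literal:
  assumes l: "literal L l" and e: "range e \<subseteq> Dom B" and sat: "sat B e l"
  shows "eventually (\<lambda>z. \<forall>\<sigma> d. stage z \<subseteq> \<sigma> \<longrightarrow> cond (a (snd z)) \<sigma> \<longrightarrow>
    (\<forall>x\<in>fv l. (proj e (snd z) x, d x) \<in> \<sigma>) \<longrightarrow> sat A d l) gen"
proof -
  have map_e: "at_index i (map e us) = map (proj e i) us" for i us by (simp add: proj_def)
  have sub: "set (map e us) \<subseteq> Dom B" for us using e by auto
  have maps_d: "maps \<sigma> (map (proj e i) us) (map d us)" if "\<forall>x\<in>set us. (proj e i x, d x) \<in> \<sigma>" for \<sigma> i us d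
    using that by (simp add: list_all2_conv_all_nth)
  have dcut: "e u \<in> cut" for u using e Dom_B by auto
  have tm: "map (teval X e') (map Var us) = map e' us" for X :: "('x, nat, nat) struct" and e' us
    by simp
  show ?thesis
    using l
  proof cases
    case (1 R us)
    have "rl B R (map e us)" using sat unfolding 1 sat.simps tm .
    with B_rel[OF 1(2) _ sub, of us] 1(3)
    have "eventually (\<lambda>z. \<exists>bs. maps (stage z) (map (proj e (snd z)) us) bs \<and> rl A R bs) gen"
      unfolding map_e by simp
    then show ?thesis
    proof eventually_elim
      case (elim z)
      then obtain bs where bs: "maps (stage z) (map (proj e (snd z)) us) bs" "rl A R bs" by blast
      show ?case
      proof (intro allI impI)
        fix \<sigma> d assume \<sigma>: "stage z \<subseteq> \<sigma>" "cond (a (snd z)) \<sigma>" "\<forall>x\<in>fv l. (proj e (snd z) x, d x) \<in> \<sigma>"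
        have "map d us = bs"
          using maps_unique[OF \<sigma>(2) maps_d maps_mono[OF bs(1) \<sigma>(1)]] \<sigma>(3) 1(1) by auto
        with bs(2) show "sat A d l" unfolding 1(1) sat.simps tm by simp
      qed
    qed
  next
    case (2 R us)
    have "\<not> rl B R (map e us)" using sat unfolding 2 sat.simps tm .
    with B_rel[OF 2(2) _ sub, of us] 2(3)
    have "eventually (\<lambda>z. \<exists>bs. maps (stage z) (map (proj e (snd z)) us) bs \<and> \<not> rl A R bs) gen"
      unfolding map_e by simp
    then show ?thesis
    proof eventually_elim
      case (elim z)
      then obtain bs where bs: "maps (stage z) (map (proj e (snd z)) us) bs" "\<not> rl A R bs" by blast
      show ?case
      proof (intro allI impI)
        fix \<sigma> d assume \<sigma>: "stage z \<subseteq> \<sigma>" "cond (a (snd z)) \<sigma>" "\<forall>x\<in>fv l. (proj e (snd z) x, d x) \<in> \<sigma>"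
        have "map d us = bs"
          using maps_unique[OF \<sigma>(2) maps_d maps_mono[OF bs(1) \<sigma>(1)]] \<sigma>(3) 2(1) by auto
        with bs(2) show "sat A d l" unfolding 2(1) sat.simps tm by simp
      qed
    qed
  next
    case (3 f us v)
    have "fn B f (map e us) = e v" using sat unfolding 3 sat.simps teval.simps tm .
    with B_fun[OF 3(2) _ sub, of us] 3(3)
    have "eventually (\<lambda>z. \<exists>bs. maps (stage z) (map (proj e (snd z)) us) bs \<and> (proj e (snd z) v, fn A f bs) \<in> stage z) gen"
      unfolding map_e by (simp add: proj_def)
    then show ?thesis
    proof eventually_elim
      case (elim z)
      then obtain bs where bs: "maps (stage z) (map (proj e (snd z)) us) bs" "(proj e (snd z) v, fn A f bs) \<in> stage z" by blast
      show ?case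
      proof (intro allI impI)
        fix \<sigma> d assume \<sigma>: "stage z \<subseteq> \<sigma>" "cond (a (snd z)) \<sigma>" "\<forall>x\<in>fv l. (proj e (snd z) x, d x) \<in> \<sigma>"
        have "map d us = bs"
          using maps_unique[OF \<sigma>(2) maps_d maps_mono[OF bs(1) \<sigma>(1)]] \<sigma>(3) 3(1) by auto
        moreover have "(proj e (snd z) v, d v) \<in> \<sigma>" using \<sigma>(3) 3(1) by simp
        with cond_fun[OF \<sigma>(2)] subsetD[OF \<sigma>(1) bs(2)] have "fn A f bs = d v" by blast
        ultimately show "sat A d l" unfolding 3(1) sat.simps teval.simps tm by simp
      qed
    qed
  next
    case (4 u v)
    have "e u \<noteq> e v" using sat unfolding 4 by simp
    then have "eventually (\<lambda>i. e u i \<noteq> e v i) U"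
      using pts_eq_iff[OF cut_pts cut_pts, OF dcut dcut] U_not by blast
    then have "eventually (\<lambda>z. e u (snd z) \<noteq> e v (snd z)) gen" using gen_U[of "\<lambda>i. e u i \<noteq> e v i"] by simp
    then show ?thesis
    proof eventually_elim
      case (elim z)
      show ?case
      proof (intro allI impI)
        fix \<sigma> d assume \<sigma>: "cond (a (snd z)) \<sigma>" "\<forall>x\<in>fv l. (proj e (snd z) x, d x) \<in> \<sigma>"
        then have "(e u (snd z), d u) \<in> \<sigma>" "(e v (snd z), d v) \<in> \<sigma>" using 4 by (auto simp: proj_def)
        with cond_inj[OF \<sigma>(1)] elim have "d u \<noteq> d v" by metis
        then show "sat A d l" unfolding 4 by simp
      qed
    qed
  next
    case (5 u v)
    have "e u = e v" using sat unfolding 5 by simp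
    then show ?thesis
    proof (intro always_eventually allI impI)
      fix z \<sigma> d assume eq: "e u = e v" and \<sigma>: "cond (a (snd z)) \<sigma>" "\<forall>x\<in>fv l. (proj e (snd z) x, d x) \<in> \<sigma>"
      then have "(e u (snd z), d u) \<in> \<sigma>" "(e u (snd z), d v) \<in> \<sigma>" using 5 by (auto simp: proj_def)
      with cond_fun[OF \<sigma>(1)] have "d u = d v" by metis
      then show "sat A d l" unfolding 5 by simp
    qed
  qed
qed

text \<open>Finitely many literals can be treated at one common stage and index. The condition found
  there is extended to all variables outside the chain, at whatever size, and the images of the
  variables form the assignment into \<open>A\<close>.\<close>

lemma B_conjunction:
  assumes ls: "\<And>l. l \<in> set ls \<Longrightarrow> literal L l" and e: "range e \<subseteq> Dom B" and sat: "\<And>l. l \<in> set ls \<Longrightarrow> sat B e l"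
  shows "\<exists>d. \<forall>l\<in>set ls. sat A d l"
proof -
  obtain vs where vs: "set vs = (\<Union>l\<in>set ls. fv l)" using finite_list[of "\<Union>l\<in>set ls. fv l"] by auto
  have "eventually (\<lambda>z. \<forall>l\<in>set ls. \<forall>\<sigma> d. stage z \<subseteq> \<sigma> \<longrightarrow> cond (a (snd z)) \<sigma> \<longrightarrow>
      (\<forall>x\<in>fv l. (proj e (snd z) x, d x) \<in> \<sigma>) \<longrightarrow> sat A d l) gen"
    by (intro eventually_ball_finite ballI B_literal ls e sat) auto
  moreover have "set (map e vs) \<subseteq> Dom B" using e by auto
  from Dom_B_below[OF this] have "eventually (\<lambda>z. set (map (proj e (snd z)) vs) \<subseteq> {..<a (snd z)}) gen"
    by (simp add: proj_def image_image)
  ultimately have "eventually (\<lambda>z. (\<forall>l\<in>set ls. \<forall>\<sigma> d. stage z \<subseteq> \<sigma> \<longrightarrow> cond (a (snd z)) \<sigma> \<longrightarrow>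
      (\<forall>x\<in>fv l. (proj e (snd z) x, d x) \<in> \<sigma>) \<longrightarrow> sat A d l) \<and>
      set (map (proj e (snd z)) vs) \<subseteq> {..<a (snd z)}) gen" by (rule eventually_conj)
  then obtain z where z: "\<forall>l\<in>set ls. \<forall>\<sigma> d. stage z \<subseteq> \<sigma> \<longrightarrow> cond (a (snd z)) \<sigma> \<longrightarrow>
      (\<forall>x\<in>fv l. (proj e (snd z) x, d x) \<in> \<sigma>) \<longrightarrow> sat A d l"
    "set (map (proj e (snd z)) vs) \<subseteq> {..<a (snd z)}"
    using eventually_happens'[OF gen_nonempty] by blast
  from extend_points[OF stage_cond z(2)] obtain \<sigma> where
    \<sigma>: "stage z \<subseteq> \<sigma>" "cond (a (snd z)) \<sigma>" "set (map (proj e (snd z)) vs) \<subseteq> fst ` \<sigma>" by blast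
  define d where "d = (\<lambda>x. SOME b. (proj e (snd z) x, b) \<in> \<sigma>)"
  have "(proj e (snd z) x, d x) \<in> \<sigma>" if "x \<in> set vs" for x
  proof -
    have "\<exists>b. (proj e (snd z) x, b) \<in> \<sigma>" using subsetD[OF \<sigma>(3), of "proj e (snd z) x"] that by force
    then show ?thesis unfolding d_def by (rule someI_ex)
  qed
  with z(1) \<sigma>(1,2) vs have "\<forall>l\<in>set ls. sat A d l" by blast
  then show ?thesis by (intro exI[of _ d])
qed

lemma B_fails:
  assumes lss: "\<And>ls l. ls \<in> set lss \<Longrightarrow> l \<in> set ls \<Longrightarrow> literal L l"
    and fv: "fv (exs ys (Disj (map Conj lss))) = {}"
    and A: "\<And>d. \<not> sat A d (Disj (map Conj lss))"
  shows "\<not> models B (exs ys (Disj (map Conj lss)))"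
proof -
  have "eventually (\<lambda>i. 1 \<le> a i) U" using a_top unfolding filterlim_at_top by blast
  with n(2) numeral_N(2)[of 0] have "eventually (\<lambda>i. numeral_in P N 0 i < n i) U" by eventually_elim simp
  then have "Dom B \<noteq> {}" using numeral_N(1)[of 0] by (auto simp: Dom_B)
  have False if e: "range e \<subseteq> Dom B" and sat: "sat B e (Disj (map Conj lss))" for e
  proof -
    from sat obtain ls where ls: "ls \<in> set lss" "\<And>l. l \<in> set ls \<Longrightarrow> sat B e l" by auto
    from B_conjunction[OF lss[OF ls(1)] e ls(2)] obtain d where "\<forall>l\<in>set ls. sat A d l" by blast
    with ls(1) A[of d] show False by auto
  qed
  then show ?thesis unfolding models_exs[OF fv \<open>Dom B \<noteq> {}\<close>] by (intro notI) (elim exE conjE)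
qed

lemma witnesses:
  assumes \<psi>: "is_formula PV \<psi>" "\<And>i. sat std_PV (\<lambda>_. a i) \<psi>"
  shows "model_forall_T12_PVa N" "n \<in> Dom N - {numeral_in P N 0}"
    "elementary_embedding PV (\<lambda>c. rep (\<lambda>_. c)) std_PV M" "pv_cut N M"
    "subexponential_in M N n" "sat M (\<lambda>_. n) \<psi>"
proof -
  show "model_forall_T12_PVa N" by (rule model_N)
  show "n \<in> Dom N - {numeral_in P N 0}" using n(1) n_nonzero by simp
  show "elementary_embedding PV (\<lambda>c. rep (\<lambda>_. c)) std_PV M" by (rule elementary_embedding_M)
  show "pv_cut N M" by (rule pv_cut_N)
  show "subexponential_in M N n" using subexponential by (simp add: subexponential_in_def n_def)
  have "eventually (\<lambda>i. sat std_PV (proj (\<lambda>_. n) i) \<psi>) U"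
    using n(2) by eventually_elim (use \<psi>(2) in \<open>simp add: proj_def\<close>)
  moreover have "range (\<lambda>_. n) \<subseteq> pts" using cut_pts[OF n(1)] by auto
  ultimately show "sat M (\<lambda>_. n) \<psi>" by (intro iffD2[OF los[OF \<psi>(1)]])
qed

end

subsection \<open>A countable counterexample\<close>

text \<open>Starting the closure with a countably infinite subset makes the hull a copy of the
  natural numbers. Failure passes to it because the failing matrix is a disjunction of conjunctions
  of literals, whose terms are unnested.\<close>

lemma countable_counterexample:
  fixes A :: "('a, nat, nat) struct"
  assumes L: "finite_language L" and A: "is_struct L A" "infinite (Dom A)"
    and lss: "\<And>ls l. ls \<in> set lss \<Longrightarrow> l \<in> set ls \<Longrightarrow> literal L l"
    and fails: "\<And>e. range e \<subseteq> Dom A \<Longrightarrow> \<not> sat A e (Disj (map Conj lss))"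
  shows "\<exists>A' :: (nat, nat, nat) struct. \<forall>d. \<not> sat A' d (Disj (map Conj lss))"
proof -
  obtain S where S: "S \<subseteq> Dom A" "countable S" "infinite S"
    using infinite_countable_subset'[OF A(2)] by blast
  have "countable (fn A ` funs L)" using L by (simp add: finite_language_def countable_finite)
  from countable_closure[OF this S(2)] obtain T where T: "countable T" "S \<subseteq> T"
    and T': "\<forall>h\<in>fn A ` funs L. \<forall>xs. set xs \<subseteq> T \<longrightarrow> h xs \<in> T" by (elim exE conjE)
  have cl: "fn A f xs \<in> T" if "f \<in> funs L" "set xs \<subseteq> T" for f xs using T' that by simp
  \<comment> \<open>The closure applies the functions to lists of every length and may therefore
    leave the domain; the intersection is still closed at the proper arities.\<close>
  define D where "D = T \<inter> Dom A"
  have "countable D" "infinite D" using T S infinite_super[of S D] by (auto simp: D_def)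
  then have bij: "bij_betw (from_nat_into D) UNIV D" by (rule bij_betw_from_nat_into)
  define g where "g = from_nat_into D"
  have g: "range g = D" "inj g" using bij by (auto simp: g_def bij_betw_def)
  define A' :: "(nat, nat, nat) struct" where
    "A' = \<lparr>Dom = UNIV, fn = (\<lambda>f xs. inv g (fn A f (map g xs))), rl = (\<lambda>R xs. rl A R (map g xs))\<rparr>"
  have fnA': "g (fn A' f xs) = fn A f (map g xs)" if f: "f \<in> funs L" "length xs = far L f" for f xs
  proof -
    have "set (map g xs) \<subseteq> D" using g(1) by auto
    then have "fn A f (map g xs) \<in> D"
      using cl[OF f(1), of "map g xs"] A(1) f unfolding D_def is_struct_def by simp
    with g(1) show ?thesis by (simp add: A'_def f_inv_into_f)
  qed
  have lit: "sat A' d l \<longleftrightarrow> sat A (g \<circ> d) l" if "literal L l" for l d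
    using that
  proof cases
    case (1 R us)
    then show ?thesis by (simp add: A'_def comp_def)
  next
    case (2 R us)
    then show ?thesis by (simp add: A'_def comp_def)
  next
    case (3 f us v)
    have "sat A' d l \<longleftrightarrow> g (fn A' f (map d us)) = g (d v)" using g(2) by (simp add: 3 comp_def inj_eq)
    also have "g (fn A' f (map d us)) = fn A f (map g (map d us))" using fnA' 3 by simp
    finally show ?thesis by (simp add: 3 comp_def)
  next
    case (4 u v)
    then show ?thesis using g(2) by (simp add: inj_eq)
  next
    case (5 u v)
    then show ?thesis using g(2) by (simp add: inj_eq)
  qed
  have "\<not> sat A' d (Disj (map Conj lss))" for d
  proof
    assume "sat A' d (Disj (map Conj lss))"
    then have "sat A (g \<circ> d) (Disj (map Conj lss))" using lit lss by auto
    moreover have "range (g \<circ> d) \<subseteq> Dom A" using g(1) by (auto simp: D_def)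
    ultimately show False using fails by blast
  qed
  then show ?thesis by blast
qed

lemma generic_exists:
  assumes "conditions L \<tau> r" and a: "\<And>i. i \<le> a i"
  shows "\<exists>U F. generic L A \<tau> r U F a"
proof -
  interpret conditions L A \<tau> r by fact
  \<comment> \<open>An ultrafilter finer than the filter of cofinite sets, so that \<open>a\<close>
    still tends to infinity along it.\<close>
  obtain U :: "nat filter" where U: "U \<le> sequentially" "ultrafilter U"
    using ultrafilter_below[OF sequentially_bot] by blast
  have "countable ((\<lambda>h fs i. h (at_index i fs)) ` ops)" by (intro countable_image countable_ops)
  from countable_closure[OF this, of "{a}"] obtain F where
    F: "countable F" "a \<in> F" "\<forall>h\<in>(\<lambda>h fs i. h (at_index i fs)) ` ops. \<forall>fs. set fs \<subseteq> F \<longrightarrow> h fs \<in> F" by auto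
  have "generic L A \<tau> r U F a"
  proof
    show "ultrafilter U" "a \<in> F" "countable F" by fact+
    have "filterlim a at_top sequentially"
      by (rule filterlim_at_top_mono[OF filterlim_ident]) (use a in simp)
    from filterlim_mono[OF this order_refl U(1)] show "filterlim a at_top U" .
    show "(\<lambda>i. h (at_index i fs)) \<in> F" if "h \<in> ops" "set fs \<subseteq> F" for h fs
      using mp[OF spec[OF bspec[OF F(3) imageI[OF that(1)]], of fs] that(2)] .
  qed
  then show ?thesis by blast
qed

theorem theorem6p6:
  fixes L :: "(nat, nat) language"
    and \<phi> :: "(nat, nat) fm"
    and A :: "('a, nat, nat) struct"
    and P :: pv_names
  assumes names: "valid_names P"
    and L: "finite_language L"
    and \<phi>: "basic_sentence L \<phi>"
    and A: "is_struct L A" "infinite (Dom A)" "\<not> models A \<phi>"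
  shows "(\<exists>(N :: (point, otm, pv_rel) struct) n.
            model_forall_T12_PVa N \<and> n \<in> Dom N - {numeral_in P N 0} \<and>
            \<not> models (B_struct P N n (alpha_of N)) \<phi>) \<and>
         (\<forall>\<psi>. is_formula PV \<psi> \<longrightarrow> fv \<psi> \<subseteq> {0} \<longrightarrow>
            (\<forall>k. \<exists>a\<ge>k. sat std_PV (\<lambda>_. a) \<psi>) \<longrightarrow>
            (\<exists>(N :: (point, otm, pv_rel) struct) n (M :: (point, otm, pv_rel) struct) \<iota>.
               model_forall_T12_PVa N \<and> n \<in> Dom N - {numeral_in P N 0} \<and>
               \<not> models (B_struct P N n (alpha_of N)) \<phi> \<and>
               elementary_embedding PV \<iota> std_PV M \<and> pv_cut N M \<and>
               subexponential_in M N n \<and> sat M (\<lambda>_. n) \<psi>))"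
proof -
  obtain ys lss where \<phi>_eq: "\<phi> = exs ys (Disj (map Conj lss))" and fv: "fv (exs ys (Disj (map Conj lss))) = {}"
    and lss: "\<And>ls l. ls \<in> set lss \<Longrightarrow> l \<in> set ls \<Longrightarrow> literal L l"
    using \<phi> unfolding basic_sentence_def by blast
  have "Dom A \<noteq> {}" using A(2) by auto
  then have fails: "\<not> sat A e (Disj (map Conj lss))" if "range e \<subseteq> Dom A" for e
    using A(3) models_exs[OF fv, of A] that unfolding \<phi>_eq by blast
  have "\<exists>A' :: (nat, nat, nat) struct. \<forall>d. \<not> sat A' d (Disj (map Conj lss))"
    by (rule countable_counterexample[OF L A(1,2)]) (use lss fails in blast)+
  then obtain A' :: "(nat, nat, nat) struct" where
    A': "\<And>d. \<not> sat A' d (Disj (map Conj lss))" by blast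
  obtain \<tau> where \<tau>: "inj \<tau>" "\<And>k. pv_computes (tup P k) k \<tau>" using names unfolding valid_names_def by blast
  \<comment> \<open>The inserted 0 keeps the maximum defined for a language without symbols.\<close>
  define r where "r = Max (insert 0 (far L ` funs L \<union> rar L ` rels L))"
  have cond: "conditions L \<tau> r"
    using L \<tau>(1) unfolding finite_language_def by unfold_locales (auto simp: r_def)
  have main: "\<exists>(N :: (point, otm, pv_rel) struct) n (M :: (point, otm, pv_rel) struct) \<iota>.
      model_forall_T12_PVa N \<and> n \<in> Dom N - {numeral_in P N 0} \<and>
      \<not> models (B_struct P N n (alpha_of N)) \<phi> \<and>
      elementary_embedding PV \<iota> std_PV M \<and> pv_cut N M \<and>
      subexponential_in M N n \<and> sat M (\<lambda>_. n) \<psi>"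
    if \<psi>: "is_formula PV \<psi>" "\<forall>k. \<exists>a\<ge>k. sat std_PV (\<lambda>_. a) \<psi>" for \<psi>
  proof -
    obtain a where seq: "\<And>k. k \<le> a k" "\<And>k. sat std_PV (\<lambda>_. a k) \<psi>" using \<psi>(2) by metis
    obtain U F where "generic L A' \<tau> r U F a" using generic_exists[OF cond seq(1)] by blast
    then interpret generic L A' \<tau> r U F a .
    interpret generic_structure L A' \<tau> r U F a P
      by unfold_locales (use names \<tau>(2) in auto)
    have "\<not> models B \<phi>" unfolding \<phi>_eq by (rule B_fails) (use lss fv A' in blast)+
    with witnesses[OF \<psi>(1) seq(2)] show ?thesis by blast
  qed
  \<comment> \<open>The first claim is the second one for the formula x = x, which defines all
    natural numbers.\<close>
  have "\<exists>(N :: (point, otm, pv_rel) struct) n. model_forall_T12_PVa N \<and> n \<in> Dom N - {numeral_in P N 0} \<and>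
      \<not> models (B_struct P N n (alpha_of N)) \<phi>"
    using main[of "Eq (Var 0) (Var 0)"] by auto
  with main show ?thesis by blast
qed

end
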